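(* Let $a,b$ satisfy the Lipschitz condition and the linear-growth bound stated in the context. Let $\boldsymbol\varphi\in\mathbb R^{R\times d}$ have orthonormal rows and let $\boldsymbol\xi\in[L^2(\Omega)]^R$ be $\mathscr F_0$-measurable with linearly independent components. For $T>0$, suppose that $\boldsymbol U,\tilde{\boldsymbol U}\in C([0,T];\mathbb R^{R\times d})$ and $\boldsymbol Y,\tilde{\boldsymbol Y}\in L^2(\Omega;C([0,T];\mathbb R^R))$ satisfy $\boldsymbol U_t=F_1(\boldsymbol U,\boldsymbol Y)(t)$, $\tilde{\boldsymbol U}_t=F_1(\tilde{\boldsymbol U},\tilde{\boldsymbol Y})(t)$, $\boldsymbol Y_t=F_2(\boldsymbol U,\boldsymbol Y)(t)$ and $\tilde{\boldsymbol Y}_t=F_2(\tilde{\boldsymbol U},\tilde{\boldsymbol Y})(t)$ for $t\in[0,T]$, where $F_1,F_2$ are the maps defined in the context (with the same $\boldsymbol\varphi,\boldsymbol\xi$ for both pairs). Then $$\mathbb P\Big(\sup_{0\le t\le T}\|\boldsymbol U_t-\tilde{\boldsymbol U}_t\|_{\mathrm F}^2+\sup_{0\le t\le T}|\boldsymbol Y_t-\tilde{\boldsymbol Y}_t|>0\Big)=0.$$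
   Context: Let $(\Omega,\mathscr F,\mathbb P;(\mathscr F_t)_{t\ge0})$ be a filtered complete probability space with the usual conditions and $W$ a standard $m$-dimensional $(\mathscr F_t)$-Brownian motion. $|\cdot|$ is the Euclidean norm, $\|\cdot\|_{\mathrm F}$ the Frobenius norm, and $R\le d$ are positive integers. $a:[0,\infty)\times\mathbb R^d\to\mathbb R^d$ and $b:[0,\infty)\times\mathbb R^d\to\mathbb R^{d\times m}$ are jointly measurable. Lipschitz condition: for some $C_{\mathrm{Lip}}>0$, $|a(s,x)-a(s,y)|\le C_{\mathrm{Lip}}|x-y|$ and $\|b(s,x)-b(s,y)\|_{\mathrm F}\le C_{\mathrm{Lip}}|x-y|$ for all $s\geq 0$, $x,y\in\mathbb R^d$. Linear-growth bound: for some $C_{\mathrm{lgb}}>0$, $|a(s,x)|^2+\|b(s,x)\|_{\mathrm F}^2\le C_{\mathrm{lgb}}(1+|x|^2)$ for all $s\geq 0$, $x\in\mathbb R^d$. The maps $F_1,F_2$ are defined for $\boldsymbol U\in C([0,t];\mathbb R^{R\times d})$ whose rows are linearly independent at every time and $(\mathscr F_t)$-adapted $\boldsymbol Y\in L^2(\Omega;C([0,t];\mathbb R^R))$ whose components $Y^1_s,\dots,Y^R_s$ are linearly independent in $L^2(\Omega)$ at every time $s$ (being a fixed point of $F_1,F_2$ includes lying in this domain): $$F_1(\boldsymbol U,\boldsymbol Y)(t)=\boldsymbol\varphi+\int_0^tC_{\boldsymbol Y_s}^{-1}\mathbb E[\boldsymbol Y_sa(s,\boldsymbol U_s^\top\boldsymbol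 Y_s)^\top](I_{d\times d}-P^{\mathrm{row}}_{\boldsymbol U_s})\,ds,$$ $$F_2(\boldsymbol U,\boldsymbol Y)(t)=\boldsymbol\xi+\int_0^t\boldsymbol U_sa(s,\boldsymbol U_s^\top\boldsymbol Y_s)\,ds+\int_0^t\boldsymbol U_sb(s,\boldsymbol U_s^\top\boldsymbol Y_s)\,dW_s,$$ where $C_{\boldsymbol Y_s}=\mathbb E[\boldsymbol Y_s\boldsymbol Y_s^\top]$ and $P^{\mathrm{row}}_{\boldsymbol U_s}$ is the orthogonal projection of $\mathbb R^d$ onto the span of the rows of $\boldsymbol U_s$. *)

theory Defs
  imports "HOL-Probability.Probability"
begin

section \<open>Filtered probability spaces and Brownian motion\<close>

text \<open>
  Time is \<open>real\<close>; everything indexed by time is only ever constrained on \<open>[0, \<infinity>)\<close>.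
\<close>

locale usual_filtered_prob_space = prob_space M + complete_measure M
  for M :: "'a measure" +
  fixes F :: "real \<Rightarrow> 'a measure"
  assumes subalgebra_F: "\<And>t. 0 \<le> t \<Longrightarrow> subalgebra M (F t)"
    and mono_F: "\<And>s t. 0 \<le> s \<Longrightarrow> s \<le> t \<Longrightarrow> sets (F s) \<subseteq> sets (F t)"
    and null_sets_F: "null_sets M \<subseteq> sets (F 0)"
    and right_continuous_F: "\<And>t. 0 \<le> t \<Longrightarrow> sets (F t) = (\<Inter>s\<in>{t<..}. sets (F s))"

definition standard_brownian_motion ::
    "'a measure \<Rightarrow> (real \<Rightarrow> 'a measure) \<Rightarrow> (real \<Rightarrow> 'a \<Rightarrow> real^'m) \<Rightarrow> bool" where
  "standard_brownian_motion M F W \<longleftrightarrow>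
     (\<forall>t\<ge>0. W t \<in> borel_measurable (F t)) \<and>
     (AE \<omega> in M. W 0 \<omega> = 0) \<and>
     (AE \<omega> in M. continuous_on {0..} (\<lambda>t. W t \<omega>)) \<and>
     (\<forall>s t. 0 \<le> s \<longrightarrow> s < t \<longrightarrow>
        prob_space.indep_set M (sets (F s))
          (sets (vimage_algebra (space M) (\<lambda>\<omega>. W t \<omega> - W s \<omega>) borel)) \<and>
        distributed M lborel (\<lambda>\<omega>. W t \<omega> - W s \<omega>)
          (\<lambda>x. ennreal (\<Prod>i\<in>UNIV. normal_density 0 (sqrt (t - s)) (x $ i))))"

section \<open>The Ito integral of square-integrable integrands\<close>

text \<open>
  Integrands take values in the matrices \<open>real^'m^'r\<close> (\<open>'r\<close> rows, \<open>'m\<close> columns).  The norm that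
  HOL-Analysis puts on this type is the Frobenius norm.
\<close>

definition progressively_measurable ::
    "(real \<Rightarrow> 'a measure) \<Rightarrow> real \<Rightarrow> (real \<Rightarrow> 'a \<Rightarrow> 'b::topological_space) \<Rightarrow> bool" where
  "progressively_measurable F T H \<longleftrightarrow>
     (\<forall>u\<in>{0..T}. (\<lambda>(s, \<omega>). H s \<omega>) \<in> borel_measurable (restrict_space borel {0..u} \<Otimes>\<^sub>M F u))"

text \<open>
  The triple \<open>(n, \<tau>, h)\<close> stands for the process equal to \<open>h i\<close> on \<open>(\<tau> i, \<tau> (i + 1)]\<close> for \<open>i < n\<close>,
  and zero elsewhere.
\<close>

definition simple_process ::
    "(real \<Rightarrow> 'a measure) \<Rightarrow> real \<Rightarrow> nat \<Rightarrow> (nat \<Rightarrow> real) \<Rightarrow> (nat \<Rightarrow> 'a \<Rightarrow> real^'m^'r) \<Rightarrow> bool" where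
  "simple_process F T n \<tau> h \<longleftrightarrow>
     0 \<le> \<tau> 0 \<and> (\<forall>i<n. \<tau> i \<le> \<tau> (Suc i)) \<and> \<tau> n \<le> T \<and>
     (\<forall>i<n. h i \<in> borel_measurable (F (\<tau> i)) \<and> bounded (h i ` space (F (\<tau> i))))"

definition simple_value ::
    "nat \<Rightarrow> (nat \<Rightarrow> real) \<Rightarrow> (nat \<Rightarrow> 'a \<Rightarrow> real^'m^'r) \<Rightarrow> real \<Rightarrow> 'a \<Rightarrow> real^'m^'r" where
  "simple_value n \<tau> h s \<omega> = (\<Sum>i<n. indicator {\<tau> i<..\<tau> (Suc i)} s *\<^sub>R h i \<omega>)"

definition simple_integral ::
    "(real \<Rightarrow> 'a \<Rightarrow> real^'m) \<Rightarrow> nat \<Rightarrow> (nat \<Rightarrow> real) \<Rightarrow> (nat \<Rightarrow> 'a \<Rightarrow> real^'m^'r) \<Rightarrow> 'a \<Rightarrow> real^'r" where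
  "simple_integral W n \<tau> h \<omega> = (\<Sum>i<n. h i \<omega> *v (W (\<tau> (Suc i)) \<omega> - W (\<tau> i) \<omega>))"

text \<open>
  \<open>has_ito_integral M F W t H I\<close>: the random vector \<open>I\<close> is (a version of) \<open>\<integral>\<^sub>0\<^sup>t H\<^sub>s dW\<^sub>s\<close>, i.e. the
  limit in \<open>L\<^sup>2(\<Omega>)\<close> of the integrals of simple processes which approximate \<open>H\<close> in
  \<open>L\<^sup>2([0,t] \<times> \<Omega>)\<close>.  It is a relation because the integral is only determined up to null sets.
\<close>

definition has_ito_integral ::
    "'a measure \<Rightarrow> (real \<Rightarrow> 'a measure) \<Rightarrow> (real \<Rightarrow> 'a \<Rightarrow> real^'m) \<Rightarrow> real \<Rightarrow>
     (real \<Rightarrow> 'a \<Rightarrow> real^'m^'r) \<Rightarrow> ('a \<Rightarrow> real^'r) \<Rightarrow> bool" where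
  "has_ito_integral M F W t H I \<longleftrightarrow>
     progressively_measurable F t H \<and>
     (\<integral>\<^sup>+\<omega>. (\<integral>\<^sup>+s\<in>{0..t}. ennreal ((norm (H s \<omega>))\<^sup>2) \<partial>lborel) \<partial>M) < \<infinity> \<and>
     I \<in> borel_measurable M \<and>
     (\<exists>n \<tau> h.
        (\<forall>k. simple_process F t (n k) (\<tau> k) (h k)) \<and>
        (\<lambda>k. \<integral>\<^sup>+\<omega>. (\<integral>\<^sup>+s\<in>{0..t}. ennreal ((norm (simple_value (n k) (\<tau> k) (h k) s \<omega> - H s \<omega>))\<^sup>2)
                 \<partial>lborel) \<partial>M) \<longlonglongrightarrow> 0 \<and>
        (\<lambda>k. \<integral>\<^sup>+\<omega>. ennreal ((norm (simple_integral W (n k) (\<tau> k) (h k) \<omega> - I \<omega>))\<^sup>2) \<partial>M)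
          \<longlonglongrightarrow> 0)"

section \<open>Coefficients\<close>

definition jointly_measurable ::
    "(real \<Rightarrow> real^'d \<Rightarrow> 'b::topological_space) \<Rightarrow> bool" where
  "jointly_measurable f \<longleftrightarrow>
     (\<lambda>(s, x). f s x) \<in> borel_measurable (restrict_space borel ({0..} \<times> UNIV))"

definition lipschitz_condition ::
    "real \<Rightarrow> (real \<Rightarrow> real^'d \<Rightarrow> real^'d) \<Rightarrow> (real \<Rightarrow> real^'d \<Rightarrow> real^'m^'d) \<Rightarrow> bool" where
  "lipschitz_condition C a b \<longleftrightarrow>
     (\<forall>s\<ge>0. \<forall>x y. norm (a s x - a s y) \<le> C * norm (x - y) \<and>
                    norm (b s x - b s y) \<le> C * norm (x - y))"

definition linear_growth_bound ::
    "real \<Rightarrow> (real \<Rightarrow> real^'d \<Rightarrow> real^'d) \<Rightarrow> (real \<Rightarrow> real^'d \<Rightarrow> real^'m^'d) \<Rightarrow> bool" where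
  "linear_growth_bound C a b \<longleftrightarrow>
     (\<forall>s\<ge>0. \<forall>x. (norm (a s x))\<^sup>2 + (norm (b s x))\<^sup>2 \<le> C * (1 + (norm x)\<^sup>2))"

section \<open>The maps $F_1$ and $F_2$\<close>

text \<open>
  Independence of the rows as a family: \<open>independent (rows A)\<close> would identify equal rows.
\<close>

definition independent_rows :: "real^'d^'r \<Rightarrow> bool" where
  "independent_rows A \<longleftrightarrow> (\<forall>c. (\<Sum>i\<in>UNIV. c i *\<^sub>R row i A) = 0 \<longrightarrow> (\<forall>i. c i = 0))"

definition orthonormal_rows :: "real^'d^'r \<Rightarrow> bool" where
  "orthonormal_rows A \<longleftrightarrow> (\<forall>i j. row i A \<bullet> row j A = (if i = j then 1 else 0))"

definition independent_components :: "'a measure \<Rightarrow> ('a \<Rightarrow> real^'r) \<Rightarrow> bool" where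
  "independent_components M X \<longleftrightarrow>
     (\<forall>c. (AE \<omega> in M. (\<Sum>i\<in>UNIV. c i * X \<omega> $ i) = 0) \<longrightarrow> (\<forall>i. c i = 0))"

text \<open>
  The orthogonal projection onto the row space, as a symmetric matrix; hence it may be applied to
  row vectors by multiplication from the right.
\<close>

definition proj_row :: "real^'d^'r \<Rightarrow> real^'d^'d" where
  "proj_row A =
     matrix (\<lambda>x. THE p. p \<in> span (rows A) \<and> (\<forall>v\<in>span (rows A). orthogonal (x - p) v))"

definition outer_product :: "real^'r \<Rightarrow> real^'d \<Rightarrow> real^'d^'r" where
  "outer_product v w = (\<chi> i j. v $ i * w $ j)"

definition second_moment_matrix :: "'a measure \<Rightarrow> ('a \<Rightarrow> real^'r) \<Rightarrow> real^'r^'r" where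
  "second_moment_matrix M X = (\<integral>\<omega>. outer_product (X \<omega>) (X \<omega>) \<partial>M)"

definition L2_C :: "'a measure \<Rightarrow> real \<Rightarrow> (real \<Rightarrow> 'a \<Rightarrow> real^'r) \<Rightarrow> bool" where
  "L2_C M T Y \<longleftrightarrow>
     (\<forall>\<omega>\<in>space M. continuous_on {0..T} (\<lambda>t. Y t \<omega>)) \<and>
     (\<forall>t\<in>{0..T}. Y t \<in> borel_measurable M) \<and>
     integrable M (\<lambda>\<omega>. (SUP t\<in>{0..T}. norm (Y t \<omega>))\<^sup>2)"

definition F_domain ::
    "'a measure \<Rightarrow> (real \<Rightarrow> 'a measure) \<Rightarrow> real \<Rightarrow>
     (real \<Rightarrow> real^'d^'r) \<Rightarrow> (real \<Rightarrow> 'a \<Rightarrow> real^'r) \<Rightarrow> bool" where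
  "F_domain M F T U Y \<longleftrightarrow>
     continuous_on {0..T} U \<and> (\<forall>t\<in>{0..T}. independent_rows (U t)) \<and>
     L2_C M T Y \<and> (\<forall>t\<in>{0..T}. Y t \<in> borel_measurable (F t)) \<and>
     (\<forall>t\<in>{0..T}. independent_components M (Y t))"

definition F1 ::
    "'a measure \<Rightarrow> (real \<Rightarrow> real^'d \<Rightarrow> real^'d) \<Rightarrow> real^'d^'r \<Rightarrow>
     (real \<Rightarrow> real^'d^'r) \<Rightarrow> (real \<Rightarrow> 'a \<Rightarrow> real^'r) \<Rightarrow> real \<Rightarrow> real^'d^'r" where
  "F1 M a \<phi> U Y t =
     \<phi> + (LINT s:{0..t}|lborel.
            matrix_inv (second_moment_matrix M (Y s)) **
            (\<integral>\<omega>. outer_product (Y s \<omega>) (a s (transpose (U s) *v Y s \<omega>)) \<partial>M) **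
            (mat 1 - proj_row (U s)))"

text \<open>
  \<open>is_F2 M F W a b \<xi> U Y t Z\<close>: the random vector \<open>Z\<close> is a version of \<open>F\<^sub>2(U, Y)(t)\<close>, which is only
  determined up to null sets.
\<close>

definition is_F2 ::
    "'a measure \<Rightarrow> (real \<Rightarrow> 'a measure) \<Rightarrow> (real \<Rightarrow> 'a \<Rightarrow> real^'m) \<Rightarrow>
     (real \<Rightarrow> real^'d \<Rightarrow> real^'d) \<Rightarrow> (real \<Rightarrow> real^'d \<Rightarrow> real^'m^'d) \<Rightarrow> ('a \<Rightarrow> real^'r) \<Rightarrow>
     (real \<Rightarrow> real^'d^'r) \<Rightarrow> (real \<Rightarrow> 'a \<Rightarrow> real^'r) \<Rightarrow> real \<Rightarrow> ('a \<Rightarrow> real^'r) \<Rightarrow> bool" where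
  "is_F2 M F W a b \<xi> U Y t Z \<longleftrightarrow>
     (\<exists>I. has_ito_integral M F W t (\<lambda>s \<omega>. U s ** b s (transpose (U s) *v Y s \<omega>)) I \<and>
          (AE \<omega> in M. Z \<omega> =
             \<xi> \<omega> + (LINT s:{0..t}|lborel. U s *v a s (transpose (U s) *v Y s \<omega>)) + I \<omega>))"

definition F1_F2_fixed_point ::
    "'a measure \<Rightarrow> (real \<Rightarrow> 'a measure) \<Rightarrow> (real \<Rightarrow> 'a \<Rightarrow> real^'m) \<Rightarrow>
     (real \<Rightarrow> real^'d \<Rightarrow> real^'d) \<Rightarrow> (real \<Rightarrow> real^'d \<Rightarrow> real^'m^'d) \<Rightarrow>
     real^'d^'r \<Rightarrow> ('a \<Rightarrow> real^'r) \<Rightarrow> real \<Rightarrow>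
     (real \<Rightarrow> real^'d^'r) \<Rightarrow> (real \<Rightarrow> 'a \<Rightarrow> real^'r) \<Rightarrow> bool" where
  "F1_F2_fixed_point M F W a b \<phi> \<xi> T U Y \<longleftrightarrow>
     F_domain M F T U Y \<and>
     (\<forall>t\<in>{0..T}. U t = F1 M a \<phi> U Y t) \<and>
     (\<forall>t\<in>{0..T}. is_F2 M F W a b \<xi> U Y t (Y t))"

end

theory Submission
  imports Defs
begin

text \<open>
  Uniqueness is a Gronwall argument for the function
  \<open>gap t = \<parallel>U t - U' t\<parallel>\<^sup>2 + \<bbbE> |Y t - Y' t|\<^sup>2\<close>, which is continuous on \<open>[0,T]\<close> by dominated
  convergence.  The two maps \<open>F\<^sub>1\<close> and \<open>F\<^sub>2\<close> are only locally Lipschitz in \<open>(U, Y)\<close>, because they contain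
  products of unknowns and the inverses of \<open>C\<^sub>Y\<close> and of the Gram matrix \<open>U U\<^sup>T\<close>.  Along two given
  solutions this is harmless: \<open>U\<close>, \<open>C\<^sub>Y\<close> and \<open>U U\<^sup>T\<close> are continuous on a compact interval, and linear
  independence makes the latter two invertible at every time, so all the factors and the inverses are
  bounded on \<open>[0,T]\<close> (\<open>matrix_inv_bounded_on_compact\<close>, \<open>factors_bounded\<close>), and the local Lipschitz
  constants can be chosen uniformly in time.

  For the modes, the integrand of \<open>F\<^sub>1\<close> is the product of \<open>C\<^sub>Y\<^sup>-\<^sup>1\<close>, \<open>\<bbbE>[Y a\<^sup>T]\<close> and \<open>I - P\<close>.  Each factor is
  bounded, and its difference between the two solutions is at most a constant times
  \<open>\<parallel>U - U'\<parallel> + (\<bbbE> |Y - Y'|\<^sup>2)\<^sup>1\<^sup>/\<^sup>2\<close>; for \<open>P\<close> this uses \<open>P = U\<^sup>T (U U\<^sup>T)\<^sup>-\<^sup>1 U\<close> (\<open>proj_row_eq\<close>), and for the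
  expectations the Cauchy--Schwarz inequality (\<open>expectation_diff_le\<close>).  For the stochastic factors, drift
  and diffusion differ in square by at most a constant times
  \<open>\<parallel>U - U'\<parallel>\<^sup>2 (1 + |Y|\<^sup>2) + |Y - Y'|\<^sup>2\<close>, whose expectation is controlled by the gap because \<open>U\<close> is
  deterministic (\<open>increment_mean_square_le\<close>).  The drift integral is then estimated by Cauchy--Schwarz in
  time, and the stochastic integral by \<open>ito_integral_diff_le\<close>.

  The last estimate is the Ito isometry up to a constant.  The stochastic integral is given as an
  \<open>L\<^sup>2\<close> limit of integrals of step processes, and the two approximating sequences use unrelated time
  grids.  The isometry is therefore proved for arbitrary finite families of step functions supported on
  possibly overlapping intervals (\<open>ito_isometry_step_family\<close>): both sides are expanded bilinearly, and
  everything reduces to the expectation of a product of two increments with adapted weights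
  (\<open>integral_mult_increments\<close>).

  Altogether \<open>gap t \<le> K \<integral>\<^sub>0\<^sup>t gap\<close>, so the gap vanishes.  Thus \<open>U = U'\<close>, and \<open>Y t = Y' t\<close> almost surely for
  each fixed \<open>t\<close>; taking rational times and using the continuity of all paths gives one null set outside
  which the paths coincide, and completeness of the space makes the exceptional set of the theorem itself
  a null set.
\<close>

section \<open>A Gronwall lemma\<close>

text \<open>
  Let \<open>m\<close> be the maximum over \<open>[0,T]\<close> of \<open>e\<^sup>-\<^sup>2\<^sup>K\<^sup>t g(t)\<close>, attained at \<open>s\<close>.  Inserting \<open>g(u) \<le> m e\<^sup>2\<^sup>K\<^sup>u\<close> in the
  hypothesis at time \<open>s\<close> gives \<open>m e\<^sup>2\<^sup>K\<^sup>s \<le> m (e\<^sup>2\<^sup>K\<^sup>s - 1) / 2\<close>, which forces \<open>m \<le> 0\<close>.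
\<close>

lemma gronwall_zero:
  fixes g :: "real \<Rightarrow> real"
  assumes cont: "continuous_on {0..T} g" and "0 < K"
    and bound: "\<And>t. t \<in> {0..T} \<Longrightarrow> g t \<le> K * integral {0..t} g"
    and t: "t \<in> {0..T}"
  shows "g t \<le> 0"
proof -
  define h where "h s = exp (- 2 * K * s) * g s" for s
  have "continuous_on {0..T} h"
    unfolding h_def by (intro continuous_intros cont)
  then obtain s where s: "s \<in> {0..T}" and smax: "\<And>u. u \<in> {0..T} \<Longrightarrow> h u \<le> h s"
    using continuous_attains_sup[of "{0..T}" h] t by auto
  have g_le: "g u \<le> h s * exp (2 * K * u)" if "u \<in> {0..T}" for u
  proof -
    have "g u = h u * exp (2 * K * u)"
      by (simp add: h_def flip: exp_add)
    then show ?thesis using smax[OF that] by simp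
  qed
  have exp_int: "((\<lambda>u. h s * exp (2 * K * u)) has_integral
        h s * exp (2 * K * s) / (2 * K) - h s * exp (2 * K * 0) / (2 * K)) {0..s}"
    using s \<open>0 < K\<close>
    by (intro fundamental_theorem_of_calculus)
       (auto intro!: derivative_eq_intros simp flip: has_real_derivative_iff_has_vector_derivative)
  have "g s \<le> K * integral {0..s} g"
    using bound s by simp
  also have "integral {0..s} g \<le> h s * exp (2 * K * s) / (2 * K) - h s * exp (2 * K * 0) / (2 * K)"
    using s g_le
    by (intro integral_le[OF _ _ , THEN order_trans[OF _ eq_refl[OF integral_unique[OF exp_int]]]]
         integrable_continuous_interval continuous_on_subset[OF cont] has_integral_integrable[OF exp_int]) auto
  also have "K * \<dots> = (h s * exp (2 * K * s) - h s) / 2"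
    using \<open>0 < K\<close> by (simp add: field_simps)
  finally have "g s \<le> (h s * exp (2 * K * s) - h s) / 2"
    using \<open>0 < K\<close> by simp
  moreover have "g s = h s * exp (2 * K * s)"
    by (simp add: h_def flip: exp_add)
  ultimately have "h s * (exp (2 * K * s) + 1) \<le> 0"
    by (simp add: algebra_simps)
  then have "h s \<le> 0"
    by (metis add_pos_pos exp_gt_zero mult_pos_pos not_le zero_less_one)
  with g_le[OF t] show ?thesis
    by (meson exp_ge_zero mult_nonpos_nonneg order_trans)
qed

section \<open>The Frobenius norm, matrix inverses and the row projection\<close>

lemma borel_measurable_bounded_bilinear:
  fixes p :: "'b::{real_normed_vector, second_countable_topology} \<Rightarrow>
      'c::{real_normed_vector, second_countable_topology} \<Rightarrow> 'd::real_normed_vector"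
  assumes "bounded_bilinear p" "f \<in> borel_measurable N" "g \<in> borel_measurable N"
  shows "(\<lambda>x. p (f x) (g x)) \<in> borel_measurable N"
  by (rule borel_measurable_continuous_Pair[OF assms(2,3)])
     (intro bounded_bilinear.continuous_on[OF assms(1)] continuous_intros)

text \<open>
  The norm of a matrix is the Frobenius norm; the bound is the Cauchy--Schwarz inequality in each row.
\<close>

lemma norm_matrix_vector_mult_le:
  fixes A :: "real^'n^'m"
  shows "norm (A *v x) \<le> norm A * norm x"
proof -
  have "norm (A *v x) \<le> L2_set (\<lambda>i. norm (A $ i) * norm x) UNIV"
    unfolding norm_vec_def[of "A *v x"]
    by (rule L2_set_mono) (simp_all add: matrix_vector_mul_component Cauchy_Schwarz_ineq2)
  also have "\<dots> = norm A * norm x"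
    by (simp add: norm_vec_def[of A] L2_set_right_distrib[symmetric] L2_set_left_distrib)
  finally show ?thesis .
qed

lemma norm_transpose:
  fixes A :: "real^'n^'m"
  shows "norm (transpose A) = norm A"
proof -
  have "(norm (transpose A))\<^sup>2 = (norm A)\<^sup>2"
    unfolding power2_norm_eq_inner inner_vec_def transpose_def
    by (simp, rule sum.swap)
  then show ?thesis by simp
qed

lemma norm_matrix_mult_le:
  fixes A :: "real^'n^'m" and B :: "real^'p^'n"
  shows "norm (A ** B) \<le> norm A * norm B"
proof -
  have "norm ((A ** B) $ i) \<le> norm (A $ i) * norm B" for i
  proof -
    have "(A ** B) $ i = transpose B *v (A $ i)"
      by (simp add: matrix_matrix_mult_def matrix_vector_mult_def transpose_def vec_eq_iff mult.commute)
    then show ?thesis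
      using norm_matrix_vector_mult_le[of "transpose B" "A $ i"]
      by (simp add: norm_transpose mult.commute)
  qed
  then have "norm (A ** B) \<le> L2_set (\<lambda>i. norm (A $ i) * norm B) UNIV"
    unfolding norm_vec_def[of "A ** B"] by (intro L2_set_mono) auto
  also have "\<dots> = norm A * norm B"
    by (simp add: norm_vec_def[of A] L2_set_left_distrib)
  finally show ?thesis .
qed

lemma bounded_bilinear_matrix_mult:
  "bounded_bilinear ((**) :: real^'n^'m \<Rightarrow> real^'p^'n \<Rightarrow> real^'p^'m)"
proof
  show "\<exists>K. \<forall>(a::real^'n^'m) (b::real^'p^'n). norm (a ** b) \<le> norm a * norm b * K"
    by (rule exI[of _ 1]) (simp add: norm_matrix_mult_le)
qed (simp_all add: matrix_matrix_mult_def vec_eq_iff sum.distrib algebra_simps sum_distrib_left)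

lemma bounded_bilinear_matrix_vector_mult:
  "bounded_bilinear ((*v) :: real^'n^'m \<Rightarrow> real^'n \<Rightarrow> real^'m)"
proof
  show "\<exists>K. \<forall>(a::real^'n^'m) b. norm (a *v b) \<le> norm a * norm b * K"
    by (rule exI[of _ 1]) (simp add: norm_matrix_vector_mult_le)
qed (simp_all add: matrix_vector_mult_def vec_eq_iff sum.distrib algebra_simps sum_distrib_left)

lemma norm_outer_product:
  fixes v :: "real^'r" and w :: "real^'d"
  shows "norm (outer_product v w) = norm v * norm w"
proof -
  have "(norm (outer_product v w))\<^sup>2 = (norm v * norm w)\<^sup>2"
    unfolding power2_norm_eq_inner power_mult_distrib inner_vec_def outer_product_def
    by (simp add: sum_product inner_real_def) (rule sum.cong[OF refl], rule sum.cong[OF refl], simp add: algebra_simps)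
  then show ?thesis by (simp add: power2_eq_iff_nonneg)
qed

lemma bounded_bilinear_outer_product:
  "bounded_bilinear (outer_product :: real^'r \<Rightarrow> real^'d \<Rightarrow> real^'d^'r)"
proof
  show "\<exists>K. \<forall>(a::real^'r) (b::real^'d). norm (outer_product a b) \<le> norm a * norm b * K"
    by (rule exI[of _ 1]) (simp add: norm_outer_product)
qed (simp_all add: outer_product_def vec_eq_iff algebra_simps)

lemma bounded_linear_transpose: "bounded_linear (transpose :: real^'n^'m \<Rightarrow> real^'m^'n)"
  by (rule bounded_linear_intro[of _ 1])
     (simp_all add: norm_transpose, simp_all add: transpose_def vec_eq_iff)

lemma matrix_inv_mult:
  fixes A :: "real^'n^'n"
  assumes "invertible A"
  shows "A ** matrix_inv A = mat 1" "matrix_inv A ** A = mat 1"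
  using someI_ex[OF assms[unfolded invertible_def]] unfolding matrix_inv_def by auto

lemma invertible_iff_trivial_kernel:
  fixes A :: "real^'n^'n"
  shows "invertible A \<longleftrightarrow> (\<forall>x. A *v x = 0 \<longrightarrow> x = 0)"
  by (simp add: invertible_left_inverse matrix_left_invertible_ker)

text \<open>
  The resolvent identity \<open>A\<^sup>-\<^sup>1 - B\<^sup>-\<^sup>1 = A\<^sup>-\<^sup>1 (B - A) B\<^sup>-\<^sup>1\<close>.  Together with a uniform bound on the inverses it
  makes inversion Lipschitz, which serves both for continuity in time and for comparing two solutions.
\<close>

lemma norm_matrix_inv_diff_le:
  fixes A B :: "real^'n^'n"
  assumes "invertible A" "invertible B"
  shows "norm (matrix_inv A - matrix_inv B) \<le> norm (matrix_inv A) * norm (matrix_inv B) * norm (A - B)"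
proof -
  interpret mm: bounded_bilinear "(**) :: real^'n^'n \<Rightarrow> real^'n^'n \<Rightarrow> real^'n^'n"
    by (rule bounded_bilinear_matrix_mult)
  have "matrix_inv A - matrix_inv B = matrix_inv A ** (B - A) ** matrix_inv B"
    using matrix_inv_mult[OF assms(1)] matrix_inv_mult[OF assms(2)]
    by (simp add: mm.diff_left mm.diff_right flip: matrix_mul_assoc)
  then have "norm (matrix_inv A - matrix_inv B) \<le> norm (matrix_inv A ** (B - A)) * norm (matrix_inv B)"
    by (simp add: norm_matrix_mult_le)
  also have "\<dots> \<le> (norm (matrix_inv A) * norm (B - A)) * norm (matrix_inv B)"
    by (intro mult_right_mono norm_matrix_mult_le) auto
  finally show ?thesis
    by (simp add: norm_minus_commute algebra_simps)
qed

lemma norm_matrix_le_sum_axis: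
  fixes A :: "real^'n^'m"
  shows "norm A \<le> (\<Sum>j\<in>UNIV. norm (A *v axis j 1))"
proof -
  have "norm A = norm (transpose A)" by (simp add: norm_transpose)
  also have "\<dots> \<le> (\<Sum>j\<in>UNIV. norm (transpose A $ j))"
    unfolding norm_vec_def[of "transpose A"] by (rule L2_set_le_sum) simp
  also have "\<dots> = (\<Sum>j\<in>UNIV. norm (A *v axis j 1))"
    by (simp add: matrix_vector_mult_basis row_transpose flip: row_def)
       (simp add: row_def column_def transpose_def)
  finally show ?thesis .
qed

text \<open>
  The function \<open>(s, x) \<mapsto> |A(s) x|\<close> is continuous and positive on the product of \<open>S\<close> with the unit
  sphere, hence bounded below there by some \<open>c > 0\<close>; the columns of the inverses then have norm at
  most \<open>1/c\<close>.
\<close>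

lemma matrix_inv_bounded_on_compact:
  fixes A :: "'t::topological_space \<Rightarrow> real^'n^'n"
  assumes S: "compact S" and cont: "continuous_on S A" and inv: "\<And>s. s \<in> S \<Longrightarrow> invertible (A s)"
  obtains K where "\<And>s. s \<in> S \<Longrightarrow> norm (matrix_inv (A s)) \<le> K"
proof (cases "S = {}")
  case False
  define D where "D = S \<times> sphere (0 :: real^'n) 1"
  interpret mv: bounded_bilinear "(*v) :: real^'n^'n \<Rightarrow> real^'n \<Rightarrow> real^'n"
    by (rule bounded_bilinear_matrix_vector_mult)
  have "axis undefined 1 \<in> sphere (0 :: real^'n) 1"
    by simp
  \<comment> \<open>\<open>D\<close> is nonempty because a unit vector exists, so the infimum below is attained.\<close>
  then have "D \<noteq> {}" using False unfolding D_def by blast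
  moreover have "compact D"
    unfolding D_def by (intro compact_Times S) simp
  moreover have "continuous_on D (\<lambda>p. norm (A (fst p) *v snd p))"
    unfolding D_def
    by (intro continuous_on_norm mv.continuous_on continuous_on_snd continuous_on_id
          continuous_on_compose2[OF cont] continuous_on_fst) auto
  ultimately obtain p where p: "p \<in> D" "\<And>q. q \<in> D \<Longrightarrow> norm (A (fst p) *v snd p) \<le> norm (A (fst q) *v snd q)"
    using continuous_attains_inf[of D] by blast
  define c where "c = norm (A (fst p) *v snd p)"
  have "snd p \<noteq> 0" and "fst p \<in> S" using p(1) by (auto simp: D_def)
  then have c: "c > 0"
    using inv unfolding c_def invertible_iff_trivial_kernel by auto
  have lower: "c * norm x \<le> norm (A s *v x)" if s: "s \<in> S" for s x
  proof (cases "x = 0")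
    case False
    have "(s, x /\<^sub>R norm x) \<in> D" using s False by (simp add: D_def)
    from p(2)[OF this] have "c \<le> norm (A s *v x) / norm x"
      by (simp add: c_def mv.scaleR_right divide_inverse_commute)
    then show ?thesis using False by (simp add: field_simps)
  qed simp
  have "norm (matrix_inv (A s)) \<le> (\<Sum>j\<in>(UNIV::'n set). 1 / c)" if s: "s \<in> S" for s
  proof -
    have "norm (matrix_inv (A s)) \<le> (\<Sum>j\<in>UNIV. norm (matrix_inv (A s) *v axis j 1))"
      by (rule norm_matrix_le_sum_axis)
    also have "\<dots> \<le> (\<Sum>j\<in>(UNIV::'n set). 1 / c)"
    proof (rule sum_mono)
      fix j :: 'n
      have "c * norm (matrix_inv (A s) *v axis j 1) \<le> norm (A s *v (matrix_inv (A s) *v axis j 1))"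
        by (rule lower[OF s])
      also have "\<dots> = 1"
        by (simp add: matrix_vector_mul_assoc matrix_inv_mult[OF inv[OF s]])
      finally show "norm (matrix_inv (A s) *v axis j 1) \<le> 1 / c"
        using c by (simp add: field_simps)
    qed
    finally show ?thesis .
  qed
  then show ?thesis by (rule that)
qed (use that in auto)

lemma continuous_on_matrix_inv:
  fixes A :: "'t::topological_space \<Rightarrow> real^'n^'n"
  assumes S: "compact S" and cont: "continuous_on S A" and inv: "\<And>s. s \<in> S \<Longrightarrow> invertible (A s)"
  shows "continuous_on S (\<lambda>s. matrix_inv (A s))"
proof -
  obtain K where K: "\<And>s. s \<in> S \<Longrightarrow> norm (matrix_inv (A s)) \<le> K"
    using matrix_inv_bounded_on_compact[OF assms] by blast
  have bound: "norm (matrix_inv (A t) - matrix_inv (A s)) \<le> K * K * norm (A t - A s)"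
    if st: "s \<in> S" "t \<in> S" for s t
  proof -
    have "0 \<le> K" using K[OF st(1)] norm_ge_zero order_trans by blast
    then have "norm (matrix_inv (A t)) * norm (matrix_inv (A s)) * norm (A t - A s) \<le> K * K * norm (A t - A s)"
      using K st by (intro mult_right_mono mult_mono) auto
    with norm_matrix_inv_diff_le[OF inv inv, OF st(2,1)] show ?thesis by linarith
  qed
  show ?thesis
    unfolding continuous_on_def
  proof
    fix s assume s: "s \<in> S"
    have "((\<lambda>t. K * K * norm (A t - A s)) \<longlongrightarrow> K * K * norm (A s - A s)) (at s within S)"
      using cont s by (intro tendsto_intros) (auto simp: continuous_on_def)
    then have lim: "((\<lambda>t. K * K * norm (A t - A s)) \<longlongrightarrow> 0) (at s within S)"
      by simp
    have "eventually (\<lambda>t. norm (matrix_inv (A t) - matrix_inv (A s)) \<le> K * K * norm (A t - A s)) (at s within S)"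
      unfolding eventually_at_filter by (rule always_eventually) (use bound s in blast)
    from Lim_null_comparison[OF this lim]
    have "((\<lambda>t. matrix_inv (A t) - matrix_inv (A s)) \<longlongrightarrow> 0) (at s within S)" .
    then show "((\<lambda>t. matrix_inv (A t)) \<longlongrightarrow> matrix_inv (A s)) (at s within S)"
      by (rule LIM_zero_cancel)
  qed
qed

lemma transpose_mult_eq_row_sum:
  fixes A :: "real^'d^'r"
  shows "transpose A *v c = (\<Sum>i\<in>UNIV. c $ i *\<^sub>R row i A)"
  by (simp add: matrix_vector_mult_def transpose_def vec_eq_iff row_def mult.commute)

lemma independent_rows_iff_transpose_kernel:
  fixes A :: "real^'d^'r"
  shows "independent_rows A \<longleftrightarrow> (\<forall>x. transpose A *v x = 0 \<longrightarrow> x = 0)"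
proof safe
  fix x assume A: "independent_rows A" and "transpose A *v x = 0"
  then have "\<forall>i. x $ i = 0"
    unfolding independent_rows_def transpose_mult_eq_row_sum by blast
  then show "x = 0" by (simp add: vec_eq_iff)
next
  assume inj: "\<forall>x. transpose A *v x = 0 \<longrightarrow> x = 0"
  show "independent_rows A"
    unfolding independent_rows_def
  proof (intro allI impI)
    fix c i assume "(\<Sum>i\<in>UNIV. c i *\<^sub>R row i A) = 0"
    then have "transpose A *v (\<chi> i. c i) = 0"
      unfolding transpose_mult_eq_row_sum by simp
    with inj show "c i = 0" by (metis vec_lambda_beta zero_index)
  qed
qed

text \<open>
  \<open>x \<bullet> (A A\<^sup>T x) = |A\<^sup>T x|\<^sup>2\<close>, and \<open>A\<^sup>T x\<close> is the combination of the rows of \<open>A\<close> with coefficients \<open>x\<close>.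
\<close>

lemma invertible_gram:
  fixes A :: "real^'d^'r"
  assumes "independent_rows A"
  shows "invertible (A ** transpose A)"
  unfolding invertible_iff_trivial_kernel
proof safe
  fix x assume "(A ** transpose A) *v x = 0"
  then have "x \<bullet> (A *v (transpose A *v x)) = 0"
    by (simp only: matrix_vector_mul_assoc inner_zero_right)
  then have "(transpose A *v x) \<bullet> (transpose A *v x) = 0"
    by (simp add: dot_lmul_matrix)
  then show "x = 0" using assms by (auto simp only: independent_rows_iff_transpose_kernel inner_eq_zero_iff)
qed

text \<open>
  This formula turns the projection, defined by a unique-existence property, into an expression whose
  dependence on \<open>A\<close> is visibly continuous and locally Lipschitz.
\<close>

lemma proj_row_eq:
  fixes A :: "real^'d^'r"
  assumes "independent_rows A"
  shows "proj_row A = transpose A ** matrix_inv (A ** transpose A) ** A"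
    (is "_ = ?P")
proof -
  have "(THE p. p \<in> span (rows A) \<and> (\<forall>v\<in>span (rows A). orthogonal (x - p) v)) = ?P *v x" for x
  proof (rule the_equality)
    have "?P *v x = transpose A *v (matrix_inv (A ** transpose A) *v (A *v x))"
      by (simp only: matrix_vector_mul_assoc matrix_mul_assoc)
    then have mem: "?P *v x \<in> span (rows A)"
      unfolding transpose_mult_eq_row_sum
      by (simp only:) (intro span_sum span_scale span_base, auto simp: rows_def)
    have "A ** ?P = A"
      by (simp add: matrix_mul_assoc matrix_inv_mult[OF invertible_gram[OF assms]])
    then have "A *v (x - ?P *v x) = 0"
      by (simp add: matrix_vector_mult_diff_distrib matrix_vector_mul_assoc)
    then have "(A *v (x - ?P *v x)) $ i = 0" for i
      by simp
    then have row: "orthogonal (x - ?P *v x) (row i A)" for i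
      by (simp add: matrix_vector_mul_component orthogonal_def row_def inner_commute)
    have orth: "\<forall>v\<in>span (rows A). orthogonal (x - ?P *v x) v"
    proof
      fix v assume "v \<in> span (rows A)"
      then show "orthogonal (x - ?P *v x) v"
      proof (rule orthogonal_to_span)
        fix y assume "y \<in> rows A"
        then obtain i where "y = row i A" unfolding rows_def by blast
        then show "orthogonal (x - ?P *v x) y" by (simp only: row)
      qed
    qed
    show "?P *v x \<in> span (rows A) \<and> (\<forall>v\<in>span (rows A). orthogonal (x - ?P *v x) v)"
      using mem orth by blast
    fix p assume p: "p \<in> span (rows A) \<and> (\<forall>v\<in>span (rows A). orthogonal (x - p) v)"
    define w where "w = ?P *v x - p"
    \<comment> \<open>The difference of two projections lies in the row space and is orthogonal to it.\<close>
    have "w \<in> span (rows A)" using p mem by (simp add: span_diff w_def)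
    then have "(x - p) \<bullet> w = 0" "(x - ?P *v x) \<bullet> w = 0"
      using p orth by (auto simp: orthogonal_def)
    then have "w \<bullet> w = 0"
      by (simp add: w_def inner_diff_left)
    then show "p = ?P *v x" by (simp add: w_def)
  qed
  then show ?thesis
    unfolding proj_row_def by simp
qed

lemma norm_triple_product_diff_le:
  fixes A A' :: "real^'b^'a" and B B' :: "real^'c^'b" and C C' :: "real^'d^'c"
  assumes "norm A \<le> K" "norm A' \<le> K" "norm B \<le> K" "norm B' \<le> K" "norm C \<le> K" "norm C' \<le> K"
  shows "norm (A ** B ** C - A' ** B' ** C') \<le> K\<^sup>2 * (norm (A - A') + norm (B - B') + norm (C - C'))"
proof -
  interpret m1: bounded_bilinear "(**) :: real^'b^'a \<Rightarrow> real^'c^'b \<Rightarrow> real^'c^'a"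
    by (rule bounded_bilinear_matrix_mult)
  interpret m2: bounded_bilinear "(**) :: real^'c^'a \<Rightarrow> real^'d^'c \<Rightarrow> real^'d^'a"
    by (rule bounded_bilinear_matrix_mult)
  have triple: "norm (X ** Y ** Z) \<le> norm X * norm Y * norm Z"
    for X :: "real^'b^'a" and Y :: "real^'c^'b" and Z :: "real^'d^'c"
    by (meson norm_matrix_mult_le mult_right_mono norm_ge_zero order_trans)
  have K: "0 \<le> K" using assms(1) norm_ge_zero order_trans by blast
  have "A ** B ** C - A' ** B' ** C'
      = (A - A') ** B ** C + A' ** (B - B') ** C + A' ** B' ** (C - C')"
    by (simp add: m1.diff_left m1.diff_right m2.diff_left m2.diff_right)
  then have "norm (A ** B ** C - A' ** B' ** C') \<le>
      norm ((A - A') ** B ** C) + norm (A' ** (B - B') ** C) + norm (A' ** B' ** (C - C'))"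
    by (metis norm_triangle_le norm_triangle_ineq add_mono order_refl)
  also have "\<dots> \<le> norm (A - A') * K * K + K * norm (B - B') * K + K * K * norm (C - C')"
    using K assms by (intro add_mono order_trans[OF triple] mult_mono) auto
  finally show ?thesis by (simp add: power2_eq_square algebra_simps)
qed

section \<open>Moments of a standard Gaussian vector\<close>

text \<open>
  Lebesgue measure on \<open>real^'n\<close> is the image of a product measure indexed by the unit vectors, so an
  integrand that is a product over the coordinates can be integrated coordinate by coordinate.
\<close>

lemma
  fixes f :: "'n::finite \<Rightarrow> real \<Rightarrow> real"
  assumes int: "\<And>i. integrable lborel (f i)"
  shows integrable_lborel_vec_prod: "integrable lborel (\<lambda>x::real^'n. \<Prod>i\<in>UNIV. f i (x $ i))"
    and integral_lborel_vec_prod: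
      "(\<integral>x. (\<Prod>i\<in>UNIV. f i ((x::real^'n) $ i)) \<partial>lborel) = (\<Prod>i\<in>UNIV. \<integral>y. f i y \<partial>lborel)"
proof -
  interpret product_sigma_finite "\<lambda>_::real^'n. lborel :: real measure"
    by standard
  let ?B = "Basis :: (real^'n) set"
  define e :: "'n \<Rightarrow> real^'n" where "e i = axis i 1" for i
  have inj: "inj e" by (auto simp: e_def inj_def axis_eq_axis)
  have Basis_eq: "?B = range e" by (auto simp: Basis_vec_def e_def)
  define g where "g b = f (inv e b)" for b
  have ge: "g (e i) = f i" for i by (simp add: g_def inv_f_f[OF inj])
  \<comment> \<open>The coordinates \<open>i\<close> correspond to the basis vectors \<open>axis i 1\<close>.\<close>
  have prod_eq: "(\<Prod>b\<in>?B. k b) = (\<Prod>i\<in>UNIV. k (e i))" for k :: "real^'n \<Rightarrow> real"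
    unfolding Basis_eq by (simp add: prod.reindex[OF inj])
  let ?S = "\<lambda>x::real^'n \<Rightarrow> real. \<Sum>b\<in>?B. x b *\<^sub>R b"
  have comp: "?S x $ i = x (e i)" for x i
  proof -
    have "?S x $ i = ?S x \<bullet> e i"
      by (simp add: e_def inner_axis)
    also have "\<dots> = x (e i)"
      by (subst inner_sum_left_Basis) (auto simp: Basis_eq)
    finally show ?thesis .
  qed
  have int_g: "integrable lborel (g b)" if "b \<in> ?B" for b
    using that int by (auto simp: Basis_eq ge)
  have eq: "(\<Prod>i\<in>UNIV. f i (?S x $ i)) = (\<Prod>b\<in>?B. g b (x b))" for x
    unfolding comp prod_eq ge ..
  have [measurable]: "f i \<in> borel_measurable borel" for i
    using int[of i] by auto
  have S: "?S \<in> measurable (\<Pi>\<^sub>M b\<in>?B. lborel) borel"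
    by measurable
  show "integrable lborel (\<lambda>x::real^'n. \<Prod>i\<in>UNIV. f i (x $ i))"
    unfolding lborel_eq[where 'a="real^'n"]
    by (subst integrable_distr_eq[OF S]) (simp_all only: eq product_integrable_prod[OF finite_Basis int_g], measurable)
  show "(\<integral>x. (\<Prod>i\<in>UNIV. f i ((x::real^'n) $ i)) \<partial>lborel) = (\<Prod>i\<in>UNIV. \<integral>y. f i y \<partial>lborel)"
    unfolding lborel_eq[where 'a="real^'n"]
    by (subst integral_distr[OF S], measurable)
       (simp only: eq product_integral_prod[OF finite_Basis int_g], simp only: prod_eq ge)
qed

lemma borel_measurable_vec_nth [measurable (raw)]:
  fixes f :: "'a \<Rightarrow> ('b::real_normed_vector)^'n"
  assumes "f \<in> borel_measurable N"
  shows "(\<lambda>x. f x $ i) \<in> borel_measurable N"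
  by (rule borel_measurable_continuous_on[OF _ assms]) (intro continuous_intros)

text \<open>
  The centred Gaussian density is itself a product over the coordinates, so mixed moments factorise.
\<close>

lemma gaussian_vec_moment:
  fixes X :: "'a \<Rightarrow> real^'n" and p :: "'n \<Rightarrow> nat"
  assumes X: "distributed M lborel X (\<lambda>x. ennreal (\<Prod>i\<in>UNIV. normal_density 0 \<sigma> (x $ i)))"
    and \<sigma>: "0 < \<sigma>"
  shows "has_bochner_integral M (\<lambda>\<omega>. \<Prod>i\<in>UNIV. X \<omega> $ i ^ p i)
           (\<Prod>i\<in>UNIV. \<integral>y. normal_density 0 \<sigma> y * y ^ p i \<partial>lborel)"
proof -
  have int: "integrable lborel (\<lambda>y. normal_density 0 \<sigma> y * y ^ p i)" for i
    using integrable_normal_moment[OF \<sigma>, of 0 "p i"] by simp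
  have meas: "(\<lambda>x::real^'n. \<Prod>i\<in>UNIV. x $ i ^ p i) \<in> borel_measurable lborel"
    by measurable
  have nonneg: "0 \<le> (\<Prod>i\<in>UNIV. normal_density 0 \<sigma> (x $ i))" for x :: "real^'n"
    by (intro prod_nonneg) auto
  show ?thesis
    unfolding has_bochner_integral_iff
    using distributed_integrable[OF X meas nonneg] distributed_integral[OF X meas nonneg]
      integrable_lborel_vec_prod[of "\<lambda>i y. normal_density 0 \<sigma> y * y ^ p i", OF int]
      integral_lborel_vec_prod[of "\<lambda>i y. normal_density 0 \<sigma> y * y ^ p i", OF int]
    by (simp add: prod.distrib)
qed

lemma prod_power_of_bool:
  fixes x :: "'n::finite \<Rightarrow> real"
  shows "(\<Prod>i\<in>UNIV. x i ^ of_bool (i = j)) = x j"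
proof -
  have "x i ^ of_bool (i = j) = (if i = j then x i else 1)" for i by simp
  then show ?thesis by simp
qed

text \<open>
  Both follow from the mixed moments with exponents \<open>of_bool (i = j)\<close> and
  \<open>of_bool (i = j) + of_bool (i = k)\<close>: the product vanishes as soon as one exponent equals \<open>1\<close>.
\<close>

lemma
  fixes X :: "'a \<Rightarrow> real^'n"
  assumes X: "distributed M lborel X (\<lambda>x. ennreal (\<Prod>i\<in>UNIV. normal_density 0 \<sigma> (x $ i)))"
    and \<sigma>: "0 < \<sigma>"
  shows gaussian_vec_mean: "has_bochner_integral M (\<lambda>\<omega>. X \<omega> $ j) 0"
    and gaussian_vec_covariance:
      "has_bochner_integral M (\<lambda>\<omega>. X \<omega> $ j * X \<omega> $ k) (if j = k then \<sigma>\<^sup>2 else 0)"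
proof -
  have m0: "(\<integral>y. normal_density 0 \<sigma> y \<partial>lborel) = 1"
    using \<sigma> by (rule integral_normal_density)
  have m1: "(\<integral>y. normal_density 0 \<sigma> y * y \<partial>lborel) = 0"
    using \<sigma> by (rule integral_normal_moment_nz_1)
  have m2: "(\<integral>y. normal_density 0 \<sigma> y * y ^ 2 \<partial>lborel) = \<sigma>\<^sup>2"
    using integral_normal_moment_even[OF \<sigma>, of 0 1] \<sigma> by (simp add: fact_numeral)
  have "(\<Prod>i\<in>UNIV. \<integral>y. normal_density 0 \<sigma> y * y ^ of_bool (i = j) \<partial>lborel) = 0"
    by (rule prod_zero) (auto intro!: bexI[of _ j] simp: m1)
  with gaussian_vec_moment[OF X \<sigma>, of "\<lambda>i. of_bool (i = j)"]
  show "has_bochner_integral M (\<lambda>\<omega>. X \<omega> $ j) 0"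
    by (simp only: prod_power_of_bool)
  have "(\<Prod>i\<in>UNIV. \<integral>y. normal_density 0 \<sigma> y * y ^ (of_bool (i = j) + of_bool (i = k)) \<partial>lborel)
      = (if j = k then \<sigma>\<^sup>2 else 0)"
  proof (cases "j = k")
    case True
    have "(\<integral>y. normal_density 0 \<sigma> y * y ^ (of_bool (i = j) + of_bool (i = k)) \<partial>lborel) = (if i = j then \<sigma>\<^sup>2 else 1)" for i
      using True m2 by (simp add: m0 power2_eq_square)
    then show ?thesis using True by simp
  next
    case False
    then show ?thesis
      by (subst prod_zero) (auto intro!: bexI[of _ j] simp: m1)
  qed
  with gaussian_vec_moment[OF X \<sigma>, of "\<lambda>i. of_bool (i = j) + of_bool (i = k)"]
  show "has_bochner_integral M (\<lambda>\<omega>. X \<omega> $ j * X \<omega> $ k) (if j = k then \<sigma>\<^sup>2 else 0)"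
    by (simp only: power_add prod.distrib prod_power_of_bool)
qed

section \<open>Products of Brownian increments\<close>

locale filtered_brownian_motion = usual_filtered_prob_space M F
  for M :: "'a measure" and F :: "real \<Rightarrow> 'a measure" +
  fixes W :: "real \<Rightarrow> 'a \<Rightarrow> real^'m"
  assumes brownian: "standard_brownian_motion M F W"
begin

definition \<Delta> :: "real \<Rightarrow> real \<Rightarrow> 'a \<Rightarrow> real^'m" where
  "\<Delta> s t \<omega> = W t \<omega> - W s \<omega>"

lemma space_F: "0 \<le> t \<Longrightarrow> space (F t) = space M"
  using subalgebra_F by (auto simp: subalgebra_def)

lemma measurable_F_mono:
  assumes "f \<in> measurable (F s) N" "0 \<le> s" "s \<le> t"
  shows "f \<in> measurable (F t) N"
  using assms mono_F[of s t] space_F[of s] space_F[of t]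
  by (auto simp: measurable_def)

lemma measurable_F_M:
  assumes "f \<in> measurable (F s) N" "0 \<le> s"
  shows "f \<in> measurable M N"
  using assms subalgebra_F[of s] by (auto simp: measurable_def subalgebra_def)

lemma measurable_\<Delta>: "0 \<le> s \<Longrightarrow> s \<le> t \<Longrightarrow> \<Delta> s t \<in> borel_measurable (F t)"
  using brownian measurable_F_mono[of "W s" s borel t]
  unfolding standard_brownian_motion_def \<Delta>_def[abs_def] by (intro borel_measurable_diff) auto

lemma \<Delta>_add: "\<Delta> r t \<omega> = \<Delta> r s \<omega> + \<Delta> s t \<omega>"
  by (simp add: \<Delta>_def)

lemma \<Delta>_self [simp]: "\<Delta> t t \<omega> = 0"
  by (simp add: \<Delta>_def)

lemma
  assumes "0 \<le> s" "s \<le> t"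
  shows increment_mean: "has_bochner_integral M (\<lambda>\<omega>. \<Delta> s t \<omega> $ j) 0"
    and increment_covariance:
      "has_bochner_integral M (\<lambda>\<omega>. \<Delta> s t \<omega> $ j * \<Delta> s t \<omega> $ k) (if j = k then t - s else 0)"
proof -
  have "has_bochner_integral M (\<lambda>\<omega>. \<Delta> s t \<omega> $ j) 0 \<and>
      has_bochner_integral M (\<lambda>\<omega>. \<Delta> s t \<omega> $ j * \<Delta> s t \<omega> $ k) (if j = k then t - s else 0)"
  proof (cases "s < t")
    case True
    then have dist: "distributed M lborel (\<Delta> s t)
        (\<lambda>x. ennreal (\<Prod>i\<in>UNIV. normal_density 0 (sqrt (t - s)) (x $ i)))"
      using brownian assms unfolding standard_brownian_motion_def \<Delta>_def[abs_def] by auto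
    have "0 < sqrt (t - s)" using True by simp
    with gaussian_vec_mean[OF dist this] gaussian_vec_covariance[OF dist this, of j k] True
    show ?thesis by (cases "j = k") simp_all
  next
    case False
    with assms have "s = t" by simp
    then show ?thesis by (simp add: has_bochner_integral_zero)
  qed
  then show "has_bochner_integral M (\<lambda>\<omega>. \<Delta> s t \<omega> $ j) 0"
    "has_bochner_integral M (\<lambda>\<omega>. \<Delta> s t \<omega> $ j * \<Delta> s t \<omega> $ k) (if j = k then t - s else 0)"
    by auto
qed

text \<open>
  Independence of the increment from the past: any \<open>F s\<close>-measurable weight factors out of the
  expectation.
\<close>

lemma integral_mult_function_of_increment:
  fixes f :: "'a \<Rightarrow> real" and q :: "real^'m \<Rightarrow> real"
  assumes "0 \<le> s" "s < t" and f: "f \<in> borel_measurable (F s)" "integrable M f"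
    and q: "q \<in> borel_measurable borel" "has_bochner_integral M (\<lambda>\<omega>. q (\<Delta> s t \<omega>)) c"
  shows "has_bochner_integral M (\<lambda>\<omega>. f \<omega> * q (\<Delta> s t \<omega>)) ((\<integral>\<omega>. f \<omega> \<partial>M) * c)"
proof -
  have indep: "indep_set (sets (F s)) (sets (vimage_algebra (space M) (\<Delta> s t) borel))"
    using assms brownian unfolding standard_brownian_motion_def \<Delta>_def[abs_def] by auto
  have \<Delta>M: "\<Delta> s t \<in> borel_measurable M"
    using assms measurable_F_M[OF measurable_\<Delta>, of s t] by simp
  have sub1: "sigma_sets (space M) {f -` A \<inter> space M |A. A \<in> sets borel} \<subseteq> sets (F s)"
  proof -
    have "{f -` A \<inter> space M |A. A \<in> sets borel} \<subseteq> sets (F s)"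
      using f(1) space_F[of s] assms(1) by (auto simp: measurable_def)
    then show ?thesis
      using sets.sigma_sets_subset[of _ "F s"] space_F[of s] assms(1) by simp
  qed
  have sub2: "sigma_sets (space M) {(\<lambda>\<omega>. q (\<Delta> s t \<omega>)) -` A \<inter> space M |A. A \<in> sets borel}
      \<subseteq> sets (vimage_algebra (space M) (\<Delta> s t) borel)"
  proof -
    have "(\<lambda>\<omega>. q (\<Delta> s t \<omega>)) -` A \<inter> space M \<in> sets (vimage_algebra (space M) (\<Delta> s t) borel)"
      if "A \<in> sets borel" for A
    proof -
      have "q -` A \<in> sets borel" using q(1) that by (auto simp: measurable_def)
      then have "\<Delta> s t -` (q -` A) \<inter> space M \<in> sets (vimage_algebra (space M) (\<Delta> s t) borel)"
        by (intro in_vimage_algebra)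
      then show ?thesis by (simp add: vimage_def)
    qed
    then have "{(\<lambda>\<omega>. q (\<Delta> s t \<omega>)) -` A \<inter> space M |A. A \<in> sets borel}
        \<subseteq> sets (vimage_algebra (space M) (\<Delta> s t) borel)" by auto
    then show ?thesis
      using sets.sigma_sets_subset[of _ "vimage_algebra (space M) (\<Delta> s t) borel"] by simp
  qed
  have "indep_var borel f borel (\<lambda>\<omega>. q (\<Delta> s t \<omega>))"
    unfolding indep_var_eq
  proof (intro conjI)
    show "random_variable borel f" using f by auto
    show "random_variable borel (\<lambda>\<omega>. q (\<Delta> s t \<omega>))" using \<Delta>M q(1) by measurable
    show "indep_set (sigma_sets (space M) {f -` A \<inter> space M |A. A \<in> sets borel})
        (sigma_sets (space M) {(\<lambda>\<omega>. q (\<Delta> s t \<omega>)) -` A \<inter> space M |A. A \<in> sets borel})"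
      using indep sub1 sub2 unfolding indep_set_def
      by (elim indep_sets_mono_sets) (auto split: bool.split)
  qed
  from indep_var_lebesgue_integral[OF this] indep_var_integrable[OF this] f q
  show ?thesis by (auto simp: has_bochner_integral_iff)
qed

lemma integrable_bounded_F:
  fixes f :: "'a \<Rightarrow> real"
  assumes "0 \<le> s" "f \<in> borel_measurable (F s)" "\<And>\<omega>. \<omega> \<in> space M \<Longrightarrow> \<bar>f \<omega>\<bar> \<le> B"
  shows "integrable M f"
  using assms measurable_F_M[OF assms(2,1)]
  by (intro integrable_const_bound[of _ B]) auto

lemma integral_mult_increment:
  assumes "0 \<le> s" "s \<le> t" and f: "f \<in> borel_measurable (F s)" "integrable M f"
  shows "has_bochner_integral M (\<lambda>\<omega>. f \<omega> * \<Delta> s t \<omega> $ j) 0"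
proof (cases "s < t")
  case True
  then show ?thesis
    using integral_mult_function_of_increment[OF assms(1) True f, of "\<lambda>x. x $ j" 0]
      increment_mean[OF assms(1,2)] by simp
next
  case False
  with assms have "s = t" by simp
  then show ?thesis by (simp add: has_bochner_integral_zero)
qed

lemma integral_mult_increment_same:
  assumes "0 \<le> s" "s \<le> t" and f: "f \<in> borel_measurable (F s)" "integrable M f"
  shows "has_bochner_integral M (\<lambda>\<omega>. f \<omega> * (\<Delta> s t \<omega> $ j * \<Delta> s t \<omega> $ k))
          (if j = k then (t - s) * (\<integral>\<omega>. f \<omega> \<partial>M) else 0)"
proof (cases "s < t")
  case True
  then show ?thesis
    using integral_mult_function_of_increment[OF assms(1) True f, of "\<lambda>x. x $ j * x $ k" "if j = k then t - s else 0"]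
      increment_covariance[OF assms(1,2)] by (simp add: mult.commute split: if_splits)
next
  case False
  with assms have "s = t" by simp
  then show ?thesis by (simp add: has_bochner_integral_zero)
qed

text \<open>
  The earlier increment is measurable at time \<open>r\<close>, so it can be absorbed into the weight of the later,
  centred increment.
\<close>

lemma integral_mult_increments_disjoint:
  assumes "0 \<le> p" "p \<le> q" "q \<le> r" "r \<le> s"
    and f: "f \<in> borel_measurable (F r)" "\<And>\<omega>. \<omega> \<in> space M \<Longrightarrow> \<bar>f \<omega>\<bar> \<le> B"
  shows "has_bochner_integral M (\<lambda>\<omega>. f \<omega> * (\<Delta> p q \<omega> $ j * \<Delta> r s \<omega> $ k)) 0"
proof -
  have [measurable]: "\<Delta> p q \<in> borel_measurable (F r)"
    using measurable_F_mono[OF measurable_\<Delta>, of p q r] assms by auto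
  have "integrable M (\<lambda>\<omega>. \<Delta> p q \<omega> $ j)"
    using increment_mean[of p q j] assms by (auto simp: has_bochner_integral_iff)
  then have "integrable M (\<lambda>\<omega>. B * \<Delta> p q \<omega> $ j)" by simp
  then have int: "integrable M (\<lambda>\<omega>. f \<omega> * \<Delta> p q \<omega> $ j)"
  proof (rule Bochner_Integration.integrable_bound)
    have "(\<lambda>\<omega>. f \<omega> * \<Delta> p q \<omega> $ j) \<in> borel_measurable (F r)"
      using f by measurable
    then show "(\<lambda>\<omega>. f \<omega> * \<Delta> p q \<omega> $ j) \<in> borel_measurable M"
      using assms by (intro measurable_F_M[of _ r]) auto
    show "AE \<omega> in M. norm (f \<omega> * \<Delta> p q \<omega> $ j) \<le> norm (B * \<Delta> p q \<omega> $ j)"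
    proof (rule AE_I2)
      fix \<omega> assume "\<omega> \<in> space M"
      from f(2)[OF this] have "\<bar>f \<omega>\<bar> \<le> \<bar>B\<bar>" by linarith
      then show "norm (f \<omega> * \<Delta> p q \<omega> $ j) \<le> norm (B * \<Delta> p q \<omega> $ j)"
        by (simp add: abs_mult mult_right_mono)
    qed
  qed
  have "(\<lambda>\<omega>. f \<omega> * \<Delta> p q \<omega> $ j) \<in> borel_measurable (F r)"
    using f by measurable
  from integral_mult_increment[OF _ _ this int, of s k] assms
  show ?thesis by (simp add: mult.assoc)
qed

text \<open>
  The longer increment is split at the shorter endpoint.  The common part contributes its length, and
  the remainder is a disjoint later increment.
\<close>

lemma integral_mult_increments_same_start:
  assumes "0 \<le> p" "p \<le> u" "p \<le> v"
    and f: "f \<in> borel_measurable (F p)" "\<And>\<omega>. \<omega> \<in> space M \<Longrightarrow> \<bar>f \<omega>\<bar> \<le> B"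
  shows "has_bochner_integral M (\<lambda>\<omega>. f \<omega> * (\<Delta> p u \<omega> $ j * \<Delta> p v \<omega> $ k))
          (if j = k then (min u v - p) * (\<integral>\<omega>. f \<omega> \<partial>M) else 0)"
proof -
  have int: "integrable M f"
    using assms by (intro integrable_bounded_F[of p]) auto
  have le: "has_bochner_integral M (\<lambda>\<omega>. f \<omega> * (\<Delta> p u \<omega> $ j * \<Delta> p v \<omega> $ k))
          (if j = k then (u - p) * (\<integral>\<omega>. f \<omega> \<partial>M) else 0)"
    if "p \<le> u" "u \<le> v" for u v j k
  proof -
    have "f \<in> borel_measurable (F u)"
      using measurable_F_mono[OF f(1)] assms that by auto
    from integral_mult_increments_disjoint[OF _ _ _ _ this f(2), of p u v j k] assms that
    have "has_bochner_integral M (\<lambda>\<omega>. f \<omega> * (\<Delta> p u \<omega> $ j * \<Delta> u v \<omega> $ k)) 0" by simp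
    from has_bochner_integral_add[OF integral_mult_increment_same[OF _ that(1) f(1) int, of j k] this] assms
    show ?thesis
      by (simp add: \<Delta>_add[of p v _ u] distrib_left)
  qed
  show ?thesis
  proof (cases "u \<le> v")
    case True
    then show ?thesis using le[of u v j k] assms by (cases "j = k") simp_all
  next
    case False
    then have "has_bochner_integral M (\<lambda>\<omega>. f \<omega> * (\<Delta> p v \<omega> $ k * \<Delta> p u \<omega> $ j))
          (if k = j then (v - p) * (\<integral>\<omega>. f \<omega> \<partial>M) else 0)"
      using le[of v u k j] assms by simp
    then show ?thesis using False by (cases "j = k") (simp_all add: mult.commute[of "\<Delta> p v _ $ k"])
  qed
qed

text \<open>
  The length of the intersection of the intervals \<open>(u, v]\<close> and \<open>(u', v']\<close>.
\<close>

definition overlap :: "real \<Rightarrow> real \<Rightarrow> real \<Rightarrow> real \<Rightarrow> real" where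
  "overlap u v u' v' = max 0 (min v v' - max u u')"

text \<open>
  The scalar heart of the Ito isometry.  By symmetry the second interval may be assumed to start later,
  so that both weights are known when it starts.  The part of the first increment before that time
  contributes nothing, and what is left are two increments with a common start.
\<close>

lemma integral_mult_increments:
  assumes "0 \<le> u" "u \<le> v" "0 \<le> u'" "u' \<le> v'"
    and f: "f \<in> borel_measurable (F u)" "\<And>\<omega>. \<omega> \<in> space M \<Longrightarrow> \<bar>f \<omega>\<bar> \<le> B"
    and g: "g \<in> borel_measurable (F u')" "\<And>\<omega>. \<omega> \<in> space M \<Longrightarrow> \<bar>g \<omega>\<bar> \<le> B"
  shows "has_bochner_integral M (\<lambda>\<omega>. (f \<omega> * \<Delta> u v \<omega> $ j) * (g \<omega> * \<Delta> u' v' \<omega> $ k))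
          (if j = k then overlap u v u' v' * (\<integral>\<omega>. f \<omega> * g \<omega> \<partial>M) else 0)"
proof -
  have le: "has_bochner_integral M (\<lambda>\<omega>. (f \<omega> * \<Delta> u v \<omega> $ j) * (g \<omega> * \<Delta> u' v' \<omega> $ k))
          (if j = k then overlap u v u' v' * (\<integral>\<omega>. f \<omega> * g \<omega> \<partial>M) else 0)"
    if uu: "u \<le> u'" and "0 \<le> u" "u \<le> v" "0 \<le> u'" "u' \<le> v'"
    and f: "f \<in> borel_measurable (F u)" "\<And>\<omega>. \<omega> \<in> space M \<Longrightarrow> \<bar>f \<omega>\<bar> \<le> B"
    and g: "g \<in> borel_measurable (F u')" "\<And>\<omega>. \<omega> \<in> space M \<Longrightarrow> \<bar>g \<omega>\<bar> \<le> B"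
    for f g u v u' v' j k
  proof -
    have [measurable]: "f \<in> borel_measurable (F u')" "g \<in> borel_measurable (F u')"
      using measurable_F_mono[OF f(1)] that by auto
    have fg: "(\<lambda>\<omega>. f \<omega> * g \<omega>) \<in> borel_measurable (F u')" by measurable
    have fgB: "\<bar>f \<omega> * g \<omega>\<bar> \<le> B * B" if "\<omega> \<in> space M" for \<omega>
      using f(2)[OF that] g(2)[OF that] by (simp add: abs_mult mult_mono')
    show ?thesis
    proof (cases "v \<le> u'")
      case True
      from integral_mult_increments_disjoint[OF _ _ this _ fg fgB, of u v' j k] that True
      have "has_bochner_integral M (\<lambda>\<omega>. f \<omega> * g \<omega> * (\<Delta> u v \<omega> $ j * \<Delta> u' v' \<omega> $ k)) 0" by simp
      moreover have "overlap u v u' v' = 0"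
        using True that by (simp add: overlap_def)
      ultimately show ?thesis by (cases "j = k") (simp_all add: ac_simps)
    next
      case False
      have "has_bochner_integral M (\<lambda>\<omega>. f \<omega> * g \<omega> * (\<Delta> u u' \<omega> $ j * \<Delta> u' v' \<omega> $ k)) 0"
        using integral_mult_increments_disjoint[OF _ _ _ _ fg fgB, of u u' v' j k] that by simp
      moreover have "has_bochner_integral M (\<lambda>\<omega>. f \<omega> * g \<omega> * (\<Delta> u' v \<omega> $ j * \<Delta> u' v' \<omega> $ k))
          (if j = k then (min v v' - u') * (\<integral>\<omega>. f \<omega> * g \<omega> \<partial>M) else 0)"
        using integral_mult_increments_same_start[OF _ _ _ fg fgB, of v v' j k] that False by simp
      ultimately have "has_bochner_integral M (\<lambda>\<omega>. f \<omega> * g \<omega> * (\<Delta> u u' \<omega> $ j * \<Delta> u' v' \<omega> $ k) +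
           f \<omega> * g \<omega> * (\<Delta> u' v \<omega> $ j * \<Delta> u' v' \<omega> $ k))
          (0 + (if j = k then (min v v' - u') * (\<integral>\<omega>. f \<omega> * g \<omega> \<partial>M) else 0))"
        by (rule has_bochner_integral_add)
      moreover have "overlap u v u' v' = min v v' - u'"
        using False that by (simp add: overlap_def max_def)
      ultimately show ?thesis
        by (cases "j = k") (simp_all add: \<Delta>_add[of u v _ u'] distrib_left distrib_right ac_simps)
    qed
  qed
  show ?thesis
  proof (cases "u \<le> u'")
    case True
    then show ?thesis using le assms by blast
  next
    case False
    then have "has_bochner_integral M (\<lambda>\<omega>. (g \<omega> * \<Delta> u' v' \<omega> $ k) * (f \<omega> * \<Delta> u v \<omega> $ j))
          (if k = j then overlap u' v' u v * (\<integral>\<omega>. g \<omega> * f \<omega> \<partial>M) else 0)"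
      using assms by (intro le) auto
    moreover have "overlap u' v' u v = overlap u v u' v'"
      by (simp add: overlap_def min.commute max.commute)
    moreover have "(\<lambda>\<omega>. (g \<omega> * \<Delta> u' v' \<omega> $ k) * (f \<omega> * \<Delta> u v \<omega> $ j)) =
        (\<lambda>\<omega>. (f \<omega> * \<Delta> u v \<omega> $ j) * (g \<omega> * \<Delta> u' v' \<omega> $ k))"
      by (rule ext) (rule mult.commute)
    moreover have "(\<lambda>\<omega>. g \<omega> * f \<omega>) = (\<lambda>\<omega>. f \<omega> * g \<omega>)"
      by (rule ext) (rule mult.commute)
    ultimately show ?thesis
      by (simp only: eq_commute[of k j])
  qed
qed

text \<open>
  Expanding the matrix-vector products over coordinates, only equal components of the two increments
  are correlated, and the double sum collapses to the Frobenius inner product of the weights.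
\<close>

lemma integral_inner_increments:
  fixes H H' :: "'a \<Rightarrow> real^'m^'r"
  assumes uv: "0 \<le> u" "u \<le> v" "0 \<le> u'" "u' \<le> v'"
    and H: "H \<in> borel_measurable (F u)" "\<And>\<omega>. \<omega> \<in> space M \<Longrightarrow> norm (H \<omega>) \<le> B"
    and H': "H' \<in> borel_measurable (F u')" "\<And>\<omega>. \<omega> \<in> space M \<Longrightarrow> norm (H' \<omega>) \<le> B"
  shows "has_bochner_integral M (\<lambda>\<omega>. (H \<omega> *v \<Delta> u v \<omega>) \<bullet> (H' \<omega> *v \<Delta> u' v' \<omega>))
          (overlap u v u' v' * (\<integral>\<omega>. H \<omega> \<bullet> H' \<omega> \<partial>M))"
proof -
  have comp: "\<bar>X $ i $ j\<bar> \<le> norm X" for X :: "real^'m^'r" and i j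
    by (rule order_trans[OF component_le_norm_cart Finite_Cartesian_Product.norm_nth_le])
  have meas: "(\<lambda>\<omega>. H \<omega> $ i $ j) \<in> borel_measurable (F u)" "(\<lambda>\<omega>. H' \<omega> $ i $ j) \<in> borel_measurable (F u')" for i j
    using H(1) H'(1) by measurable
  have bd: "\<bar>H \<omega> $ i $ j\<bar> \<le> B" "\<bar>H' \<omega> $ i $ j\<bar> \<le> B" if "\<omega> \<in> space M" for \<omega> i j
    by (rule order_trans[OF comp H(2)[OF that]], rule order_trans[OF comp H'(2)[OF that]])
  have bch: "has_bochner_integral M
       (\<lambda>\<omega>. (H \<omega> $ i $ j * \<Delta> u v \<omega> $ j) * (H' \<omega> $ i $ k * \<Delta> u' v' \<omega> $ k))
       (if j = k then overlap u v u' v' * (\<integral>\<omega>. H \<omega> $ i $ j * H' \<omega> $ i $ k \<partial>M) else 0)" for i j k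
    using uv meas bd by (intro integral_mult_increments[where B=B]) auto
  have int: "integrable M (\<lambda>\<omega>. H \<omega> $ i $ j * H' \<omega> $ i $ k)" for i j k
    using uv bd measurable_F_M[OF meas(1)] measurable_F_M[OF meas(2)]
    by (intro integrable_const_bound[of _ "B * B"]) (auto intro!: AE_I2 mult_mono' simp: abs_mult)
  have "has_bochner_integral M
      (\<lambda>\<omega>. \<Sum>i\<in>UNIV. \<Sum>j\<in>UNIV. \<Sum>k\<in>UNIV. (H \<omega> $ i $ j * \<Delta> u v \<omega> $ j) * (H' \<omega> $ i $ k * \<Delta> u' v' \<omega> $ k))
      (\<Sum>i\<in>UNIV. \<Sum>j\<in>UNIV. \<Sum>k\<in>UNIV. if j = k then overlap u v u' v' * (\<integral>\<omega>. H \<omega> $ i $ j * H' \<omega> $ i $ k \<partial>M) else 0)"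
    by (intro has_bochner_integral_sum bch)
  also have "(\<lambda>\<omega>. \<Sum>i\<in>UNIV. \<Sum>j\<in>UNIV. \<Sum>k\<in>UNIV. (H \<omega> $ i $ j * \<Delta> u v \<omega> $ j) * (H' \<omega> $ i $ k * \<Delta> u' v' \<omega> $ k))
      = (\<lambda>\<omega>. (H \<omega> *v \<Delta> u v \<omega>) \<bullet> (H' \<omega> *v \<Delta> u' v' \<omega>))"
    by (simp add: inner_vec_def[where 'a=real] matrix_vector_mult_def sum_product)
  also have "(\<Sum>i\<in>UNIV. \<Sum>j\<in>UNIV. \<Sum>k\<in>UNIV. if j = k then overlap u v u' v' * (\<integral>\<omega>. H \<omega> $ i $ j * H' \<omega> $ i $ k \<partial>M) else 0)
      = overlap u v u' v' * (\<integral>\<omega>. H \<omega> \<bullet> H' \<omega> \<partial>M)"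
    by (simp add: inner_vec_def int sum_distrib_left)
  finally show ?thesis .
qed

text \<open>
  The intervals may overlap in any way.  Both sides are sums over pairs of indices of the overlap of
  the two intervals times the expected inner product of the weights.  The difference of two simple processes with
  different grids is such a family, indexed by the disjoint union of their indices.
\<close>

lemma ito_isometry_step_family:
  fixes h :: "'i \<Rightarrow> 'a \<Rightarrow> real^'m^'r"
  assumes "finite A" and uv: "\<And>i. i \<in> A \<Longrightarrow> 0 \<le> u i" "\<And>i. i \<in> A \<Longrightarrow> u i \<le> v i" "\<And>i. i \<in> A \<Longrightarrow> v i \<le> t"
    and meas: "\<And>i. i \<in> A \<Longrightarrow> h i \<in> borel_measurable (F (u i))"
    and bdd: "\<And>i \<omega>. i \<in> A \<Longrightarrow> \<omega> \<in> space M \<Longrightarrow> norm (h i \<omega>) \<le> B"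
  shows "(\<integral>\<^sup>+\<omega>. ennreal ((norm (\<Sum>i\<in>A. h i \<omega> *v \<Delta> (u i) (v i) \<omega>))\<^sup>2) \<partial>M) =
    (\<integral>\<^sup>+\<omega>. (\<integral>\<^sup>+s\<in>{0..t}. ennreal ((norm (\<Sum>i\<in>A. indicator {u i<..v i} s *\<^sub>R h i \<omega>))\<^sup>2) \<partial>lborel) \<partial>M)"
proof -
  let ?o = "\<lambda>i j. overlap (u i) (v i) (u j) (v j)"
  define S where "S \<omega> = (\<Sum>i\<in>A. h i \<omega> *v \<Delta> (u i) (v i) \<omega>)" for \<omega>
  define V where "V s \<omega> = (\<Sum>i\<in>A. indicator {u i<..v i} s *\<^sub>R h i \<omega>)" for s :: real and \<omega>
  define N where "N \<omega> = (\<Sum>i\<in>A. \<Sum>j\<in>A. ?o i j * (h i \<omega> \<bullet> h j \<omega>))" for \<omega>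
  have measM: "h i \<in> borel_measurable M" if "i \<in> A" for i
    using measurable_F_M[OF meas uv(1)] that by auto
  have int: "integrable M (\<lambda>\<omega>. h i \<omega> \<bullet> h j \<omega>)" if ij: "i \<in> A" "j \<in> A" for i j
  proof (rule integrable_const_bound)
    show "AE \<omega> in M. norm (h i \<omega> \<bullet> h j \<omega>) \<le> B * B"
    proof (rule AE_I2)
      fix \<omega> assume "\<omega> \<in> space M"
      with bdd[of i \<omega>] bdd[of j \<omega>] ij have "norm (h i \<omega>) * norm (h j \<omega>) \<le> B * B"
        by (intro mult_mono') auto
      with Cauchy_Schwarz_ineq2[of "h i \<omega>" "h j \<omega>"] show "norm (h i \<omega> \<bullet> h j \<omega>) \<le> B * B" by simp
    qed
  qed (use measM ij in measurable)
  have "has_bochner_integral M (\<lambda>\<omega>. \<Sum>i\<in>A. \<Sum>j\<in>A.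
        (h i \<omega> *v \<Delta> (u i) (v i) \<omega>) \<bullet> (h j \<omega> *v \<Delta> (u j) (v j) \<omega>))
      (\<Sum>i\<in>A. \<Sum>j\<in>A. ?o i j * (\<integral>\<omega>. h i \<omega> \<bullet> h j \<omega> \<partial>M))"
    using uv meas bdd by (intro has_bochner_integral_sum integral_inner_increments[where B=B]) auto
  also have "(\<lambda>\<omega>. \<Sum>i\<in>A. \<Sum>j\<in>A. (h i \<omega> *v \<Delta> (u i) (v i) \<omega>) \<bullet> (h j \<omega> *v \<Delta> (u j) (v j) \<omega>))
      = (\<lambda>\<omega>. (norm (S \<omega>))\<^sup>2)"
    by (simp add: S_def power2_norm_eq_inner inner_sum_left inner_sum_right) (subst sum.swap, rule refl)
  finally have S: "has_bochner_integral M (\<lambda>\<omega>. (norm (S \<omega>))\<^sup>2)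
      (\<Sum>i\<in>A. \<Sum>j\<in>A. ?o i j * (\<integral>\<omega>. h i \<omega> \<bullet> h j \<omega> \<partial>M))" .
  have N: "has_bochner_integral M N (\<Sum>i\<in>A. \<Sum>j\<in>A. ?o i j * (\<integral>\<omega>. h i \<omega> \<bullet> h j \<omega> \<partial>M))"
    unfolding N_def
    by (intro has_bochner_integral_sum has_bochner_integral_mult_right has_bochner_integral_integrable int)
  have V: "has_bochner_integral lborel (\<lambda>s. (norm (V s \<omega>))\<^sup>2) (N \<omega>)" for \<omega>
  proof -
    have "has_bochner_integral lborel (indicator ({u i<..v i} \<inter> {u j<..v j}) :: real \<Rightarrow> real) (?o i j)" for i j
    proof -
      have "{u i<..v i} \<inter> {u j<..v j} = {max (u i) (u j)<..min (v i) (v j)}" by auto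
      moreover have "measure lborel {max (u i) (u j)<..min (v i) (v j)} = ?o i j"
        by (cases "max (u i) (u j) \<le> min (v i) (v j)") (simp_all only: overlap_def, auto)
      ultimately show ?thesis
        using has_bochner_integral_real_indicator[of "{max (u i) (u j)<..min (v i) (v j)}" lborel]
        by (cases "max (u i) (u j) \<le> min (v i) (v j)") auto
    qed
    then have "has_bochner_integral lborel (\<lambda>s. \<Sum>i\<in>A. \<Sum>j\<in>A.
        indicator ({u i<..v i} \<inter> {u j<..v j}) s * (h i \<omega> \<bullet> h j \<omega>)) (N \<omega>)"
      unfolding N_def by (intro has_bochner_integral_sum has_bochner_integral_mult_left)
    moreover have "(norm (V s \<omega>))\<^sup>2 = (\<Sum>i\<in>A. \<Sum>j\<in>A.
        indicator ({u i<..v i} \<inter> {u j<..v j}) s * (h i \<omega> \<bullet> h j \<omega>))" for s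
      unfolding V_def power2_norm_eq_inner inner_sum_left inner_sum_right
      by (intro sum.cong refl)
         (simp only: inner_scaleR_left inner_scaleR_right indicator_inter_arith inner_commute mult_ac)
    ultimately show ?thesis by simp
  qed
  have V0: "V s \<omega> = 0" if "s \<notin> {0..t}" for s \<omega>
    unfolding V_def
  proof (rule sum.neutral, rule ballI)
    fix i assume i: "i \<in> A"
    have "s \<notin> {u i<..v i}" using uv[OF i] that by auto
    then show "indicator {u i<..v i} s *\<^sub>R h i \<omega> = 0" by simp
  qed
  have "(\<integral>\<^sup>+s\<in>{0..t}. ennreal ((norm (V s \<omega>))\<^sup>2) \<partial>lborel) = ennreal (N \<omega>)" for \<omega>
  proof -
    have "(\<integral>\<^sup>+s\<in>{0..t}. ennreal ((norm (V s \<omega>))\<^sup>2) \<partial>lborel) = (\<integral>\<^sup>+s. ennreal ((norm (V s \<omega>))\<^sup>2) \<partial>lborel)"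
      by (rule nn_integral_cong) (auto simp: V0 split: split_indicator)
    also have "\<dots> = ennreal (\<integral>s. (norm (V s \<omega>))\<^sup>2 \<partial>lborel)"
      using V[of \<omega>] by (intro nn_integral_eq_integral) (auto simp: has_bochner_integral_iff)
    finally show ?thesis using V[of \<omega>] by (simp add: has_bochner_integral_iff)
  qed
  moreover have "0 \<le> N \<omega>" for \<omega>
  proof -
    have "N \<omega> = (\<integral>s. (norm (V s \<omega>))\<^sup>2 \<partial>lborel)"
      using V[of \<omega>] by (simp add: has_bochner_integral_iff)
    then show ?thesis by simp
  qed
  ultimately show ?thesis
    unfolding S_def[symmetric] V_def[symmetric]
    using S N by (simp add: nn_integral_eq_integral has_bochner_integral_iff)
qed

section \<open>A mean-square bound for the difference of two Ito integrals\<close>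

lemma simple_process_times:
  assumes "simple_process F t n \<tau> h" "i \<le> n"
  shows "0 \<le> \<tau> i" "\<tau> i \<le> t"
proof -
  have step: "\<And>i. i < n \<Longrightarrow> \<tau> i \<le> \<tau> (Suc i)" and "0 \<le> \<tau> 0" "\<tau> n \<le> t"
    using assms(1) by (auto simp: simple_process_def)
  show "0 \<le> \<tau> i"
    using \<open>i \<le> n\<close>
  proof (induction i)
    case (Suc i)
    then show ?case using step[of i] by simp
  qed (use \<open>0 \<le> \<tau> 0\<close> in simp)
  show "\<tau> i \<le> t"
    using \<open>i \<le> n\<close>
  proof (induction rule: inc_induct)
    case (step m)
    then show ?case using \<open>\<And>i. i < n \<Longrightarrow> \<tau> i \<le> \<tau> (Suc i)\<close>[of m] by simp
  qed (use \<open>\<tau> n \<le> t\<close> in simp)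
qed

text \<open>
  Each weight of a simple process is bounded separately; finiteness gives a common bound, as needed for
  the isometry of a family.
\<close>

lemma simple_process_bounded:
  assumes "simple_process F t n \<tau> h"
  obtains B where "\<And>i \<omega>. i < n \<Longrightarrow> \<omega> \<in> space M \<Longrightarrow> norm (h i \<omega>) \<le> B"
proof -
  have "bounded (h i ` space M)" if "i < n" for i
    using assms that simple_process_times[OF assms, of i] space_F[of "\<tau> i"]
    by (auto simp: simple_process_def)
  then have "bounded (\<Union>i<n. h i ` space M)"
    by (intro bounded_UN) auto
  then obtain B where "\<forall>x\<in>(\<Union>i<n. h i ` space M). norm x \<le> B"
    by (auto simp: bounded_iff)
  then show ?thesis by (intro that[of B]) auto
qed

lemma simple_integral_diff_isometry:
  fixes h h' :: "nat \<Rightarrow> 'a \<Rightarrow> real^'m^'r"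
  assumes h: "simple_process F t n \<tau> h" and h': "simple_process F t n' \<tau>' h'"
  shows "(\<integral>\<^sup>+\<omega>. ennreal ((norm (simple_integral W n \<tau> h \<omega> - simple_integral W n' \<tau>' h' \<omega>))\<^sup>2) \<partial>M) =
    (\<integral>\<^sup>+\<omega>. (\<integral>\<^sup>+s\<in>{0..t}. ennreal ((norm (simple_value n \<tau> h s \<omega> - simple_value n' \<tau>' h' s \<omega>))\<^sup>2) \<partial>lborel) \<partial>M)"
proof -
  \<comment> \<open>The difference of the two processes is a single family, indexed by a disjoint union.\<close>
  let ?A = "{..<n} <+> {..<n'}"
  let ?u = "case_sum \<tau> \<tau>'" and ?v = "case_sum (\<lambda>i. \<tau> (Suc i)) (\<lambda>i. \<tau>' (Suc i))"
  let ?h = "case_sum h (\<lambda>i \<omega>. - h' i \<omega>)"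
  obtain B B' where B: "\<And>i \<omega>. i < n \<Longrightarrow> \<omega> \<in> space M \<Longrightarrow> norm (h i \<omega>) \<le> B"
    and B': "\<And>i \<omega>. i < n' \<Longrightarrow> \<omega> \<in> space M \<Longrightarrow> norm (h' i \<omega>) \<le> B'"
    using simple_process_bounded[OF h] simple_process_bounded[OF h'] by metis
  have "(\<integral>\<^sup>+\<omega>. ennreal ((norm (\<Sum>i\<in>?A. ?h i \<omega> *v \<Delta> (?u i) (?v i) \<omega>))\<^sup>2) \<partial>M) =
    (\<integral>\<^sup>+\<omega>. (\<integral>\<^sup>+s\<in>{0..t}. ennreal ((norm (\<Sum>i\<in>?A. indicator {?u i<..?v i} s *\<^sub>R ?h i \<omega>))\<^sup>2) \<partial>lborel) \<partial>M)"
  proof (rule ito_isometry_step_family[where B="max B B'"])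
    fix i assume i: "i \<in> ?A"
    show "0 \<le> ?u i" "?v i \<le> t"
      using i simple_process_times[OF h] simple_process_times[OF h'] by auto
    show "?u i \<le> ?v i" "?h i \<in> borel_measurable (F (?u i))"
      using i h h' by (auto simp: simple_process_def)
    show "norm (?h i \<omega>) \<le> max B B'" if "\<omega> \<in> space M" for \<omega>
      using i B[OF _ that] B'[OF _ that] by (auto simp: le_max_iff_disj)
  qed simp
  moreover have "(- X) *v y = - (X *v y)" for X :: "real^'m^'r" and y
    by (simp add: matrix_vector_mult_def vec_eq_iff sum_negf)
  ultimately show ?thesis
    by (simp only: sum.Plus[OF finite_lessThan finite_lessThan] comp_def sum.case simple_integral_def
          simple_value_def scaleR_minus_right sum_negf \<Delta>_def add_uminus_conv_diff)
qed

lemma measurable_progressively_measurable: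
  assumes "progressively_measurable F t H" "0 \<le> t"
  shows "(\<lambda>(\<omega>, s). H s \<omega>) \<in> borel_measurable (M \<Otimes>\<^sub>M restrict_space lborel {0..t})"
proof -
  have id: "(\<lambda>\<omega>. \<omega>) \<in> measurable M (F t)"
    using measurable_F_M[OF measurable_ident_sets[OF refl] \<open>0 \<le> t\<close>] .
  have H: "(\<lambda>(s, \<omega>). H s \<omega>) \<in> borel_measurable (restrict_space borel {0..t} \<Otimes>\<^sub>M F t)"
    using assms by (auto simp: progressively_measurable_def)
  have id': "(\<lambda>s. s) \<in> measurable (restrict_space lborel {0..t}) (restrict_space borel {0..t})"
    by (intro measurable_ident_sets) (simp add: sets_restrict_space)
  have "(\<lambda>x. (snd x, fst x)) \<in> measurable (M \<Otimes>\<^sub>M restrict_space lborel {0..t}) (restrict_space borel {0..t} \<Otimes>\<^sub>M F t)"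
    by (intro measurable_Pair measurable_compose[OF measurable_snd id'] measurable_compose[OF measurable_fst id])
  from measurable_compose[OF this H] show ?thesis by (simp add: case_prod_unfold)
qed

lemma measurable_simple_value:
  assumes "simple_process F t n \<tau> h"
  shows "(\<lambda>(\<omega>, s). simple_value n \<tau> h s \<omega>) \<in> borel_measurable (M \<Otimes>\<^sub>M restrict_space lborel {0..t})"
proof -
  have h: "h i \<in> borel_measurable M" if "i < n" for i
    using measurable_F_M[of "h i" "\<tau> i"] simple_process_times[OF assms, of i] that assms
    by (auto simp: simple_process_def)
  have ind: "(indicator {\<tau> i<..\<tau> (Suc i)} :: real \<Rightarrow> real) \<in> borel_measurable (restrict_space lborel {0..t})" for i
    by (intro measurable_restrict_space1) auto
  show ?thesis
    unfolding simple_value_def case_prod_unfold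
    by (intro borel_measurable_sum borel_measurable_scaleR measurable_compose[OF measurable_snd ind]
          measurable_compose[OF measurable_fst h]) auto
qed

end

lemma norm_add3_square_le:
  fixes x y z :: "'a::real_normed_vector"
  shows "(norm (x + y + z))\<^sup>2 \<le> 3 * ((norm x)\<^sup>2 + (norm y)\<^sup>2 + (norm z)\<^sup>2)"
proof -
  have "(norm (x + y + z))\<^sup>2 \<le> (norm x + norm y + norm z)\<^sup>2"
    by (intro power_mono norm_triangle_le add_right_mono norm_triangle_ineq) auto
  also have "\<dots> \<le> 3 * ((norm x)\<^sup>2 + (norm y)\<^sup>2 + (norm z)\<^sup>2)"
    using sum_squares_ge_zero[of "norm x - norm y" "norm y - norm z"] zero_le_power2[of "norm x - norm z"]
    by (simp add: power2_eq_square algebra_simps)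
  finally show ?thesis .
qed

lemma nn_integral_norm_add3_square_le:
  fixes f g h :: "'a \<Rightarrow> 'b::{real_normed_vector, second_countable_topology}"
  assumes [measurable]: "f \<in> borel_measurable N" "g \<in> borel_measurable N" "h \<in> borel_measurable N"
  shows "(\<integral>\<^sup>+x. ennreal ((norm (f x + g x + h x))\<^sup>2) \<partial>N) \<le>
    3 * ((\<integral>\<^sup>+x. ennreal ((norm (f x))\<^sup>2) \<partial>N) + (\<integral>\<^sup>+x. ennreal ((norm (g x))\<^sup>2) \<partial>N) + (\<integral>\<^sup>+x. ennreal ((norm (h x))\<^sup>2) \<partial>N))"
proof -
  have "(\<integral>\<^sup>+x. ennreal ((norm (f x + g x + h x))\<^sup>2) \<partial>N) \<le>
      (\<integral>\<^sup>+x. 3 * (ennreal ((norm (f x))\<^sup>2) + ennreal ((norm (g x))\<^sup>2) + ennreal ((norm (h x))\<^sup>2)) \<partial>N)"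
    using norm_add3_square_le[of "f _" "g _" "h _"]
    by (intro nn_integral_mono) (simp add: ennreal_leI flip: ennreal_plus ennreal_mult ennreal_numeral)
  then show ?thesis
    by (simp add: nn_integral_cmult nn_integral_add)
qed

context filtered_brownian_motion
begin

text \<open>
  The Ito isometry up to a constant.  For approximating simple processes \<open>V, V'\<close> with integrals \<open>S, S'\<close>,
  \<open>I - I' = (I - S) + (S' - I') + (S - S')\<close>; the isometry applies to \<open>S - S'\<close>, and
  \<open>V - V' = (V - H) + (H' - V') + (H - H')\<close>.  All but the last terms vanish in the limit, and each of the
  two splittings into three terms costs a factor \<open>3\<close> in mean square.
\<close>

lemma ito_integral_diff_le:
  fixes H H' :: "real \<Rightarrow> 'a \<Rightarrow> real^'m^'r"
  assumes I: "has_ito_integral M F W t H I" and I': "has_ito_integral M F W t H' I'" and "0 \<le> t"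
  shows "(\<integral>\<^sup>+\<omega>. ennreal ((norm (I \<omega> - I' \<omega>))\<^sup>2) \<partial>M) \<le>
    9 * (\<integral>\<^sup>+\<omega>. (\<integral>\<^sup>+s\<in>{0..t}. ennreal ((norm (H s \<omega> - H' s \<omega>))\<^sup>2) \<partial>lborel) \<partial>M)"
proof -
  define L where "L = restrict_space lborel {0..t}"
  interpret L: sigma_finite_measure L
    unfolding L_def by (rule sigma_finite_measure_restrict_space) (auto intro: sigma_finite_lborel)
  have L: "(\<integral>\<^sup>+s\<in>{0..t}. f s \<partial>lborel) = (\<integral>\<^sup>+s. f s \<partial>L)" for f :: "real \<Rightarrow> ennreal"
    by (simp add: L_def nn_integral_restrict_space)
  have pair: "(\<integral>\<^sup>+\<omega>. (\<integral>\<^sup>+s. f s \<omega> \<partial>L) \<partial>M) = (\<integral>\<^sup>+x. f (snd x) (fst x) \<partial>(M \<Otimes>\<^sub>M L))"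
    if "(\<lambda>x. f (snd x) (fst x)) \<in> borel_measurable (M \<Otimes>\<^sub>M L)" for f :: "real \<Rightarrow> 'a \<Rightarrow> ennreal"
    using L.nn_integral_fst[OF that] by simp
  obtain n \<tau> h where simp: "\<And>k. simple_process F t (n k) (\<tau> k) (h k)"
    and lim: "(\<lambda>k. \<integral>\<^sup>+\<omega>. (\<integral>\<^sup>+s\<in>{0..t}. ennreal ((norm (simple_value (n k) (\<tau> k) (h k) s \<omega> - H s \<omega>))\<^sup>2) \<partial>lborel) \<partial>M) \<longlonglongrightarrow> 0"
      "(\<lambda>k. \<integral>\<^sup>+\<omega>. ennreal ((norm (simple_integral W (n k) (\<tau> k) (h k) \<omega> - I \<omega>))\<^sup>2) \<partial>M) \<longlonglongrightarrow> 0"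
    using I unfolding has_ito_integral_def by blast
  obtain n' \<tau>' h' where simp': "\<And>k. simple_process F t (n' k) (\<tau>' k) (h' k)"
    and lim': "(\<lambda>k. \<integral>\<^sup>+\<omega>. (\<integral>\<^sup>+s\<in>{0..t}. ennreal ((norm (simple_value (n' k) (\<tau>' k) (h' k) s \<omega> - H' s \<omega>))\<^sup>2) \<partial>lborel) \<partial>M) \<longlonglongrightarrow> 0"
      "(\<lambda>k. \<integral>\<^sup>+\<omega>. ennreal ((norm (simple_integral W (n' k) (\<tau>' k) (h' k) \<omega> - I' \<omega>))\<^sup>2) \<partial>M) \<longlonglongrightarrow> 0"
    using I' unfolding has_ito_integral_def by blast
  define S where "S k = simple_integral W (n k) (\<tau> k) (h k)" for k
  define S' where "S' k = simple_integral W (n' k) (\<tau>' k) (h' k)" for k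
  define V where "V k = simple_value (n k) (\<tau> k) (h k)" for k
  define V' where "V' k = simple_value (n' k) (\<tau>' k) (h' k)" for k
  note lim = lim[folded S_def V_def] and lim' = lim'[folded S'_def V'_def]
  have [measurable]: "I \<in> borel_measurable M" "I' \<in> borel_measurable M"
    using I I' by (auto simp: has_ito_integral_def)
  have W [measurable]: "W s \<in> borel_measurable M" if "0 \<le> s" for s
    using brownian measurable_F_M[of "W s" s] that by (auto simp: standard_brownian_motion_def)
  have mvm: "(\<lambda>\<omega>. X \<omega> *v y \<omega>) \<in> borel_measurable M"
    if "X \<in> borel_measurable M" "y \<in> borel_measurable M" for X :: "'a \<Rightarrow> real^'m^'r" and y
    using that by (rule borel_measurable_bounded_bilinear[OF bounded_bilinear_matrix_vector_mult])
  have S_meas: "simple_integral W n \<tau> h \<in> borel_measurable M"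
    if "simple_process F t n \<tau> h" for n \<tau> and h :: "nat \<Rightarrow> 'a \<Rightarrow> real^'m^'r"
  proof -
    have "h i \<in> borel_measurable M" if "i < n" for i
      using measurable_F_M[of "h i" "\<tau> i"] simple_process_times[OF \<open>simple_process F t n \<tau> h\<close>, of i] that
        \<open>simple_process F t n \<tau> h\<close>
      by (auto simp: simple_process_def)
    then show ?thesis
      unfolding simple_integral_def[abs_def]
      using simple_process_times[OF that]
      by (intro borel_measurable_sum mvm borel_measurable_diff W) auto
  qed
  have [measurable]: "S k \<in> borel_measurable M" "S' k \<in> borel_measurable M" for k
    unfolding S_def S'_def using S_meas simp simp' by blast+
  have [measurable]: "(\<lambda>x. H (snd x) (fst x)) \<in> borel_measurable (M \<Otimes>\<^sub>M L)"
      "(\<lambda>x. H' (snd x) (fst x)) \<in> borel_measurable (M \<Otimes>\<^sub>M L)"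
    using I I' measurable_progressively_measurable[OF _ \<open>0 \<le> t\<close>, of H]
      measurable_progressively_measurable[OF _ \<open>0 \<le> t\<close>, of H']
    by (auto simp: has_ito_integral_def L_def case_prod_unfold)
  have [measurable]: "(\<lambda>x. V k (snd x) (fst x)) \<in> borel_measurable (M \<Otimes>\<^sub>M L)"
      "(\<lambda>x. V' k (snd x) (fst x)) \<in> borel_measurable (M \<Otimes>\<^sub>M L)" for k
    using measurable_simple_value[OF simp[of k]] measurable_simple_value[OF simp'[of k]]
    by (auto simp: L_def V_def V'_def case_prod_unfold)
  let ?E = "\<lambda>f. \<integral>\<^sup>+\<omega>. ennreal ((norm (f \<omega>))\<^sup>2) \<partial>M"
  let ?D = "\<lambda>f. \<integral>\<^sup>+\<omega>. (\<integral>\<^sup>+s\<in>{0..t}. ennreal ((norm (f s \<omega>))\<^sup>2) \<partial>lborel) \<partial>M"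
  have D: "?D f = (\<integral>\<^sup>+x. ennreal ((norm (f (snd x) (fst x)))\<^sup>2) \<partial>(M \<Otimes>\<^sub>M L))"
    if [measurable]: "(\<lambda>x. f (snd x) (fst x)) \<in> borel_measurable (M \<Otimes>\<^sub>M L)" for f :: "real \<Rightarrow> 'a \<Rightarrow> real^'m^'r"
    unfolding L by (rule pair) measurable
  have D3: "?D (\<lambda>s \<omega>. f s \<omega> + g s \<omega> + h s \<omega>) \<le> 3 * (?D f + ?D g + ?D h)"
    if [measurable]: "(\<lambda>x. f (snd x) (fst x)) \<in> borel_measurable (M \<Otimes>\<^sub>M L)"
      "(\<lambda>x. g (snd x) (fst x)) \<in> borel_measurable (M \<Otimes>\<^sub>M L)"
      "(\<lambda>x. h (snd x) (fst x)) \<in> borel_measurable (M \<Otimes>\<^sub>M L)" for f g h :: "real \<Rightarrow> 'a \<Rightarrow> real^'m^'r"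
  proof -
    have "(\<lambda>x. f (snd x) (fst x) + g (snd x) (fst x) + h (snd x) (fst x)) \<in> borel_measurable (M \<Otimes>\<^sub>M L)"
      by measurable
    from D[OF this] D[OF that(1)] D[OF that(2)] D[OF that(3)]
    show ?thesis
      by (simp only:) (rule nn_integral_norm_add3_square_le, measurable)
  qed
  have "?E (\<lambda>\<omega>. I \<omega> - I' \<omega>) \<le>
      3 * (?E (\<lambda>\<omega>. S k \<omega> - I \<omega>) + ?E (\<lambda>\<omega>. S' k \<omega> - I' \<omega>) +
        3 * (?D (\<lambda>s \<omega>. V k s \<omega> - H s \<omega>) + ?D (\<lambda>s \<omega>. V' k s \<omega> - H' s \<omega>) + ?D (\<lambda>s \<omega>. H s \<omega> - H' s \<omega>)))" for k
  proof -
    have "?E (\<lambda>\<omega>. I \<omega> - I' \<omega>) = ?E (\<lambda>\<omega>. (I \<omega> - S k \<omega>) + (S' k \<omega> - I' \<omega>) + (S k \<omega> - S' k \<omega>))"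
      by (simp add: algebra_simps)
    also have "\<dots> \<le> 3 * (?E (\<lambda>\<omega>. I \<omega> - S k \<omega>) + ?E (\<lambda>\<omega>. S' k \<omega> - I' \<omega>) + ?E (\<lambda>\<omega>. S k \<omega> - S' k \<omega>))"
      by (rule nn_integral_norm_add3_square_le) measurable
    also have "?E (\<lambda>\<omega>. S k \<omega> - S' k \<omega>) = ?D (\<lambda>s \<omega>. V k s \<omega> - V' k s \<omega>)"
      unfolding S_def S'_def V_def V'_def by (rule simple_integral_diff_isometry[OF simp simp'])
    also have "?D (\<lambda>s \<omega>. V k s \<omega> - V' k s \<omega>)
        = ?D (\<lambda>s \<omega>. (V k s \<omega> - H s \<omega>) + (H' s \<omega> - V' k s \<omega>) + (H s \<omega> - H' s \<omega>))"
      by (simp add: algebra_simps)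
    also have "\<dots> \<le> 3 * (?D (\<lambda>s \<omega>. V k s \<omega> - H s \<omega>) + ?D (\<lambda>s \<omega>. H' s \<omega> - V' k s \<omega>) + ?D (\<lambda>s \<omega>. H s \<omega> - H' s \<omega>))"
      by (rule D3) measurable
    finally show ?thesis
      by (simp add: norm_minus_commute[of "I _"] norm_minus_commute[of "H' _ _"] add_left_mono mult_left_mono)
  qed
  moreover have "(\<lambda>k. 3 * (?E (\<lambda>\<omega>. S k \<omega> - I \<omega>) + ?E (\<lambda>\<omega>. S' k \<omega> - I' \<omega>) +
        3 * (?D (\<lambda>s \<omega>. V k s \<omega> - H s \<omega>) + ?D (\<lambda>s \<omega>. V' k s \<omega> - H' s \<omega>) + ?D (\<lambda>s \<omega>. H s \<omega> - H' s \<omega>))))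
      \<longlonglongrightarrow> 3 * (0 + 0 + 3 * (0 + 0 + ?D (\<lambda>s \<omega>. H s \<omega> - H' s \<omega>)))"
    by (intro tendsto_add ennreal_tendsto_cmult lim lim' tendsto_const) auto
  ultimately have "?E (\<lambda>\<omega>. I \<omega> - I' \<omega>) \<le> 3 * (0 + 0 + 3 * (0 + 0 + ?D (\<lambda>s \<omega>. H s \<omega> - H' s \<omega>)))"
    by (intro LIMSEQ_le_const) auto
  then show ?thesis by (simp flip: mult.assoc)
qed

end

section \<open>Processes with continuous paths and square-integrable functions\<close>

text \<open>
  \<open>Z\<close> is the pointwise limit of its values at the time rounded down to multiples of \<open>1/(n+1)\<close>, and each
  such approximation takes the time argument through a countable set.
\<close>

lemma measurable_continuous_paths:
  fixes Z :: "real \<Rightarrow> 'a \<Rightarrow> 'b::{metric_space, second_countable_topology}"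
  assumes "0 \<le> T"
    and cont: "\<And>\<omega>. \<omega> \<in> space M \<Longrightarrow> continuous_on {0..T} (\<lambda>t. Z t \<omega>)"
    and meas: "\<And>t. t \<in> {0..T} \<Longrightarrow> Z t \<in> borel_measurable M"
  shows "(\<lambda>(s, \<omega>). Z s \<omega>) \<in> borel_measurable (restrict_space lborel {0..T} \<Otimes>\<^sub>M M)"
proof -
  let ?N = "restrict_space lborel {0..T} \<Otimes>\<^sub>M M"
  \<comment> \<open>Clamping keeps the rounded times inside \<open>[0,T]\<close>, the only times at which \<open>Z\<close> is constrained.\<close>
  define clamp where "clamp s = max 0 (min T s)" for s
  have clamp: "clamp s \<in> {0..T}" for s using \<open>0 \<le> T\<close> by (auto simp: clamp_def)
  have clamp_id: "clamp s = s" if "s \<in> {0..T}" for s using that by (auto simp: clamp_def)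
  define g where "g n s = \<lfloor>real (Suc n) * s\<rfloor>" for n s
  define f where "f n p = Z (clamp (of_int (g n (fst p)) / real (Suc n))) (snd p)" for n p
  have fst: "fst \<in> borel_measurable ?N"
    by (rule measurable_compose[OF measurable_fst]) (auto intro: measurable_restrict_space1)
  have "f n \<in> borel_measurable ?N" for n
  proof -
    have "(\<lambda>p. g n (fst p)) \<in> measurable ?N (count_space UNIV)"
      unfolding g_def using fst by measurable
    moreover have "(\<lambda>p. Z (clamp (of_int k / real (Suc n))) (snd p)) \<in> borel_measurable ?N" for k
      by (rule measurable_compose[OF measurable_snd meas[OF clamp]])
    ultimately show ?thesis
      unfolding f_def
      by (rule measurable_compose_countable[where f="\<lambda>k p. Z (clamp (of_int k / real (Suc n))) (snd p)", rotated])
  qed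
  moreover have "(\<lambda>n. f n p) \<longlonglongrightarrow> Z (fst p) (snd p)" if p: "p \<in> space ?N" for p
  proof -
    have s: "fst p \<in> {0..T}" and \<omega>: "snd p \<in> space M"
      using p by (auto simp: space_pair_measure space_restrict_space)
    have "(\<lambda>n. of_int (g n (fst p)) / real (Suc n)) \<longlonglongrightarrow> fst p"
    proof (rule tendsto_sandwich)
      show "\<forall>\<^sub>F n in sequentially. fst p - 1 / real (Suc n) \<le> of_int (g n (fst p)) / real (Suc n)"
      proof (intro always_eventually allI)
        fix n
        have "fst p - 1 / real (Suc n) = (real (Suc n) * fst p - 1) / real (Suc n)"
          by (simp add: diff_divide_distrib)
        also have "\<dots> \<le> of_int (g n (fst p)) / real (Suc n)"
          unfolding g_def by (intro divide_right_mono) linarith+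
        finally show "fst p - 1 / real (Suc n) \<le> of_int (g n (fst p)) / real (Suc n)" .
      qed
      show "\<forall>\<^sub>F n in sequentially. of_int (g n (fst p)) / real (Suc n) \<le> fst p"
      proof (intro always_eventually allI)
        fix n
        have "of_int (g n (fst p)) / real (Suc n) \<le> real (Suc n) * fst p / real (Suc n)"
          unfolding g_def by (intro divide_right_mono) linarith+
        then show "of_int (g n (fst p)) / real (Suc n) \<le> fst p" by simp
      qed
      have "(\<lambda>n. fst p - 1 / real (Suc n)) \<longlonglongrightarrow> fst p - 0"
        using LIMSEQ_inverse_real_of_nat by (intro tendsto_intros) (simp add: inverse_eq_divide)
      then show "(\<lambda>n. fst p - 1 / real (Suc n)) \<longlonglongrightarrow> fst p" by simp
    qed simp
    then have "(\<lambda>n. clamp (of_int (g n (fst p)) / real (Suc n))) \<longlonglongrightarrow> clamp (fst p)"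
      unfolding clamp_def by (intro tendsto_intros)
    then have "(\<lambda>n. Z (clamp (of_int (g n (fst p)) / real (Suc n))) (snd p)) \<longlonglongrightarrow> Z (clamp (fst p)) (snd p)"
      by (intro continuous_on_tendsto_compose[OF cont[OF \<omega>]]) (use clamp in auto)
    then show ?thesis by (simp add: f_def clamp_id[OF s])
  qed
  ultimately have "(\<lambda>p. Z (fst p) (snd p)) \<in> borel_measurable ?N"
    by (rule borel_measurable_LIMSEQ_metric)
  then show ?thesis by (simp add: case_prod_unfold)
qed

lemma continuous_on_integral_dominated:
  fixes f :: "real \<Rightarrow> 'a \<Rightarrow> 'b::{banach, second_countable_topology}"
  assumes cont: "\<And>\<omega>. \<omega> \<in> space M \<Longrightarrow> continuous_on S (\<lambda>t. f t \<omega>)"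
    and meas: "\<And>t. t \<in> S \<Longrightarrow> f t \<in> borel_measurable M"
    and dom: "\<And>t \<omega>. t \<in> S \<Longrightarrow> \<omega> \<in> space M \<Longrightarrow> norm (f t \<omega>) \<le> w \<omega>" "integrable M w"
  shows "continuous_on S (\<lambda>t. \<integral>\<omega>. f t \<omega> \<partial>M)"
  unfolding continuous_on_sequentially comp_def
proof (intro allI ballI impI)
  fix x a assume a: "a \<in> S" and "(\<forall>n. x n \<in> S) \<and> x \<longlonglongrightarrow> a"
  then have x: "x n \<in> S" "x \<longlonglongrightarrow> a" for n by auto
  show "(\<lambda>n. \<integral>\<omega>. f (x n) \<omega> \<partial>M) \<longlonglongrightarrow> (\<integral>\<omega>. f a \<omega> \<partial>M)"
  proof (rule integral_dominated_convergence[where w=w])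
    show "AE \<omega> in M. (\<lambda>n. f (x n) \<omega>) \<longlonglongrightarrow> f a \<omega>"
      using x a by (intro AE_I2 continuous_on_tendsto_compose[OF cont]) auto
  qed (use meas dom x a in auto)
qed

text \<open>
  The Cauchy--Schwarz inequality, transferred from nonnegative extended reals to integrable functions.
\<close>

lemma
  fixes f g :: "'a \<Rightarrow> real"
  assumes [measurable]: "f \<in> borel_measurable M" "g \<in> borel_measurable M"
    and int: "integrable M (\<lambda>x. (f x)\<^sup>2)" "integrable M (\<lambda>x. (g x)\<^sup>2)"
  shows integrable_mult_L2: "integrable M (\<lambda>x. f x * g x)"
    and integral_mult_le_L2: "(\<integral>x. f x * g x \<partial>M) \<le> sqrt (\<integral>x. (f x)\<^sup>2 \<partial>M) * sqrt (\<integral>x. (g x)\<^sup>2 \<partial>M)"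
proof -
  have abs_le: "\<bar>f x * g x\<bar> \<le> (f x)\<^sup>2 + (g x)\<^sup>2" for x
  proof -
    have "2 * \<bar>f x\<bar> * \<bar>g x\<bar> \<le> (f x)\<^sup>2 + (g x)\<^sup>2"
      using sum_squares_bound[of "\<bar>f x\<bar>" "\<bar>g x\<bar>"] by (simp only: power2_abs)
    moreover have "0 \<le> \<bar>f x\<bar> * \<bar>g x\<bar>" by simp
    ultimately show ?thesis unfolding abs_mult by linarith
  qed
  show 1: "integrable M (\<lambda>x. f x * g x)"
    by (rule Bochner_Integration.integrable_bound[OF Bochner_Integration.integrable_add[OF int]])
       (use abs_le in \<open>auto intro!: AE_I2\<close>)
  let ?I = "\<integral>x. \<bar>f x * g x\<bar> \<partial>M"
  have "(\<integral>\<^sup>+x. ennreal \<bar>f x\<bar> * ennreal \<bar>g x\<bar> \<partial>M) = ennreal ?I"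
    using nn_integral_eq_integral[OF integrable_abs[OF 1]] by (simp add: abs_mult ennreal_mult)
  then have "ennreal (?I\<^sup>2) = (\<integral>\<^sup>+x. ennreal \<bar>f x\<bar> * ennreal \<bar>g x\<bar> \<partial>M)\<^sup>2"
    by (simp add: ennreal_power)
  also have "\<dots> \<le> (\<integral>\<^sup>+x. ennreal \<bar>f x\<bar> ^ 2 \<partial>M) * (\<integral>\<^sup>+x. ennreal \<bar>g x\<bar> ^ 2 \<partial>M)"
    by (rule Cauchy_Schwarz_nn_integral) measurable
  also have "\<dots> = ennreal ((\<integral>x. (f x)\<^sup>2 \<partial>M) * (\<integral>x. (g x)\<^sup>2 \<partial>M))"
    using int by (simp add: ennreal_power nn_integral_eq_integral ennreal_mult)
  finally have "?I\<^sup>2 \<le> (\<integral>x. (f x)\<^sup>2 \<partial>M) * (\<integral>x. (g x)\<^sup>2 \<partial>M)"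
    by (subst (asm) ennreal_le_iff) (auto intro!: mult_nonneg_nonneg)
  then have "?I \<le> sqrt (\<integral>x. (f x)\<^sup>2 \<partial>M) * sqrt (\<integral>x. (g x)\<^sup>2 \<partial>M)"
    by (simp add: real_le_rsqrt flip: real_sqrt_mult)
  moreover have "(\<integral>x. f x * g x \<partial>M) \<le> ?I"
    using 1 by (intro integral_mono) auto
  ultimately show "(\<integral>x. f x * g x \<partial>M) \<le> sqrt (\<integral>x. (f x)\<^sup>2 \<partial>M) * sqrt (\<integral>x. (g x)\<^sup>2 \<partial>M)"
    by linarith
qed

text \<open>
  The Cauchy--Schwarz inequality against the indicator of \<open>[0,t]\<close>.  The right-hand side is an extended
  real, so that it can be integrated over \<open>\<Omega>\<close> and exchanged with the time integral directly.
\<close>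

lemma norm_set_integral_square_le:
  fixes f :: "real \<Rightarrow> 'b::{banach, second_countable_topology}"
  assumes f: "set_integrable lborel {0..t} f" and "0 \<le> t"
  shows "ennreal ((norm (LINT s:{0..t}|lborel. f s))\<^sup>2) \<le>
    ennreal t * (\<integral>\<^sup>+s\<in>{0..t}. ennreal ((norm (f s))\<^sup>2) \<partial>lborel)"
proof -
  let ?g = "\<lambda>s. indicator {0..t} s *\<^sub>R f s" and ?i = "\<lambda>s. indicator {0..t} s :: ennreal"
  have [measurable]: "?g \<in> borel_measurable lborel"
    using f by (auto simp: set_integrable_def)
  have eq: "ennreal (norm (?g s)) = ennreal (norm (?g s)) * ?i s" for s
    by (simp split: split_indicator)
  have "ennreal (norm (LINT s:{0..t}|lborel. f s)) \<le> (\<integral>\<^sup>+s. ennreal (norm (?g s)) \<partial>lborel)"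
    using f unfolding set_lebesgue_integral_def set_integrable_def by (rule integral_norm_bound_ennreal)
  also have "\<dots> = (\<integral>\<^sup>+s. ennreal (norm (?g s)) * ?i s \<partial>lborel)"
    by (subst eq) (rule refl)
  finally have "(ennreal (norm (LINT s:{0..t}|lborel. f s)))\<^sup>2 \<le> (\<integral>\<^sup>+s. ennreal (norm (?g s)) * ?i s \<partial>lborel)\<^sup>2"
    by (intro power_mono) auto
  also have "\<dots> \<le> (\<integral>\<^sup>+s. ennreal (norm (?g s)) ^ 2 \<partial>lborel) * (\<integral>\<^sup>+s. ?i s ^ 2 \<partial>lborel)"
    by (rule Cauchy_Schwarz_nn_integral) measurable
  also have "(\<lambda>s. ?i s ^ 2) = ?i"
    by (auto split: split_indicator)
  also have "(\<integral>\<^sup>+s. ?i s \<partial>lborel) = ennreal t"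
    using \<open>0 \<le> t\<close> by simp
  also have "(\<integral>\<^sup>+s. ennreal (norm (?g s)) ^ 2 \<partial>lborel) = (\<integral>\<^sup>+s\<in>{0..t}. ennreal ((norm (f s))\<^sup>2) \<partial>lborel)"
    by (rule nn_integral_cong) (simp add: ennreal_power split: split_indicator)
  finally show ?thesis
    by (simp add: ennreal_power mult.commute)
qed

lemma norm_diff_square_le:
  fixes x y :: "'a::real_normed_vector"
  shows "(norm (x - y))\<^sup>2 \<le> 2 * (norm x)\<^sup>2 + 2 * (norm y)\<^sup>2"
proof -
  have "(norm (x - y))\<^sup>2 \<le> (norm x + norm y)\<^sup>2"
    by (intro power_mono norm_triangle_ineq4) simp
  also have "\<dots> \<le> 2 * (norm x)\<^sup>2 + 2 * (norm y)\<^sup>2"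
    using zero_le_power2[of "norm x - norm y"] by (simp add: power2_eq_square algebra_simps)
  finally show ?thesis .
qed

lemma norm_integral_le_integral:
  fixes f :: "'a \<Rightarrow> 'b::{banach, second_countable_topology}"
  assumes "integrable M f" "integrable M g" "\<And>x. x \<in> space M \<Longrightarrow> norm (f x) \<le> g x"
  shows "norm (\<integral>x. f x \<partial>M) \<le> (\<integral>x. g x \<partial>M)"
proof -
  have "(\<integral>x. norm (f x) \<partial>M) \<le> (\<integral>x. g x \<partial>M)"
    using assms by (intro integral_mono integrable_norm)
  with integral_norm_bound[of M f] show ?thesis by linarith
qed

lemma nn_integral_continuous_eq_integral:
  fixes g :: "real \<Rightarrow> real"
  assumes "continuous_on {0..t} g" and nonneg: "\<And>s. s \<in> {0..t} \<Longrightarrow> 0 \<le> g s"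
  shows "(\<integral>\<^sup>+s\<in>{0..t}. ennreal (g s) \<partial>lborel) = ennreal (integral {0..t} g)"
proof -
  have int: "set_integrable lborel {0..t} g"
    unfolding set_integrable_def by (rule borel_integrable_compact) (use assms in auto)
  have "(\<integral>\<^sup>+s\<in>{0..t}. ennreal (g s) \<partial>lborel) = (\<integral>\<^sup>+s. ennreal (indicator {0..t} s *\<^sub>R g s) \<partial>lborel)"
    by (rule nn_integral_cong) (simp split: split_indicator)
  also have "\<dots> = ennreal (LINT s:{0..t}|lborel. g s)"
    unfolding set_lebesgue_integral_def using int nonneg
    by (intro nn_integral_eq_integral) (auto simp: set_integrable_def split: split_indicator)
  also have "(LINT s:{0..t}|lborel. g s) = integral {0..t} g"
    by (rule set_borel_integral_eq_integral(2)[OF int])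
  finally show ?thesis .
qed

section \<open>Lipschitz coefficients\<close>

text \<open>
  The drift \<open>a\<close> and the diffusion \<open>b\<close> take values in different spaces but enter the estimates in the
  same way.  The growth bound is in its linear form, which is the one suited to products with \<open>U\<close>.
\<close>

locale lipschitz_coefficient =
  fixes f :: "real \<Rightarrow> real^'d \<Rightarrow> 'b::{banach, second_countable_topology}" and C c :: real
  assumes f_measurable: "jointly_measurable f"
    and C_nonneg: "0 \<le> C" and c_nonneg: "0 \<le> c"
    and f_lipschitz: "\<And>s x y. 0 \<le> s \<Longrightarrow> norm (f s x - f s y) \<le> C * norm (x - y)"
    and f_growth: "\<And>s x. 0 \<le> s \<Longrightarrow> norm (f s x) \<le> c * (1 + norm x)"
begin

lemma growth_composed:
  fixes A :: "real^'d^'r"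
  assumes "0 \<le> s" "norm A \<le> R"
  shows "norm (f s (transpose A *v y)) \<le> c * (1 + R) * (1 + norm y)"
proof -
  have R: "0 \<le> R" using assms(2) norm_ge_zero order_trans by blast
  have "norm (transpose A *v y) \<le> R * norm y"
    using norm_matrix_vector_mult_le[of "transpose A" y] mult_right_mono[OF assms(2), of "norm y"]
    unfolding norm_transpose by simp
  then have "1 + norm (transpose A *v y) \<le> (1 + R) * (1 + norm y)"
    using R norm_ge_zero[of y] by (simp add: algebra_simps del: norm_ge_zero)
  then have "c * (1 + norm (transpose A *v y)) \<le> c * ((1 + R) * (1 + norm y))"
    using c_nonneg by (rule mult_left_mono)
  with f_growth[OF assms(1), of "transpose A *v y"] show ?thesis by (simp only: mult.assoc)
qed

lemma lipschitz_composed: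
  fixes A A' :: "real^'d^'r"
  assumes "0 \<le> s" "norm A' \<le> R"
  shows "norm (f s (transpose A *v y) - f s (transpose A' *v y')) \<le>
    C * (1 + R) * (norm (A - A') * (1 + norm y) + norm (y - y'))"
proof -
  have R: "0 \<le> R" using assms(2) norm_ge_zero order_trans by blast
  have eq: "transpose A *v y - transpose A' *v y' = transpose (A - A') *v y + transpose A' *v (y - y')"
    by (simp only: linear_diff[OF bounded_linear.linear[OF bounded_linear_transpose]]
        bounded_bilinear.diff_left[OF bounded_bilinear_matrix_vector_mult]
        bounded_bilinear.diff_right[OF bounded_bilinear_matrix_vector_mult]) simp
  have "norm (transpose A *v y - transpose A' *v y') \<le> norm (transpose (A - A') *v y) + norm (transpose A' *v (y - y'))"
    unfolding eq by (rule norm_triangle_ineq)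
  also have "\<dots> \<le> norm (A - A') * norm y + norm A' * norm (y - y')"
    using norm_matrix_vector_mult_le[of "transpose (A - A')" y] norm_matrix_vector_mult_le[of "transpose A'" "y - y'"]
    unfolding norm_transpose by (rule add_mono)
  also have "\<dots> \<le> norm (A - A') * (1 + norm y) + R * norm (y - y')"
    using assms(2) by (intro add_mono mult_left_mono mult_right_mono) auto
  also have "\<dots> \<le> (1 + R) * (norm (A - A') * (1 + norm y)) + (1 + R) * norm (y - y')"
    using R mult_right_mono[of 1 "1 + R" "norm (A - A') * (1 + norm y)"]
    by (intro add_mono mult_right_mono) simp_all
  also have "\<dots> = (1 + R) * (norm (A - A') * (1 + norm y) + norm (y - y'))"
    by (simp only: distrib_left)
  finally have "C * norm (transpose A *v y - transpose A' *v y') \<le>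
      C * ((1 + R) * (norm (A - A') * (1 + norm y) + norm (y - y')))"
    using C_nonneg by (rule mult_left_mono)
  with f_lipschitz[OF assms(1), of "transpose A *v y" "transpose A' *v y'"]
  show ?thesis by (simp only: mult.assoc)
qed

text \<open>
  Here \<open>p\<close> stands for the product of \<open>U\<close> with the drift vector or with the diffusion matrix.  The
  square of the difference is bounded by an expression that is jointly quadratic in the two distances,
  with the growth in \<open>y\<close> attached only to the distance of the deterministic matrices; this is what makes
  its expectation controllable by second moments.
\<close>

lemma product_diff_square_le:
  fixes A A' :: "real^'d^'r" and p :: "real^'d^'r \<Rightarrow> 'b \<Rightarrow> 'e::real_normed_vector"
  assumes p: "bounded_bilinear p" "\<And>X v. norm (p X v) \<le> norm X * norm v"
    and "0 \<le> s" "norm A \<le> R" "norm A' \<le> R"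
  shows "(norm (p A (f s (transpose A *v y)) - p A' (f s (transpose A' *v y'))))\<^sup>2 \<le>
    4 * (c * (1 + R) + R * (C * (1 + R)))\<^sup>2 *
      ((norm (A - A'))\<^sup>2 * (1 + (norm y)\<^sup>2) + (norm (y - y'))\<^sup>2)"
proof -
  interpret bounded_bilinear p by fact
  have R: "0 \<le> R" using assms(4) norm_ge_zero order_trans by blast
  let ?v = "f s (transpose A *v y)" and ?v' = "f s (transpose A' *v y')"
  let ?u = "norm (A - A')" and ?\<eta> = "norm y" and ?e = "norm (y - y')"
  let ?K = "c * (1 + R) + R * (C * (1 + R))"
  have "p A ?v - p A' ?v' = p (A - A') ?v + p A' (?v - ?v')"
    by (simp add: diff_left diff_right)
  then have "norm (p A ?v - p A' ?v') \<le> norm (p (A - A') ?v) + norm (p A' (?v - ?v'))"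
    by (metis norm_triangle_ineq)
  also have "\<dots> \<le> ?u * norm ?v + norm A' * norm (?v - ?v')"
    by (intro add_mono p(2))
  also have "\<dots> \<le> ?u * (c * (1 + R) * (1 + ?\<eta>)) + R * (C * (1 + R) * (?u * (1 + ?\<eta>) + ?e))"
    using assms R by (intro add_mono mult_mono growth_composed lipschitz_composed) auto
  also have "\<dots> \<le> ?K * (?u * (1 + ?\<eta>) + ?e)"
    using R c_nonneg mult_nonneg_nonneg[of "c * (1 + R)" ?e] by (simp add: algebra_simps)
  finally have "(norm (p A ?v - p A' ?v'))\<^sup>2 \<le> (?K * (?u * (1 + ?\<eta>) + ?e))\<^sup>2"
    by (intro power_mono) auto
  also have "(?u * (1 + ?\<eta>) + ?e)\<^sup>2 \<le> 4 * (?u\<^sup>2 * (1 + ?\<eta>\<^sup>2) + ?e\<^sup>2)"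
  proof -
    have "(?u * (1 + ?\<eta>) + ?e)\<^sup>2 \<le> 2 * (?u * (1 + ?\<eta>))\<^sup>2 + 2 * ?e\<^sup>2"
      using zero_le_power2[of "?u * (1 + ?\<eta>) - ?e"] by (simp add: power2_eq_square algebra_simps)
    also have "(?u * (1 + ?\<eta>))\<^sup>2 \<le> ?u\<^sup>2 * (2 * (1 + ?\<eta>\<^sup>2))"
      unfolding power_mult_distrib using zero_le_power2[of "1 - ?\<eta>"]
      by (intro mult_left_mono) (simp_all add: power2_eq_square algebra_simps)
    also have "2 * (?u\<^sup>2 * (2 * (1 + ?\<eta>\<^sup>2))) + 2 * ?e\<^sup>2 \<le> 4 * (?u\<^sup>2 * (1 + ?\<eta>\<^sup>2) + ?e\<^sup>2)"
      by (simp add: algebra_simps)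
    finally show ?thesis by simp
  qed
  then have "(?K * (?u * (1 + ?\<eta>) + ?e))\<^sup>2 \<le> ?K\<^sup>2 * (4 * (?u\<^sup>2 * (1 + ?\<eta>\<^sup>2) + ?e\<^sup>2))"
    unfolding power_mult_distrib[of ?K] by (intro mult_left_mono) auto
  finally show ?thesis by (simp only: mult.assoc mult.left_commute[of "?K\<^sup>2" 4])
qed

lemma measurable_composed:
  assumes "g \<in> borel_measurable N" "\<And>p. p \<in> space N \<Longrightarrow> 0 \<le> g p" "X \<in> borel_measurable N"
  shows "(\<lambda>p. f (g p) (X p)) \<in> borel_measurable N"
proof -
  have "(\<lambda>p. (g p, X p)) \<in> measurable N (restrict_space borel ({0..} \<times> UNIV))"
    using assms by (intro measurable_restrict_space2 borel_measurable_Pair) auto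
  from measurable_compose[OF this f_measurable[unfolded jointly_measurable_def]] show ?thesis by simp
qed

end

text \<open>
  \<open>1 + |x|\<^sup>2 \<le> (1 + |x|)\<^sup>2\<close> turns the quadratic growth bound into the linear one.
\<close>

lemma lipschitz_coefficientI:
  assumes meas: "jointly_measurable f" and "0 \<le> C" "0 \<le> c"
    and lip: "\<And>s x y. 0 \<le> s \<Longrightarrow> norm (f s x - f s y) \<le> C * norm (x - y)"
    and growth: "\<And>s x. 0 \<le> s \<Longrightarrow> (norm (f s x))\<^sup>2 \<le> c * (1 + (norm x)\<^sup>2)"
  shows "lipschitz_coefficient f C (sqrt c)"
proof
  fix s :: real and x assume "0 \<le> s"
  have "(norm (f s x))\<^sup>2 \<le> c * (1 + norm x)\<^sup>2"
    using growth[OF \<open>0 \<le> s\<close>, of x] \<open>0 \<le> c\<close>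
    by (elim order_trans) (intro mult_left_mono, auto simp: power2_sum)
  also have "\<dots> = (sqrt c * (1 + norm x))\<^sup>2"
    using \<open>0 \<le> c\<close> by (simp add: power_mult_distrib)
  finally show "norm (f s x) \<le> sqrt c * (1 + norm x)"
    by (rule power2_le_imp_le) (use \<open>0 \<le> c\<close> in simp)
qed (use assms in auto)

section \<open>A single low-rank process\<close>

text \<open>
  One pair \<open>(U, Y)\<close> in the domain of \<open>F\<^sub>1\<close> and \<open>F\<^sub>2\<close>, seen only through the paths of \<open>Y\<close> and its second
  moments; from these come all bounds on the factors.
\<close>

locale low_rank_process = prob_space M for M :: "'a measure" +
  fixes T :: real and U :: "real \<Rightarrow> real^'d^'r" and Y :: "real \<Rightarrow> 'a \<Rightarrow> real^'r"
  assumes T_nonneg: "0 \<le> T"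
    and U_continuous: "continuous_on {0..T} U"
    and U_rows: "\<And>t. t \<in> {0..T} \<Longrightarrow> independent_rows (U t)"
    and Y_L2_C: "L2_C M T Y"
    and Y_components: "\<And>t. t \<in> {0..T} \<Longrightarrow> independent_components M (Y t)"
begin

abbreviation X :: "real \<Rightarrow> 'a \<Rightarrow> real^'d" where
  "X s \<omega> \<equiv> transpose (U s) *v Y s \<omega>"

abbreviation horizon :: "real measure" where
  "horizon \<equiv> restrict_space lborel {0..T}"

definition Y_sup :: "'a \<Rightarrow> real" where
  "Y_sup \<omega> = (SUP t\<in>{0..T}. norm (Y t \<omega>))"

lemma Y_continuous: "\<omega> \<in> space M \<Longrightarrow> continuous_on {0..T} (\<lambda>t. Y t \<omega>)"
  and Y_measurable: "t \<in> {0..T} \<Longrightarrow> Y t \<in> borel_measurable M"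
  and Y_sup_integrable: "integrable M (\<lambda>\<omega>. (Y_sup \<omega>)\<^sup>2)"
  using Y_L2_C by (auto simp: L2_C_def Y_sup_def)

lemma norm_Y_le: "t \<in> {0..T} \<Longrightarrow> \<omega> \<in> space M \<Longrightarrow> norm (Y t \<omega>) \<le> Y_sup \<omega>"
  unfolding Y_sup_def
  by (intro cSUP_upper bounded_imp_bdd_above compact_imp_bounded compact_continuous_image
        continuous_on_norm Y_continuous) auto

lemma Y_square_le: "t \<in> {0..T} \<Longrightarrow> \<omega> \<in> space M \<Longrightarrow> (norm (Y t \<omega>))\<^sup>2 \<le> (Y_sup \<omega>)\<^sup>2"
  by (intro power_mono norm_Y_le) auto

lemma Y_square_integrable: "t \<in> {0..T} \<Longrightarrow> integrable M (\<lambda>\<omega>. (norm (Y t \<omega>))\<^sup>2)"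
  using Y_measurable[of t] Y_square_le[of t]
  by (intro Bochner_Integration.integrable_bound[OF Y_sup_integrable]) (auto intro!: AE_I2)

lemma Y_square_expectation_le:
  "t \<in> {0..T} \<Longrightarrow> (\<integral>\<omega>. (norm (Y t \<omega>))\<^sup>2 \<partial>M) \<le> (\<integral>\<omega>. (Y_sup \<omega>)\<^sup>2 \<partial>M)"
  by (intro integral_mono Y_square_integrable Y_sup_integrable Y_square_le)

lemma Y_jointly_measurable: "(\<lambda>(s, \<omega>). Y s \<omega>) \<in> borel_measurable (horizon \<Otimes>\<^sub>M M)"
  by (intro measurable_continuous_paths T_nonneg Y_continuous Y_measurable)

lemma second_moment_integrable:
  assumes "t \<in> {0..T}"
  shows "integrable M (\<lambda>\<omega>. outer_product (Y t \<omega>) (Y t \<omega>))"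
  by (rule Bochner_Integration.integrable_bound[OF Y_square_integrable[OF assms]])
     (auto simp: norm_outer_product power2_eq_square intro!: AE_I2 Y_measurable assms
        borel_measurable_bounded_bilinear[OF bounded_bilinear_outer_product])

lemma second_moment_continuous: "continuous_on {0..T} (\<lambda>t. second_moment_matrix M (Y t))"
  unfolding second_moment_matrix_def
proof (rule continuous_on_integral_dominated[where w="\<lambda>\<omega>. (Y_sup \<omega>)\<^sup>2"])
  show "continuous_on {0..T} (\<lambda>t. outer_product (Y t \<omega>) (Y t \<omega>))" if "\<omega> \<in> space M" for \<omega>
    by (intro bounded_bilinear.continuous_on[OF bounded_bilinear_outer_product] Y_continuous that)
  show "norm (outer_product (Y t \<omega>) (Y t \<omega>)) \<le> (Y_sup \<omega>)\<^sup>2" if "t \<in> {0..T}" "\<omega> \<in> space M" for t \<omega>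
    using Y_square_le[OF that] by (simp add: norm_outer_product power2_eq_square)
qed (use Y_sup_integrable second_moment_integrable in auto)

text \<open>
  \<open>x \<bullet> (C\<^sub>Y x) = \<bbbE> (x \<bullet> Y)\<^sup>2\<close>, so a kernel vector is a linear relation between the components of \<open>Y\<close>.
\<close>

lemma second_moment_invertible:
  assumes t: "t \<in> {0..T}"
  shows "invertible (second_moment_matrix M (Y t))"
  unfolding invertible_iff_trivial_kernel
proof safe
  fix x assume x: "second_moment_matrix M (Y t) *v x = 0"
  have lin: "bounded_linear (\<lambda>A::real^'r^'r. x \<bullet> (A *v x))"
    by (intro bounded_linear_inner_right_comp
          bounded_bilinear.bounded_linear_left[OF bounded_bilinear_matrix_vector_mult])
  have quad: "x \<bullet> (outer_product y y *v x) = (x \<bullet> y)\<^sup>2" for y :: "real^'r"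
    by (simp add: inner_vec_def outer_product_def matrix_vector_mult_def power2_eq_square sum_product
          sum_distrib_left mult_ac)
  have "(\<integral>\<omega>. (x \<bullet> Y t \<omega>)\<^sup>2 \<partial>M) = x \<bullet> (second_moment_matrix M (Y t) *v x)"
    using integral_bounded_linear[OF lin second_moment_integrable[OF t]]
    by (simp add: quad second_moment_matrix_def)
  also have "\<dots> = 0" by (simp add: x)
  finally have zero: "(\<integral>\<omega>. (x \<bullet> Y t \<omega>)\<^sup>2 \<partial>M) = 0" .
  have "integrable M (\<lambda>\<omega>. (x \<bullet> Y t \<omega>)\<^sup>2)"
    using integrable_bounded_linear[OF lin second_moment_integrable[OF t]] by (simp add: quad)
  with zero have "AE \<omega> in M. x \<bullet> Y t \<omega> = 0"
    by (subst (asm) integral_nonneg_eq_0_iff_AE) auto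
  then have "AE \<omega> in M. (\<Sum>i\<in>UNIV. x $ i * Y t \<omega> $ i) = 0"
    by (simp add: inner_vec_def)
  then have "\<forall>i. x $ i = 0"
    using Y_components[OF t] unfolding independent_components_def by blast
  then show "x = 0" by (simp add: vec_eq_iff)
qed

lemma inverse_second_moment_continuous:
  "continuous_on {0..T} (\<lambda>t. matrix_inv (second_moment_matrix M (Y t)))"
  by (intro continuous_on_matrix_inv compact_Icc second_moment_continuous second_moment_invertible)

lemma gram_inverse_continuous: "continuous_on {0..T} (\<lambda>t. matrix_inv (U t ** transpose (U t)))"
  by (intro continuous_on_matrix_inv compact_Icc invertible_gram U_rows
        bounded_bilinear.continuous_on[OF bounded_bilinear_matrix_mult] U_continuous
        bounded_linear.continuous_on[OF bounded_linear_transpose])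

lemma proj_row_continuous: "continuous_on {0..T} (\<lambda>t. proj_row (U t))"
proof -
  have "continuous_on {0..T} (\<lambda>t. transpose (U t) ** matrix_inv (U t ** transpose (U t)) ** U t)"
    by (intro bounded_bilinear.continuous_on[OF bounded_bilinear_matrix_mult] U_continuous
          bounded_linear.continuous_on[OF bounded_linear_transpose] gram_inverse_continuous)
  then show ?thesis
    by (rule continuous_on_eq) (simp add: proj_row_eq U_rows)
qed

text \<open>
  Continuity on a compact interval; this is where the local Lipschitz constants become uniform in time.
\<close>

lemma factors_bounded:
  obtains R where "1 \<le> R"
    "\<And>s. s \<in> {0..T} \<Longrightarrow> norm (U s) \<le> R"
    "\<And>s. s \<in> {0..T} \<Longrightarrow> norm (matrix_inv (second_moment_matrix M (Y s))) \<le> R"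
    "\<And>s. s \<in> {0..T} \<Longrightarrow> norm (matrix_inv (U s ** transpose (U s))) \<le> R"
    "\<And>s. s \<in> {0..T} \<Longrightarrow> norm (mat 1 - proj_row (U s)) \<le> R"
proof -
  have bdd: "\<exists>K. \<forall>s\<in>{0..T}. norm (f s) \<le> K" if "continuous_on {0..T} f" for f :: "real \<Rightarrow> 'z::real_normed_vector"
    using compact_imp_bounded[OF compact_continuous_image[OF that compact_Icc]] by (auto simp: bounded_iff)
  obtain K1 where K1: "\<forall>s\<in>{0..T}. norm (U s) \<le> K1"
    using bdd[OF U_continuous] ..
  obtain K2 where K2: "\<forall>s\<in>{0..T}. norm (matrix_inv (second_moment_matrix M (Y s))) \<le> K2"
    using bdd[OF inverse_second_moment_continuous] ..
  obtain K3 where K3: "\<forall>s\<in>{0..T}. norm (matrix_inv (U s ** transpose (U s))) \<le> K3"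
    using bdd[OF gram_inverse_continuous] ..
  have "continuous_on {0..T} (\<lambda>s. mat 1 - proj_row (U s))"
    by (intro continuous_intros proj_row_continuous)
  from bdd[OF this] obtain K4 where K4: "\<forall>s\<in>{0..T}. norm (mat 1 - proj_row (U s)) \<le> K4" ..
  show ?thesis
  proof (rule that[of "Max {1, K1, K2, K3, K4}"])
    fix s assume "s \<in> {0..T}"
    then show "norm (U s) \<le> Max {1, K1, K2, K3, K4}"
      "norm (matrix_inv (second_moment_matrix M (Y s))) \<le> Max {1, K1, K2, K3, K4}"
      "norm (matrix_inv (U s ** transpose (U s))) \<le> Max {1, K1, K2, K3, K4}"
      "norm (mat 1 - proj_row (U s)) \<le> Max {1, K1, K2, K3, K4}"
      using K1 K2 K3 K4 by (auto simp: le_max_iff_disj)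
  qed simp
qed

lemma U_measurable: "U \<in> borel_measurable horizon"
proof -
  have "U \<in> borel_measurable (restrict_space borel {0..T})"
    by (rule borel_measurable_continuous_on_restrict[OF U_continuous])
  then show ?thesis
    by (simp cong: measurable_cong_sets add: sets_restrict_space)
qed

lemma X_jointly_measurable: "(\<lambda>(s, \<omega>). X s \<omega>) \<in> borel_measurable (horizon \<Otimes>\<^sub>M M)"
proof -
  have "(\<lambda>s. transpose (U s)) \<in> borel_measurable horizon"
    by (rule borel_measurable_continuous_on[OF bounded_linear.continuous_on[OF bounded_linear_transpose] U_measurable])
       (rule continuous_on_id)
  then have "(\<lambda>p. transpose (U (fst p))) \<in> borel_measurable (horizon \<Otimes>\<^sub>M M)"
    by (rule measurable_compose[OF measurable_fst])
  from borel_measurable_bounded_bilinear[OF bounded_bilinear_matrix_vector_mult this, of "\<lambda>p. Y (fst p) (snd p)"]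
  show ?thesis using Y_jointly_measurable by (simp add: case_prod_unfold del: transpose_matrix_vector)
qed

end

context lipschitz_coefficient
begin

lemma coefficient_jointly_measurable:
  assumes "low_rank_process M T U Y"
  shows "(\<lambda>p. f (fst p) (transpose (U (fst p)) *v Y (fst p) (snd p)))
    \<in> borel_measurable (restrict_space lborel {0..T} \<Otimes>\<^sub>M M)"
proof -
  interpret low_rank_process M T U Y by fact
  have "fst \<in> borel_measurable (horizon \<Otimes>\<^sub>M M)"
    by (rule measurable_compose[OF measurable_fst]) (auto intro: measurable_restrict_space1)
  then show ?thesis
    using X_jointly_measurable
    by (intro measurable_composed) (auto simp: case_prod_unfold space_pair_measure space_restrict_space)
qed

lemma integrand_jointly_measurable:
  fixes p :: "real^'d^'r \<Rightarrow> 'b \<Rightarrow> 'e::{real_normed_vector, second_countable_topology}"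
  assumes process: "low_rank_process M T U Y" and p: "bounded_bilinear p"
  shows "(\<lambda>q. p (U (fst q)) (f (fst q) (transpose (U (fst q)) *v Y (fst q) (snd q))))
    \<in> borel_measurable (restrict_space lborel {0..T} \<Otimes>\<^sub>M M)"
proof -
  interpret low_rank_process M T U Y by fact
  show ?thesis
    by (intro borel_measurable_bounded_bilinear[OF p] coefficient_jointly_measurable[OF process]
          measurable_compose[OF measurable_fst U_measurable])
qed

text \<open>
  On a fixed path the integrand is bounded, since the whole path of \<open>Y\<close> is bounded by its supremum.
\<close>

lemma integrand_set_integrable:
  fixes p :: "real^'d^'r \<Rightarrow> 'b \<Rightarrow> 'e::{banach, second_countable_topology}"
  assumes process: "low_rank_process M T U Y"
    and p: "bounded_bilinear p" "\<And>X v. norm (p X v) \<le> norm X * norm v"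
    and \<omega>: "\<omega> \<in> space M" and t: "t \<in> {0..T}"
  shows "set_integrable lborel {0..t} (\<lambda>s. p (U s) (f s (transpose (U s) *v Y s \<omega>)))"
proof -
  interpret low_rank_process M T U Y by fact
  obtain R where R: "1 \<le> R" "\<And>s. s \<in> {0..T} \<Longrightarrow> norm (U s) \<le> R"
    using factors_bounded by metis
  interpret horizon: finite_measure horizon
    by (rule finite_measureI) (simp add: emeasure_restrict_space space_restrict_space T_nonneg)
  have "integrable horizon (\<lambda>s. p (U s) (f s (transpose (U s) *v Y s \<omega>)))"
  proof (rule horizon.integrable_const_bound)
    show "(\<lambda>s. p (U s) (f s (transpose (U s) *v Y s \<omega>))) \<in> borel_measurable horizon"
      using measurable_Pair1[OF integrand_jointly_measurable[OF process p(1)] \<omega>] by simp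
    show "AE s in horizon. norm (p (U s) (f s (transpose (U s) *v Y s \<omega>))) \<le>
        R * (c * (1 + R) * (1 + Y_sup \<omega>))"
    proof (rule AE_I2)
      fix s assume "s \<in> space horizon"
      then have s: "s \<in> {0..T}" by (simp add: space_restrict_space)
      have "norm (f s (transpose (U s) *v Y s \<omega>)) \<le> c * (1 + R) * (1 + norm (Y s \<omega>))"
        using s R(2)[OF s] by (intro growth_composed) auto
      also have "\<dots> \<le> c * (1 + R) * (1 + Y_sup \<omega>)"
        using R(1) c_nonneg norm_Y_le[OF s \<omega>] by (intro mult_left_mono) auto
      finally have "norm (U s) * norm (f s (transpose (U s) *v Y s \<omega>)) \<le> R * (c * (1 + R) * (1 + Y_sup \<omega>))"
        using R s by (intro mult_mono) auto
      with p(2)[of "U s" "f s (transpose (U s) *v Y s \<omega>)"]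
      show "norm (p (U s) (f s (transpose (U s) *v Y s \<omega>))) \<le> R * (c * (1 + R) * (1 + Y_sup \<omega>))"
        by linarith
    qed
  qed
  then have "set_integrable lborel {0..T} (\<lambda>s. p (U s) (f s (transpose (U s) *v Y s \<omega>)))"
    by (simp add: set_integrable_def integrable_restrict_space)
  then show ?thesis
    by (rule set_integrable_subset) (use t in auto)
qed

end

context low_rank_process
begin

definition cross_moment :: "(real \<Rightarrow> real^'d \<Rightarrow> real^'d) \<Rightarrow> real \<Rightarrow> real^'d^'r" where
  "cross_moment a s = (\<integral>\<omega>. outer_product (Y s \<omega>) (a s (X s \<omega>)) \<partial>M)"

text \<open>
  The integrand of \<open>F\<^sub>1\<close>.
\<close>

definition mode_drift :: "(real \<Rightarrow> real^'d \<Rightarrow> real^'d) \<Rightarrow> real \<Rightarrow> real^'d^'r" where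
  "mode_drift a s =
     matrix_inv (second_moment_matrix M (Y s)) ** cross_moment a s ** (mat 1 - proj_row (U s))"

lemma cross_moment_integrand_le:
  assumes "lipschitz_coefficient a C c" "s \<in> {0..T}" "norm (U s) \<le> R"
  shows "norm (outer_product (Y s \<omega>) (a s (X s \<omega>))) \<le> c * (1 + R) * (1 + 2 * (norm (Y s \<omega>))\<^sup>2)"
proof -
  interpret lipschitz_coefficient a C c by fact
  have R: "0 \<le> R" using assms(3) norm_ge_zero order_trans by blast
  let ?\<eta> = "norm (Y s \<omega>)"
  have "norm (outer_product (Y s \<omega>) (a s (X s \<omega>))) \<le> ?\<eta> * (c * (1 + R) * (1 + ?\<eta>))"
    unfolding norm_outer_product using assms by (intro mult_left_mono growth_composed) auto
  also have "\<dots> = c * (1 + R) * (?\<eta> * (1 + ?\<eta>))"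
    by (simp only: mult_ac)
  also have "\<dots> \<le> c * (1 + R) * (1 + 2 * ?\<eta>\<^sup>2)"
  proof (intro mult_left_mono mult_nonneg_nonneg)
    show "?\<eta> * (1 + ?\<eta>) \<le> 1 + 2 * ?\<eta>\<^sup>2"
      using zero_le_power2[of "?\<eta> - 1"] zero_le_power2[of ?\<eta>] norm_ge_zero[of "Y s \<omega>"]
      unfolding power2_eq_square by (simp only: algebra_simps)
  qed (use c_nonneg R in auto)
  finally show ?thesis .
qed

lemma cross_moment_integrand_measurable:
  assumes "lipschitz_coefficient a C c"
  shows "(\<lambda>p. outer_product (Y (fst p) (snd p)) (a (fst p) (X (fst p) (snd p)))) \<in> borel_measurable (horizon \<Otimes>\<^sub>M M)"
proof -
  have "low_rank_process M T U Y" by unfold_locales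
  from lipschitz_coefficient.coefficient_jointly_measurable[OF assms this] Y_jointly_measurable
  show ?thesis
    by (intro borel_measurable_bounded_bilinear[OF bounded_bilinear_outer_product])
       (simp_all add: case_prod_unfold)
qed

lemma cross_moment_integrable:
  assumes a: "lipschitz_coefficient a C c" and s: "s \<in> {0..T}"
  shows "integrable M (\<lambda>\<omega>. outer_product (Y s \<omega>) (a s (X s \<omega>)))"
proof -
  have "integrable M (\<lambda>\<omega>. c * (1 + norm (U s)) * (1 + 2 * (norm (Y s \<omega>))\<^sup>2))"
    using Y_square_integrable[OF s] by simp
  then show ?thesis
  proof (rule Bochner_Integration.integrable_bound)
    have "s \<in> space horizon" using s by (simp add: space_restrict_space)
    from measurable_Pair2[OF cross_moment_integrand_measurable[OF a] this]
    show "(\<lambda>\<omega>. outer_product (Y s \<omega>) (a s (X s \<omega>))) \<in> borel_measurable M" by simp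
    show "AE \<omega> in M. norm (outer_product (Y s \<omega>) (a s (X s \<omega>))) \<le>
        norm (c * (1 + norm (U s)) * (1 + 2 * (norm (Y s \<omega>))\<^sup>2))"
      by (intro AE_I2 order_trans[OF cross_moment_integrand_le[OF a s order_refl]]) simp
  qed
qed

lemma cross_moment_bounded:
  assumes a: "lipschitz_coefficient a C c"
  obtains K where "\<And>s. s \<in> {0..T} \<Longrightarrow> norm (cross_moment a s) \<le> K"
proof -
  interpret lipschitz_coefficient a C c by fact
  obtain R where R: "1 \<le> R" "\<And>s. s \<in> {0..T} \<Longrightarrow> norm (U s) \<le> R"
    using factors_bounded by metis
  have "norm (cross_moment a s) \<le> c * (1 + R) * (1 + 2 * (\<integral>\<omega>. (Y_sup \<omega>)\<^sup>2 \<partial>M))" if s: "s \<in> {0..T}" for s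
  proof -
    have "norm (cross_moment a s) \<le> (\<integral>\<omega>. c * (1 + R) * (1 + 2 * (Y_sup \<omega>)\<^sup>2) \<partial>M)"
      unfolding cross_moment_def
    proof (rule norm_integral_le_integral)
      show "integrable M (\<lambda>\<omega>. c * (1 + R) * (1 + 2 * (Y_sup \<omega>)\<^sup>2))"
        using Y_sup_integrable by simp
      fix \<omega> assume "\<omega> \<in> space M"
      then show "norm (outer_product (Y s \<omega>) (a s (X s \<omega>))) \<le> c * (1 + R) * (1 + 2 * (Y_sup \<omega>)\<^sup>2)"
        using R c_nonneg Y_square_le[OF s]
        by (intro order_trans[OF cross_moment_integrand_le[OF a s R(2)[OF s]]] mult_left_mono) auto
    qed (rule cross_moment_integrable[OF a s])
    also have "\<dots> = c * (1 + R) * (1 + 2 * (\<integral>\<omega>. (Y_sup \<omega>)\<^sup>2 \<partial>M))"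
      using Y_sup_integrable by (simp add: prob_space)
    finally show ?thesis .
  qed
  then show ?thesis by (rule that)
qed

text \<open>
  Integrability matters because the integral of a non-integrable function is \<open>0\<close> by convention: only
  with it does the difference of two values of \<open>F\<^sub>1\<close> become the integral of a difference.
\<close>

lemma mode_drift_set_integrable:
  assumes a: "lipschitz_coefficient a C c" and t: "t \<in> {0..T}"
  shows "set_integrable lborel {0..t} (mode_drift a)"
proof -
  obtain R where R: "1 \<le> R"
    "\<And>s. s \<in> {0..T} \<Longrightarrow> norm (matrix_inv (second_moment_matrix M (Y s))) \<le> R"
    "\<And>s. s \<in> {0..T} \<Longrightarrow> norm (mat 1 - proj_row (U s)) \<le> R"
    using factors_bounded by metis
  obtain K where K: "\<And>s. s \<in> {0..T} \<Longrightarrow> norm (cross_moment a s) \<le> K"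
    using cross_moment_bounded[OF a] by blast
  interpret horizon: finite_measure horizon
    by (rule finite_measureI) (simp add: emeasure_restrict_space space_restrict_space T_nonneg)
  have cont: "f \<in> borel_measurable horizon" if "continuous_on {0..T} f"
    for f :: "real \<Rightarrow> 'z::{second_countable_topology, real_normed_vector}"
    using borel_measurable_continuous_on_restrict[OF that]
    by (simp cong: measurable_cong_sets add: sets_restrict_space)
  have "integrable horizon (mode_drift a)"
  proof (rule horizon.integrable_const_bound)
    have "cross_moment a \<in> borel_measurable horizon"
      unfolding cross_moment_def[abs_def]
      using cross_moment_integrand_measurable[OF a]
      by (intro borel_measurable_lebesgue_integral) (simp add: case_prod_unfold)
    then show "mode_drift a \<in> borel_measurable horizon"
      unfolding mode_drift_def[abs_def]
      by (intro borel_measurable_bounded_bilinear[OF bounded_bilinear_matrix_mult]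
           cont[OF inverse_second_moment_continuous]
           cont[OF continuous_on_diff[OF continuous_on_const proj_row_continuous]])
    show "AE s in horizon. norm (mode_drift a s) \<le> R * K * R"
    proof (rule AE_I2)
      fix s assume "s \<in> space horizon"
      then have s: "s \<in> {0..T}" by (simp add: space_restrict_space)
      have "norm (mode_drift a s) \<le> norm (matrix_inv (second_moment_matrix M (Y s)) ** cross_moment a s) *
          norm (mat 1 - proj_row (U s))"
        unfolding mode_drift_def by (rule norm_matrix_mult_le)
      also have "\<dots> \<le> (R * K) * R"
      proof (intro mult_mono order_trans[OF norm_matrix_mult_le])
        show "0 \<le> R * K"
          using R(1) K[OF s] norm_ge_zero[of "cross_moment a s"] by (intro mult_nonneg_nonneg) linarith+
      qed (use R K s in auto)
      finally show "norm (mode_drift a s) \<le> R * K * R" .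
    qed
  qed
  then have "set_integrable lborel {0..T} (mode_drift a)"
    by (simp add: set_integrable_def integrable_restrict_space)
  then show ?thesis
    by (rule set_integrable_subset) (use t in auto)
qed

end

section \<open>The distance between two low-rank processes\<close>

locale low_rank_pair = Z: low_rank_process M T U Y + Z': low_rank_process M T U' Y'
  for M :: "'a measure" and T :: real and U U' :: "real \<Rightarrow> real^'d^'r"
    and Y Y' :: "real \<Rightarrow> 'a \<Rightarrow> real^'r"
begin

abbreviation mean_square_dist :: "real \<Rightarrow> real" where
  "mean_square_dist s \<equiv> \<integral>\<omega>. (norm (Y s \<omega> - Y' s \<omega>))\<^sup>2 \<partial>M"

definition gap :: "real \<Rightarrow> real" where
  "gap s = (norm (U s - U' s))\<^sup>2 + mean_square_dist s"

definition sup_bound :: real where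
  "sup_bound = (\<integral>\<omega>. (Z.Y_sup \<omega>)\<^sup>2 \<partial>M) + (\<integral>\<omega>. (Z'.Y_sup \<omega>)\<^sup>2 \<partial>M)"

lemma sup_bound_nonneg: "0 \<le> sup_bound"
  by (simp add: sup_bound_def)

lemma diff_measurable: "s \<in> {0..T} \<Longrightarrow> (\<lambda>\<omega>. Y s \<omega> - Y' s \<omega>) \<in> borel_measurable M"
  by (intro borel_measurable_diff Z.Y_measurable Z'.Y_measurable)

lemma diff_square_integrable:
  assumes "s \<in> {0..T}"
  shows "integrable M (\<lambda>\<omega>. (norm (Y s \<omega> - Y' s \<omega>))\<^sup>2)"
proof (rule Bochner_Integration.integrable_bound)
  show "integrable M (\<lambda>\<omega>. 2 * (norm (Y s \<omega>))\<^sup>2 + 2 * (norm (Y' s \<omega>))\<^sup>2)"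
    using Z.Y_square_integrable[OF assms] Z'.Y_square_integrable[OF assms] by simp
qed (use diff_measurable[OF assms] norm_diff_square_le in \<open>auto intro!: AE_I2\<close>)

lemma gap_nonneg: "0 \<le> gap s"
  by (simp add: gap_def)

lemma gap_continuous: "continuous_on {0..T} gap"
proof -
  have "continuous_on {0..T} mean_square_dist"
  proof (rule continuous_on_integral_dominated[where w="\<lambda>\<omega>. 2 * (Z.Y_sup \<omega>)\<^sup>2 + 2 * (Z'.Y_sup \<omega>)\<^sup>2"])
    show "continuous_on {0..T} (\<lambda>t. (norm (Y t \<omega> - Y' t \<omega>))\<^sup>2)" if "\<omega> \<in> space M" for \<omega>
      by (intro continuous_intros Z.Y_continuous Z'.Y_continuous that)
    show "(\<lambda>\<omega>. (norm (Y t \<omega> - Y' t \<omega>))\<^sup>2) \<in> borel_measurable M" if "t \<in> {0..T}" for t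
      using diff_measurable[OF that] by measurable
    show "norm ((norm (Y t \<omega> - Y' t \<omega>))\<^sup>2) \<le> 2 * (Z.Y_sup \<omega>)\<^sup>2 + 2 * (Z'.Y_sup \<omega>)\<^sup>2"
      if "t \<in> {0..T}" "\<omega> \<in> space M" for t \<omega>
      using norm_diff_square_le[of "Y t \<omega>" "Y' t \<omega>"] Z.Y_square_le[OF that] Z'.Y_square_le[OF that] by simp
  qed (use Z.Y_sup_integrable Z'.Y_sup_integrable in simp)
  then show ?thesis
    unfolding gap_def[abs_def] by (intro continuous_intros Z.U_continuous Z'.U_continuous)
qed

text \<open>
  The common pattern of \<open>C\<^sub>Y\<close> and \<open>\<bbbE>[Y a\<^sup>T]\<close>: a pointwise difference that is linear in \<open>|Y - Y'|\<close> with a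
  weight of linear growth, plus linear in \<open>\<parallel>U - U'\<parallel>\<close> with a weight of quadratic growth.  The first part
  is estimated by Cauchy--Schwarz, the second directly.
\<close>

lemma expectation_diff_le:
  fixes V V' :: "'a \<Rightarrow> 'z::{banach, second_countable_topology}"
  assumes s: "s \<in> {0..T}" and int: "integrable M V" "integrable M V'" and K: "0 \<le> K"
    and le: "\<And>\<omega>. \<omega> \<in> space M \<Longrightarrow> norm (V \<omega> - V' \<omega>) \<le>
        K * (norm (Y s \<omega> - Y' s \<omega>) * (1 + norm (Y s \<omega>) + norm (Y' s \<omega>)) +
             norm (U s - U' s) * (1 + (norm (Y s \<omega>))\<^sup>2 + (norm (Y' s \<omega>))\<^sup>2))"
  shows "norm ((\<integral>\<omega>. V \<omega> \<partial>M) - (\<integral>\<omega>. V' \<omega> \<partial>M)) \<le>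
    K * (3 * (1 + sup_bound)) * (norm (U s - U' s) + sqrt (mean_square_dist s))"
proof -
  let ?d = "\<lambda>\<omega>. norm (Y s \<omega> - Y' s \<omega>)"
  let ?w = "\<lambda>\<omega>. 1 + norm (Y s \<omega>) + norm (Y' s \<omega>)"
  let ?v = "\<lambda>\<omega>. 1 + (norm (Y s \<omega>))\<^sup>2 + (norm (Y' s \<omega>))\<^sup>2"
  let ?u = "norm (U s - U' s)" and ?\<delta> = "sqrt (mean_square_dist s)"
  have [measurable]: "Y s \<in> borel_measurable M" "Y' s \<in> borel_measurable M"
    using s by (auto intro: Z.Y_measurable Z'.Y_measurable)
  have v: "integrable M ?v"
    using Z.Y_square_integrable[OF s] Z'.Y_square_integrable[OF s] by simp
  have v_le: "(\<integral>\<omega>. ?v \<omega> \<partial>M) \<le> 1 + sup_bound"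
    using Z.Y_square_integrable[OF s] Z'.Y_square_integrable[OF s]
      Z.Y_square_expectation_le[OF s] Z'.Y_square_expectation_le[OF s]
    by (simp add: sup_bound_def Z.prob_space)
  have w_le: "(?w \<omega>)\<^sup>2 \<le> 3 * ?v \<omega>" for \<omega>
    using zero_le_power2[of "norm (Y s \<omega>) - 1"] zero_le_power2[of "norm (Y' s \<omega>) - 1"]
      zero_le_power2[of "norm (Y s \<omega>) - norm (Y' s \<omega>)"]
    by (simp add: power2_eq_square algebra_simps)
  have w: "integrable M (\<lambda>\<omega>. (?w \<omega>)\<^sup>2)"
  proof (rule Bochner_Integration.integrable_bound)
    show "integrable M (\<lambda>\<omega>. 3 * ?v \<omega>)" using v by (rule integrable_mult_right)
    show "AE \<omega> in M. norm ((?w \<omega>)\<^sup>2) \<le> norm (3 * ?v \<omega>)"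
      using w_le by (intro AE_I2) simp
  qed measurable
  have "(\<integral>\<omega>. (?w \<omega>)\<^sup>2 \<partial>M) \<le> (\<integral>\<omega>. 3 * ?v \<omega> \<partial>M)"
    by (rule integral_mono[OF w integrable_mult_right[OF v] w_le])
  also have "\<dots> = 3 * (\<integral>\<omega>. ?v \<omega> \<partial>M)"
    by (rule integral_mult_right_zero)
  also have "\<dots> \<le> 3 * (1 + sup_bound)"
    using v_le by (rule mult_left_mono) simp
  \<comment> \<open>The base is at least \<open>1\<close>, so the square root of the integral is bounded by the base itself.\<close>
  also have "\<dots> \<le> (3 * (1 + sup_bound))\<^sup>2"
    using sup_bound_nonneg self_le_power[of "3 * (1 + sup_bound)" 2] by simp
  finally have "sqrt (\<integral>\<omega>. (?w \<omega>)\<^sup>2 \<partial>M) \<le> 3 * (1 + sup_bound)"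
    using sup_bound_nonneg by (intro real_le_lsqrt) auto
  \<comment> \<open>Cauchy--Schwarz for \<open>|Y - Y'|\<close> against its weight.\<close>
  note CS = integral_mult_le_L2[OF _ _ diff_square_integrable[OF s] w]
  have dw: "integrable M (\<lambda>\<omega>. ?d \<omega> * ?w \<omega>)"
    by (rule integrable_mult_L2[OF _ _ diff_square_integrable[OF s] w]) measurable
  have "(\<integral>\<omega>. ?d \<omega> * ?w \<omega> \<partial>M) \<le> ?\<delta> * sqrt (\<integral>\<omega>. (?w \<omega>)\<^sup>2 \<partial>M)"
    by (rule CS) measurable
  also have "\<dots> \<le> ?\<delta> * (3 * (1 + sup_bound))"
    by (rule mult_left_mono) (fact, simp)
  finally have dw_le: "(\<integral>\<omega>. ?d \<omega> * ?w \<omega> \<partial>M) \<le> ?\<delta> * (3 * (1 + sup_bound))" .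
  have "norm ((\<integral>\<omega>. V \<omega> \<partial>M) - (\<integral>\<omega>. V' \<omega> \<partial>M)) = norm (\<integral>\<omega>. V \<omega> - V' \<omega> \<partial>M)"
    using int by simp
  also have "\<dots> \<le> (\<integral>\<omega>. K * (?d \<omega> * ?w \<omega> + ?u * ?v \<omega>) \<partial>M)"
    using int dw v le by (intro norm_integral_le_integral) auto
  also have "\<dots> = K * ((\<integral>\<omega>. ?d \<omega> * ?w \<omega> \<partial>M) + ?u * (\<integral>\<omega>. ?v \<omega> \<partial>M))"
    using dw v by (simp only: integral_mult_right_zero Bochner_Integration.integral_add integrable_mult_right)
  also have "\<dots> \<le> K * (?\<delta> * (3 * (1 + sup_bound)) + ?u * (3 * (1 + sup_bound)))"
    using dw_le v_le sup_bound_nonneg K by (intro mult_left_mono add_mono) auto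
  finally show ?thesis by (simp add: algebra_simps)
qed

lemma second_moment_diff_le:
  assumes s: "s \<in> {0..T}"
  shows "norm (second_moment_matrix M (Y s) - second_moment_matrix M (Y' s)) \<le>
    3 * (1 + sup_bound) * (norm (U s - U' s) + sqrt (mean_square_dist s))"
proof -
  interpret bounded_bilinear "outer_product :: real^'r \<Rightarrow> real^'r \<Rightarrow> real^'r^'r"
    by (rule bounded_bilinear_outer_product)
  have "norm (outer_product (Y s \<omega>) (Y s \<omega>) - outer_product (Y' s \<omega>) (Y' s \<omega>)) \<le>
      1 * (norm (Y s \<omega> - Y' s \<omega>) * (1 + norm (Y s \<omega>) + norm (Y' s \<omega>)) +
             norm (U s - U' s) * (1 + (norm (Y s \<omega>))\<^sup>2 + (norm (Y' s \<omega>))\<^sup>2))" for \<omega>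
  proof -
    have "outer_product (Y s \<omega>) (Y s \<omega>) - outer_product (Y' s \<omega>) (Y' s \<omega>) =
        outer_product (Y s \<omega> - Y' s \<omega>) (Y s \<omega>) + outer_product (Y' s \<omega>) (Y s \<omega> - Y' s \<omega>)"
      by (simp add: diff_left diff_right)
    then have "norm (outer_product (Y s \<omega>) (Y s \<omega>) - outer_product (Y' s \<omega>) (Y' s \<omega>)) \<le>
        norm (Y s \<omega> - Y' s \<omega>) * norm (Y s \<omega>) + norm (Y' s \<omega>) * norm (Y s \<omega> - Y' s \<omega>)"
      by (metis norm_triangle_ineq norm_outer_product)
    also have "\<dots> \<le> norm (Y s \<omega> - Y' s \<omega>) * (1 + norm (Y s \<omega>) + norm (Y' s \<omega>)) + 0"
      by (simp add: algebra_simps)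
    also have "\<dots> \<le> norm (Y s \<omega> - Y' s \<omega>) * (1 + norm (Y s \<omega>) + norm (Y' s \<omega>)) +
             norm (U s - U' s) * (1 + (norm (Y s \<omega>))\<^sup>2 + (norm (Y' s \<omega>))\<^sup>2)"
      by (intro add_left_mono mult_nonneg_nonneg) auto
    finally show ?thesis by simp
  qed
  from expectation_diff_le[OF s Z.second_moment_integrable[OF s] Z'.second_moment_integrable[OF s] _ this]
  show ?thesis by (simp add: second_moment_matrix_def)
qed

lemma cross_moment_diff_le:
  assumes a: "lipschitz_coefficient a C c" and s: "s \<in> {0..T}" and R: "norm (U s) \<le> R" "norm (U' s) \<le> R"
  shows "norm (Z.cross_moment a s - Z'.cross_moment a s) \<le>
    (c + C) * (1 + R) * (3 * (1 + sup_bound)) * (norm (U s - U' s) + sqrt (mean_square_dist s))"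
proof -
  interpret lipschitz_coefficient a C c by fact
  interpret bounded_bilinear "outer_product :: real^'r \<Rightarrow> real^'d \<Rightarrow> real^'d^'r"
    by (rule bounded_bilinear_outer_product)
  have R0: "0 \<le> R" using R(1) norm_ge_zero order_trans by blast
  have "norm (outer_product (Y s \<omega>) (a s (Z.X s \<omega>)) - outer_product (Y' s \<omega>) (a s (Z'.X s \<omega>))) \<le>
      ((c + C) * (1 + R)) * (norm (Y s \<omega> - Y' s \<omega>) * (1 + norm (Y s \<omega>) + norm (Y' s \<omega>)) +
             norm (U s - U' s) * (1 + (norm (Y s \<omega>))\<^sup>2 + (norm (Y' s \<omega>))\<^sup>2))" for \<omega>
  proof -
    let ?d = "norm (Y s \<omega> - Y' s \<omega>)" and ?\<eta> = "norm (Y s \<omega>)" and ?\<eta>' = "norm (Y' s \<omega>)"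
    let ?u = "norm (U s - U' s)"
    have "outer_product (Y s \<omega>) (a s (Z.X s \<omega>)) - outer_product (Y' s \<omega>) (a s (Z'.X s \<omega>)) =
        outer_product (Y s \<omega> - Y' s \<omega>) (a s (Z.X s \<omega>)) +
        outer_product (Y' s \<omega>) (a s (Z.X s \<omega>) - a s (Z'.X s \<omega>))"
      by (simp add: diff_left diff_right)
    then have "norm (outer_product (Y s \<omega>) (a s (Z.X s \<omega>)) - outer_product (Y' s \<omega>) (a s (Z'.X s \<omega>))) \<le>
        ?d * norm (a s (Z.X s \<omega>)) + ?\<eta>' * norm (a s (Z.X s \<omega>) - a s (Z'.X s \<omega>))"
      by (metis norm_triangle_ineq norm_outer_product)
    also have "\<dots> \<le> ?d * (c * (1 + R) * (1 + ?\<eta>)) + ?\<eta>' * (C * (1 + R) * (?u * (1 + ?\<eta>) + ?d))"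
      using s R by (intro add_mono mult_left_mono growth_composed lipschitz_composed) auto
    also have "\<dots> = (1 + R) * (c * (?d * (1 + ?\<eta>)) + C * (?d * ?\<eta>' + ?u * (?\<eta>' * (1 + ?\<eta>))))"
      by (simp add: algebra_simps)
    also have "\<dots> \<le> (1 + R) * (c * (?d * (1 + ?\<eta> + ?\<eta>') + ?u * (1 + ?\<eta>\<^sup>2 + ?\<eta>'\<^sup>2)) +
        C * (?d * (1 + ?\<eta> + ?\<eta>') + ?u * (1 + ?\<eta>\<^sup>2 + ?\<eta>'\<^sup>2)))"
    proof (intro mult_left_mono add_mono)
      have "?d * (1 + ?\<eta>) \<le> ?d * (1 + ?\<eta> + ?\<eta>')"
        by (intro mult_left_mono) auto
      moreover have "0 \<le> ?u * (1 + ?\<eta>\<^sup>2 + ?\<eta>'\<^sup>2)"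
        by (intro mult_nonneg_nonneg) auto
      ultimately show "?d * (1 + ?\<eta>) \<le> ?d * (1 + ?\<eta> + ?\<eta>') + ?u * (1 + ?\<eta>\<^sup>2 + ?\<eta>'\<^sup>2)"
        by linarith
      show "?\<eta>' * (1 + ?\<eta>) \<le> 1 + ?\<eta>\<^sup>2 + ?\<eta>'\<^sup>2"
        using zero_le_power2[of "?\<eta>' - 1"] zero_le_power2[of "?\<eta> - ?\<eta>'"] zero_le_power2[of ?\<eta>]
        unfolding power2_eq_square by (simp only: algebra_simps)
    qed (use R0 c_nonneg C_nonneg in auto)
    also have "\<dots> = ((c + C) * (1 + R)) * (?d * (1 + ?\<eta> + ?\<eta>') + ?u * (1 + ?\<eta>\<^sup>2 + ?\<eta>'\<^sup>2))"
      by (simp only: distrib_right[of c C, symmetric] mult_ac)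
    finally show ?thesis .
  qed
  from expectation_diff_le[OF s Z.cross_moment_integrable[OF a s] Z'.cross_moment_integrable[OF a s] _ this]
  show ?thesis using R0 c_nonneg C_nonneg by (simp only: Z.cross_moment_def Z'.cross_moment_def) simp
qed

lemma proj_row_diff_le:
  assumes s: "s \<in> {0..T}" and R: "1 \<le> R" "norm (U s) \<le> R" "norm (U' s) \<le> R"
    "norm (matrix_inv (U s ** transpose (U s))) \<le> R" "norm (matrix_inv (U' s ** transpose (U' s))) \<le> R"
  shows "norm (proj_row (U s) - proj_row (U' s)) \<le> R\<^sup>2 * (2 + 2 * R ^ 3) * norm (U s - U' s)"
proof -
  interpret bounded_bilinear "(**) :: real^'d^'r \<Rightarrow> real^'r^'d \<Rightarrow> real^'r^'r"
    by (rule bounded_bilinear_matrix_mult)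
  let ?u = "norm (U s - U' s)" and ?G = "U s ** transpose (U s)" and ?G' = "U' s ** transpose (U' s)"
  have tr: "norm (transpose (U s) - transpose (U' s)) = ?u"
    by (simp add: linear_diff[OF bounded_linear.linear[OF bounded_linear_transpose], symmetric] norm_transpose)
  have "?G - ?G' = (U s - U' s) ** transpose (U s) + U' s ** (transpose (U s) - transpose (U' s))"
    by (simp add: diff_left diff_right)
  then have "norm (?G - ?G') \<le> norm ((U s - U' s) ** transpose (U s)) + norm (U' s ** (transpose (U s) - transpose (U' s)))"
    by (metis norm_triangle_ineq)
  also have "\<dots> \<le> ?u * R + R * ?u"
    using R tr by (intro add_mono order_trans[OF norm_matrix_mult_le] mult_mono) (auto simp: norm_transpose)
  finally have "norm (?G - ?G') \<le> 2 * R * ?u" by simp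
  have "norm (matrix_inv ?G - matrix_inv ?G') \<le> norm (matrix_inv ?G) * norm (matrix_inv ?G') * norm (?G - ?G')"
    using s by (intro norm_matrix_inv_diff_le invertible_gram Z.U_rows Z'.U_rows)
  also have "\<dots> \<le> R * R * (2 * R * ?u)"
    using R \<open>norm (?G - ?G') \<le> 2 * R * ?u\<close> by (intro mult_mono) auto
  finally have inv: "norm (matrix_inv ?G - matrix_inv ?G') \<le> 2 * R ^ 3 * ?u"
    by (simp add: power3_eq_cube)
  have "norm (proj_row (U s) - proj_row (U' s)) \<le>
      R\<^sup>2 * (norm (transpose (U s) - transpose (U' s)) + norm (matrix_inv ?G - matrix_inv ?G') + ?u)"
    using R s unfolding proj_row_eq[OF Z.U_rows[OF s]] proj_row_eq[OF Z'.U_rows[OF s]]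
    by (intro norm_triple_product_diff_le) (auto simp: norm_transpose)
  also have "\<dots> \<le> R\<^sup>2 * (?u + 2 * R ^ 3 * ?u + ?u)"
    using tr inv by (intro mult_left_mono add_mono) auto
  finally show ?thesis by (simp add: algebra_simps)
qed

lemma sum_dist_square_le_gap:
  assumes s: "s \<in> {0..T}"
  shows "(norm (U s - U' s) + sqrt (mean_square_dist s))\<^sup>2 \<le> 2 * gap s"
proof -
  have "(norm (U s - U' s) + sqrt (mean_square_dist s))\<^sup>2 \<le>
      2 * (norm (U s - U' s))\<^sup>2 + 2 * (sqrt (mean_square_dist s))\<^sup>2"
    using zero_le_power2[of "norm (U s - U' s) - sqrt (mean_square_dist s)"]
    by (simp only: power2_sum power2_diff)
  then show ?thesis by (simp add: gap_def)
qed

text \<open>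
  \<open>F\<^sub>1\<close> is Lipschitz along the two solutions: a product of three bounded factors, each of them Lipschitz in
  \<open>\<parallel>U - U'\<parallel> + (\<bbbE> |Y - Y'|\<^sup>2)\<^sup>1\<^sup>/\<^sup>2\<close>.
\<close>

lemma mode_drift_diff_le:
  assumes a: "lipschitz_coefficient a C c"
  obtains K where "0 < K" "\<And>s. s \<in> {0..T} \<Longrightarrow> (norm (Z.mode_drift a s - Z'.mode_drift a s))\<^sup>2 \<le> K * gap s"
proof -
  interpret lipschitz_coefficient a C c by fact
  obtain R1 where R1: "1 \<le> R1" "\<And>s. s \<in> {0..T} \<Longrightarrow> norm (U s) \<le> R1"
    "\<And>s. s \<in> {0..T} \<Longrightarrow> norm (matrix_inv (second_moment_matrix M (Y s))) \<le> R1"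
    "\<And>s. s \<in> {0..T} \<Longrightarrow> norm (matrix_inv (U s ** transpose (U s))) \<le> R1"
    "\<And>s. s \<in> {0..T} \<Longrightarrow> norm (mat 1 - proj_row (U s)) \<le> R1"
    using Z.factors_bounded by blast
  obtain R2 where R2: "1 \<le> R2" "\<And>s. s \<in> {0..T} \<Longrightarrow> norm (U' s) \<le> R2"
    "\<And>s. s \<in> {0..T} \<Longrightarrow> norm (matrix_inv (second_moment_matrix M (Y' s))) \<le> R2"
    "\<And>s. s \<in> {0..T} \<Longrightarrow> norm (matrix_inv (U' s ** transpose (U' s))) \<le> R2"
    "\<And>s. s \<in> {0..T} \<Longrightarrow> norm (mat 1 - proj_row (U' s)) \<le> R2"
    using Z'.factors_bounded by blast
  obtain K1 where K1: "\<And>s. s \<in> {0..T} \<Longrightarrow> norm (Z.cross_moment a s) \<le> K1"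
    using Z.cross_moment_bounded[OF a] by blast
  obtain K2 where K2: "\<And>s. s \<in> {0..T} \<Longrightarrow> norm (Z'.cross_moment a s) \<le> K2"
    using Z'.cross_moment_bounded[OF a] by blast
  \<comment> \<open>One constant that dominates all factors of both solutions.\<close>
  define R where "R = max (max R1 R2) (max K1 K2)"
  have R: "R1 \<le> R" "R2 \<le> R" "K1 \<le> R" "K2 \<le> R" "1 \<le> R"
    using R1(1) by (auto simp: R_def)
  define B where "B = 3 * (1 + sup_bound)"
  have B: "0 \<le> B" using sup_bound_nonneg by (simp add: B_def)
  define K where "K = R\<^sup>2 * (R * R * B + (c + C) * (1 + R) * B + R\<^sup>2 * (2 + 2 * R ^ 3))"
  have lip: "norm (Z.mode_drift a s - Z'.mode_drift a s) \<le> K * (norm (U s - U' s) + sqrt (mean_square_dist s))"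
    if s: "s \<in> {0..T}" for s
  proof -
    define e where "e = norm (U s - U' s) + sqrt (mean_square_dist s)"
    have e: "0 \<le> e" "norm (U s - U' s) \<le> e" by (simp_all add: e_def)
    have bounds: "norm (U s) \<le> R" "norm (U' s) \<le> R"
      "norm (matrix_inv (second_moment_matrix M (Y s))) \<le> R" "norm (matrix_inv (second_moment_matrix M (Y' s))) \<le> R"
      "norm (matrix_inv (U s ** transpose (U s))) \<le> R" "norm (matrix_inv (U' s ** transpose (U' s))) \<le> R"
      "norm (mat 1 - proj_row (U s)) \<le> R" "norm (mat 1 - proj_row (U' s)) \<le> R"
      "norm (Z.cross_moment a s) \<le> R" "norm (Z'.cross_moment a s) \<le> R"
      using R1(2-5)[OF s] R2(2-5)[OF s] K1[OF s] K2[OF s] R(1-4) by linarith+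
    have "norm (matrix_inv (second_moment_matrix M (Y s)) - matrix_inv (second_moment_matrix M (Y' s))) \<le>
        norm (matrix_inv (second_moment_matrix M (Y s))) * norm (matrix_inv (second_moment_matrix M (Y' s))) *
        norm (second_moment_matrix M (Y s) - second_moment_matrix M (Y' s))"
      by (intro norm_matrix_inv_diff_le Z.second_moment_invertible Z'.second_moment_invertible s)
    also have "\<dots> \<le> R * R * (B * e)"
      using second_moment_diff_le[OF s] bounds R unfolding B_def[symmetric] e_def[symmetric]
      by (intro mult_mono) auto
    finally have 1: "norm (matrix_inv (second_moment_matrix M (Y s)) - matrix_inv (second_moment_matrix M (Y' s)))
        \<le> R * R * B * e" by (simp only: mult.assoc)
    have 2: "norm (Z.cross_moment a s - Z'.cross_moment a s) \<le> (c + C) * (1 + R) * B * e"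
      using cross_moment_diff_le[OF a s bounds(1,2)] unfolding B_def[symmetric] e_def[symmetric] .
    have "norm (proj_row (U s) - proj_row (U' s)) \<le> R\<^sup>2 * (2 + 2 * R ^ 3) * norm (U s - U' s)"
      by (rule proj_row_diff_le[OF s R(5) bounds(1,2,5,6)])
    also have "\<dots> \<le> R\<^sup>2 * (2 + 2 * R ^ 3) * e"
      using e R(5) by (intro mult_left_mono) auto
    finally have 3: "norm ((mat 1 - proj_row (U s)) - (mat 1 - proj_row (U' s))) \<le> R\<^sup>2 * (2 + 2 * R ^ 3) * e"
      by (simp add: norm_minus_commute)
    have "norm (Z.mode_drift a s - Z'.mode_drift a s) \<le> R\<^sup>2 *
       (norm (matrix_inv (second_moment_matrix M (Y s)) - matrix_inv (second_moment_matrix M (Y' s))) +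
        norm (Z.cross_moment a s - Z'.cross_moment a s) +
        norm ((mat 1 - proj_row (U s)) - (mat 1 - proj_row (U' s))))"
      unfolding Z.mode_drift_def Z'.mode_drift_def by (intro norm_triple_product_diff_le bounds)
    also have "\<dots> \<le> R\<^sup>2 * (R * R * B * e + (c + C) * (1 + R) * B * e + R\<^sup>2 * (2 + 2 * R ^ 3) * e)"
      by (intro mult_left_mono add_mono 1 2 3) simp
    finally show ?thesis by (simp only: K_def e_def[symmetric] distrib_right mult.assoc)
  qed
  have le: "(norm (Z.mode_drift a s - Z'.mode_drift a s))\<^sup>2 \<le> (K\<^sup>2 * 2 + 1) * gap s" if "s \<in> {0..T}" for s
  proof -
    have "(norm (Z.mode_drift a s - Z'.mode_drift a s))\<^sup>2 \<le> (K * (norm (U s - U' s) + sqrt (mean_square_dist s)))\<^sup>2"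
      by (intro power_mono lip that) simp
    also have "\<dots> \<le> K\<^sup>2 * (2 * gap s)"
      unfolding power_mult_distrib using sum_dist_square_le_gap[OF that] by (rule mult_left_mono) simp
    \<comment> \<open>The summand \<open>1\<close> only makes the constant positive.\<close>
    also have "\<dots> \<le> (K\<^sup>2 * 2 + 1) * gap s"
      using gap_nonneg[of s] by (simp add: algebra_simps)
    finally show ?thesis .
  qed
  show ?thesis
    by (rule that[OF _ le]) (use zero_le_power2[of K] in linarith)
qed

text \<open>
  This serves the drift and the diffusion of \<open>F\<^sub>2\<close> alike.  After the pointwise bound, Fubini moves the
  expectation inside the time integral, where it is at most a constant times the gap.
\<close>

lemma increment_mean_square_le:
  fixes p :: "real^'d^'r \<Rightarrow> 'z::{banach, second_countable_topology} \<Rightarrow> 'e::{real_normed_vector, second_countable_topology}"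
  assumes f: "lipschitz_coefficient f C c"
    and p: "bounded_bilinear p" "\<And>X v. norm (p X v) \<le> norm X * norm v"
  obtains K where "0 \<le> K" "\<And>t. t \<in> {0..T} \<Longrightarrow>
    (\<integral>\<^sup>+\<omega>. (\<integral>\<^sup>+s\<in>{0..t}. ennreal ((norm (p (U s) (f s (Z.X s \<omega>)) - p (U' s) (f s (Z'.X s \<omega>))))\<^sup>2) \<partial>lborel) \<partial>M)
      \<le> ennreal (K * integral {0..t} gap)"
proof -
  interpret lipschitz_coefficient f C c by fact
  obtain R1 where R1: "1 \<le> R1" "\<And>s. s \<in> {0..T} \<Longrightarrow> norm (U s) \<le> R1"
    using Z.factors_bounded by metis
  obtain R2 where R2: "1 \<le> R2" "\<And>s. s \<in> {0..T} \<Longrightarrow> norm (U' s) \<le> R2"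
    using Z'.factors_bounded by metis
  define R where "R = max R1 R2"
  have R: "norm (U s) \<le> R" "norm (U' s) \<le> R" if "s \<in> {0..T}" for s
    using R1(2)[OF that] R2(2)[OF that] by (auto simp: R_def)
  define K where "K = 4 * (c * (1 + R) + R * (C * (1 + R)))\<^sup>2"
  have K: "0 \<le> K" by (simp add: K_def)
  define q where "q s \<omega> = (norm (U s - U' s))\<^sup>2 * (1 + (norm (Y s \<omega>))\<^sup>2) + (norm (Y s \<omega> - Y' s \<omega>))\<^sup>2" for s \<omega>
  have q: "0 \<le> q s \<omega>" for s \<omega> by (simp add: q_def)
  interpret pair_sigma_finite Z.horizon M
    by (intro pair_sigma_finite.intro sigma_finite_measure_restrict_space sigma_finite_lborel
          Z.sigma_finite_measure_axioms) auto
  have [measurable]: "(\<lambda>x. Y (fst x) (snd x)) \<in> borel_measurable (Z.horizon \<Otimes>\<^sub>M M)"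
    "(\<lambda>x. Y' (fst x) (snd x)) \<in> borel_measurable (Z.horizon \<Otimes>\<^sub>M M)"
    using Z.Y_jointly_measurable Z'.Y_jointly_measurable by (simp_all add: case_prod_unfold)
  have [measurable]: "(\<lambda>x. U (fst x)) \<in> borel_measurable (Z.horizon \<Otimes>\<^sub>M M)"
    "(\<lambda>x. U' (fst x)) \<in> borel_measurable (Z.horizon \<Otimes>\<^sub>M M)"
    by (intro measurable_compose[OF measurable_fst] Z.U_measurable Z'.U_measurable)+
  have q_meas: "(\<lambda>x. q (fst x) (snd x)) \<in> borel_measurable (Z.horizon \<Otimes>\<^sub>M M)"
    unfolding q_def by measurable
  have Eq: "(\<integral>\<^sup>+\<omega>. ennreal (K * q s \<omega>) \<partial>M) \<le> ennreal (K * (1 + sup_bound) * gap s)" if s: "s \<in> {0..T}" for s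
  proof -
    note [simp] = Z.Y_square_integrable[OF s] diff_square_integrable[OF s]
    have "integrable M (\<lambda>\<omega>. K * q s \<omega>)" unfolding q_def by simp
    then have "(\<integral>\<^sup>+\<omega>. ennreal (K * q s \<omega>) \<partial>M) = ennreal (\<integral>\<omega>. K * q s \<omega> \<partial>M)"
      using q K by (intro nn_integral_eq_integral) auto
    also have "(\<integral>\<omega>. K * q s \<omega> \<partial>M) = K * ((norm (U s - U' s))\<^sup>2 * (1 + (\<integral>\<omega>. (norm (Y s \<omega>))\<^sup>2 \<partial>M)) + mean_square_dist s)"
      unfolding q_def by (simp add: Z.prob_space)
    also have "\<dots> \<le> K * ((norm (U s - U' s))\<^sup>2 * (1 + sup_bound) + (1 + sup_bound) * mean_square_dist s)"
    proof (intro mult_left_mono add_mono K)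
      show "(\<integral>\<omega>. (norm (Y s \<omega>))\<^sup>2 \<partial>M) \<le> sup_bound"
      proof -
        have "0 \<le> (\<integral>\<omega>. (Z'.Y_sup \<omega>)\<^sup>2 \<partial>M)" by simp
        with Z.Y_square_expectation_le[OF s] show ?thesis unfolding sup_bound_def by linarith
      qed
      show "mean_square_dist s \<le> (1 + sup_bound) * mean_square_dist s"
        using sup_bound_nonneg mult_right_mono[of 1 "1 + sup_bound" "mean_square_dist s"] by simp
    qed auto
    also have "\<dots> = K * (1 + sup_bound) * gap s"
      by (simp add: gap_def algebra_simps)
    finally show ?thesis by (simp add: ennreal_leI)
  qed
  show ?thesis
  proof (rule that[of "K * (1 + sup_bound)"])
    show "0 \<le> K * (1 + sup_bound)" using K sup_bound_nonneg by simp
    fix t assume t: "t \<in> {0..T}"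
    have restrict: "(\<integral>\<^sup>+s\<in>{0..t}. g s \<partial>lborel) = (\<integral>\<^sup>+s. g s * indicator {0..t} s \<partial>Z.horizon)" for g :: "real \<Rightarrow> ennreal"
      using t by (subst nn_integral_restrict_space) (auto intro!: nn_integral_cong split: split_indicator)
    have "(\<integral>\<^sup>+\<omega>. (\<integral>\<^sup>+s\<in>{0..t}. ennreal ((norm (p (U s) (f s (Z.X s \<omega>)) - p (U' s) (f s (Z'.X s \<omega>))))\<^sup>2) \<partial>lborel) \<partial>M)
        \<le> (\<integral>\<^sup>+\<omega>. (\<integral>\<^sup>+s\<in>{0..t}. ennreal (K * q s \<omega>) \<partial>lborel) \<partial>M)"
    proof (intro nn_integral_mono)
      fix \<omega> s
      show "ennreal ((norm (p (U s) (f s (Z.X s \<omega>)) - p (U' s) (f s (Z'.X s \<omega>))))\<^sup>2) * indicator {0..t} s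
        \<le> ennreal (K * q s \<omega>) * indicator {0..t} s"
      proof (cases "s \<in> {0..t}")
        case True
        with t have "0 \<le> s" "s \<in> {0..T}" by auto
        from product_diff_square_le[OF p this(1) R[OF this(2)]]
        show ?thesis unfolding K_def q_def by (intro mult_right_mono ennreal_leI) auto
      qed simp
    qed
    also have "\<dots> = (\<integral>\<^sup>+\<omega>. (\<integral>\<^sup>+s. ennreal (K * q s \<omega>) * indicator {0..t} s \<partial>Z.horizon) \<partial>M)"
      unfolding restrict ..
    also have "\<dots> = (\<integral>\<^sup>+s. (\<integral>\<^sup>+\<omega>. ennreal (K * q s \<omega>) * indicator {0..t} s \<partial>M) \<partial>Z.horizon)"
    proof (rule Fubini')
      have ind: "(indicator {0..t} :: real \<Rightarrow> ennreal) \<in> borel_measurable Z.horizon"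
        by (intro measurable_restrict_space1) auto
      show "(\<lambda>(s, \<omega>). ennreal (K * q s \<omega>) * indicator {0..t} s) \<in> borel_measurable (Z.horizon \<Otimes>\<^sub>M M)"
        unfolding case_prod_unfold
        by (intro borel_measurable_times_ennreal measurable_compose[OF measurable_fst ind]
              measurable_compose[OF borel_measurable_times[OF borel_measurable_const q_meas] measurable_ennreal])
    qed
    also have "\<dots> \<le> (\<integral>\<^sup>+s. ennreal (K * (1 + sup_bound) * gap s) * indicator {0..t} s \<partial>Z.horizon)"
    proof (rule nn_integral_mono)
      fix s assume "s \<in> space Z.horizon"
      then have s: "s \<in> {0..T}" by (simp add: space_restrict_space)
      have "(\<lambda>\<omega>. ennreal (K * q s \<omega>)) \<in> borel_measurable M"
        using Z.Y_measurable[OF s] diff_measurable[OF s] unfolding q_def by measurable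
      then have "(\<integral>\<^sup>+\<omega>. ennreal (K * q s \<omega>) * indicator {0..t} s \<partial>M) = (\<integral>\<^sup>+\<omega>. ennreal (K * q s \<omega>) \<partial>M) * indicator {0..t} s"
        by (rule nn_integral_multc)
      also have "\<dots> \<le> ennreal (K * (1 + sup_bound) * gap s) * indicator {0..t} s"
        by (intro mult_right_mono Eq s) simp
      finally show "(\<integral>\<^sup>+\<omega>. ennreal (K * q s \<omega>) * indicator {0..t} s \<partial>M) \<le> ennreal (K * (1 + sup_bound) * gap s) * indicator {0..t} s" .
    qed
    also have "\<dots> = (\<integral>\<^sup>+s\<in>{0..t}. ennreal (K * (1 + sup_bound) * gap s) \<partial>lborel)"
      unfolding restrict ..
    also have "\<dots> = ennreal (integral {0..t} (\<lambda>s. K * (1 + sup_bound) * gap s))"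
      using t K sup_bound_nonneg gap_nonneg
      by (intro nn_integral_continuous_eq_integral continuous_on_mult_left continuous_on_subset[OF gap_continuous]) auto
    finally show "(\<integral>\<^sup>+\<omega>. (\<integral>\<^sup>+s\<in>{0..t}. ennreal ((norm (p (U s) (f s (Z.X s \<omega>)) - p (U' s) (f s (Z'.X s \<omega>))))\<^sup>2) \<partial>lborel) \<partial>M)
        \<le> ennreal (K * (1 + sup_bound) * integral {0..t} gap)"
      by simp
  qed
qed

end

context low_rank_pair
begin

lemma gap_integral_nonneg: "0 \<le> integral {0..t} gap"
  if "t \<in> {0..T}"
  using that gap_nonneg
  by (intro integral_nonneg integrable_continuous_interval continuous_on_subset[OF gap_continuous]) auto

lemma modes_diff_square_le:
  assumes a: "lipschitz_coefficient a C c"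
    and U: "\<And>t. t \<in> {0..T} \<Longrightarrow> U t = F1 M a \<phi> U Y t"
    and U': "\<And>t. t \<in> {0..T} \<Longrightarrow> U' t = F1 M a \<phi> U' Y' t"
  obtains K where "0 < K" "\<And>t. t \<in> {0..T} \<Longrightarrow> (norm (U t - U' t))\<^sup>2 \<le> K * integral {0..t} gap"
proof -
  obtain K where K: "0 < K"
    "\<And>s. s \<in> {0..T} \<Longrightarrow> (norm (Z.mode_drift a s - Z'.mode_drift a s))\<^sup>2 \<le> K * gap s"
    using mode_drift_diff_le[OF a] by blast
  have le: "(norm (U t - U' t))\<^sup>2 \<le> (T * K + 1) * integral {0..t} gap" if t: "t \<in> {0..T}" for t
  proof -
    let ?G = "\<lambda>s. Z.mode_drift a s - Z'.mode_drift a s"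
    have int: "set_integrable lborel {0..t} (Z.mode_drift a)" "set_integrable lborel {0..t} (Z'.mode_drift a)"
      by (rule Z.mode_drift_set_integrable[OF a t] Z'.mode_drift_set_integrable[OF a t])+
    have "U t = \<phi> + (LINT s:{0..t}|lborel. Z.mode_drift a s)"
      "U' t = \<phi> + (LINT s:{0..t}|lborel. Z'.mode_drift a s)"
      using U[OF t] U'[OF t]
      by (simp_all only: F1_def Z.mode_drift_def Z.cross_moment_def Z'.mode_drift_def Z'.cross_moment_def)
    then have "U t - U' t = (LINT s:{0..t}|lborel. ?G s)"
      using set_integral_diff(2)[OF int] by simp
    then have "ennreal ((norm (U t - U' t))\<^sup>2) \<le> ennreal t * (\<integral>\<^sup>+s\<in>{0..t}. ennreal ((norm (?G s))\<^sup>2) \<partial>lborel)"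
      using norm_set_integral_square_le[OF set_integral_diff(1)[OF int]] t by simp
    also have "\<dots> \<le> ennreal t * (\<integral>\<^sup>+s\<in>{0..t}. ennreal (K * gap s) \<partial>lborel)"
      using t K(2) by (intro mult_left_mono nn_integral_mono) (auto split: split_indicator intro: ennreal_leI)
    also have "(\<integral>\<^sup>+s\<in>{0..t}. ennreal (K * gap s) \<partial>lborel) = ennreal (integral {0..t} (\<lambda>s. K * gap s))"
      using t K(1) gap_nonneg
      by (intro nn_integral_continuous_eq_integral continuous_on_mult_left continuous_on_subset[OF gap_continuous]) auto
    finally have "ennreal ((norm (U t - U' t))\<^sup>2) \<le> ennreal (t * (K * integral {0..t} gap))"
      using t K(1) gap_integral_nonneg[OF t] by (simp add: ennreal_mult)
    then have "(norm (U t - U' t))\<^sup>2 \<le> t * (K * integral {0..t} gap)"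
      using t K(1) gap_integral_nonneg[OF t] by (subst (asm) ennreal_le_iff) auto
    also have "\<dots> \<le> T * (K * integral {0..t} gap)"
      using t K(1) gap_integral_nonneg[OF t] by (intro mult_right_mono) auto
    also have "\<dots> \<le> (T * K + 1) * integral {0..t} gap"
      using gap_integral_nonneg[OF t] by (simp add: algebra_simps)
    finally show ?thesis .
  qed
  have "0 < T * K + 1" using K(1) Z.T_nonneg by (simp add: add_nonneg_pos)
  then show ?thesis by (rule that[OF _ le])
qed

end

context filtered_brownian_motion
begin

text \<open>
  The difference \<open>Y t - Y' t\<close> is a drift integral plus the difference of two Ito integrals.  The first
  is estimated path by path with Cauchy--Schwarz in time, the second in mean square.
\<close>

lemma factors_mean_square_le:
  fixes a :: "real \<Rightarrow> real^'d \<Rightarrow> real^'d" and b :: "real \<Rightarrow> real^'d \<Rightarrow> real^'m^'d"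
    and U U' :: "real \<Rightarrow> real^'d^'r"
  assumes pair: "low_rank_pair M T U U' Y Y'"
    and a: "lipschitz_coefficient a C c" and b: "lipschitz_coefficient b C c"
    and Y: "\<And>t. t \<in> {0..T} \<Longrightarrow> is_F2 M F W a b \<xi> U Y t (Y t)"
    and Y': "\<And>t. t \<in> {0..T} \<Longrightarrow> is_F2 M F W a b \<xi> U' Y' t (Y' t)"
  obtains K where "0 \<le> K"
    "\<And>t. t \<in> {0..T} \<Longrightarrow> (\<integral>\<omega>. (norm (Y t \<omega> - Y' t \<omega>))\<^sup>2 \<partial>M) \<le> K * integral {0..t} (low_rank_pair.gap M U U' Y Y')"
proof -
  interpret low_rank_pair M T U U' Y Y' by fact
  note mv = bounded_bilinear_matrix_vector_mult norm_matrix_vector_mult_le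
  note mm = bounded_bilinear_matrix_mult norm_matrix_mult_le
  let ?\<delta>a = "\<lambda>s \<omega>. U s *v a s (Z.X s \<omega>) - U' s *v a s (Z'.X s \<omega>)"
  let ?\<delta>b = "\<lambda>s \<omega>. U s ** b s (Z.X s \<omega>) - U' s ** b s (Z'.X s \<omega>)"
  obtain Ka where Ka: "0 \<le> Ka" "\<And>t. t \<in> {0..T} \<Longrightarrow>
      (\<integral>\<^sup>+\<omega>. (\<integral>\<^sup>+s\<in>{0..t}. ennreal ((norm (?\<delta>a s \<omega>))\<^sup>2) \<partial>lborel) \<partial>M) \<le> ennreal (Ka * integral {0..t} gap)"
    using increment_mean_square_le[OF a mv] by blast
  obtain Kb where Kb: "0 \<le> Kb" "\<And>t. t \<in> {0..T} \<Longrightarrow>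
      (\<integral>\<^sup>+\<omega>. (\<integral>\<^sup>+s\<in>{0..t}. ennreal ((norm (?\<delta>b s \<omega>))\<^sup>2) \<partial>lborel) \<partial>M) \<le> ennreal (Kb * integral {0..t} gap)"
    using increment_mean_square_le[OF b mm] by blast
  have processes: "low_rank_process M T U Y" "low_rank_process M T U' Y'"
    by unfold_locales
  interpret horizon: sigma_finite_measure Z.horizon
    by (intro sigma_finite_measure_restrict_space sigma_finite_lborel) auto
  show ?thesis
  proof (rule that)
    show "0 \<le> 2 * (T * Ka) + 18 * Kb" using Ka(1) Kb(1) Z.T_nonneg by simp
    fix t assume t: "t \<in> {0..T}"
    let ?J = "integral {0..t} gap"
    have J: "0 \<le> ?J" by (rule gap_integral_nonneg[OF t])
    obtain I where I: "has_ito_integral M F W t (\<lambda>s \<omega>. U s ** b s (Z.X s \<omega>)) I"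
      "AE \<omega> in M. Y t \<omega> = \<xi> \<omega> + (LINT s:{0..t}|lborel. U s *v a s (Z.X s \<omega>)) + I \<omega>"
      using Y[OF t] unfolding is_F2_def by blast
    obtain I' where I': "has_ito_integral M F W t (\<lambda>s \<omega>. U' s ** b s (Z'.X s \<omega>)) I'"
      "AE \<omega> in M. Y' t \<omega> = \<xi> \<omega> + (LINT s:{0..t}|lborel. U' s *v a s (Z'.X s \<omega>)) + I' \<omega>"
      using Y'[OF t] unfolding is_F2_def by blast
    have [measurable]: "I \<in> borel_measurable M" "I' \<in> borel_measurable M"
      using I(1) I'(1) by (auto simp: has_ito_integral_def)
    \<comment> \<open>\<open>?Q\<close> is the squared drift difference integrated over time, the Cauchy--Schwarz bound for the drift term.\<close>
    let ?Q = "\<lambda>\<omega>. \<integral>\<^sup>+s\<in>{0..t}. ennreal ((norm (?\<delta>a s \<omega>))\<^sup>2) \<partial>lborel"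
    have Q_meas: "?Q \<in> borel_measurable M"
    proof -
      have eq: "?Q = (\<lambda>\<omega>. \<integral>\<^sup>+s. ennreal ((norm (?\<delta>a s \<omega>))\<^sup>2) * indicator {0..t} s \<partial>Z.horizon)"
        using t by (subst nn_integral_restrict_space) (auto intro!: ext nn_integral_cong split: split_indicator)
      have ind: "(indicator {0..t} :: real \<Rightarrow> ennreal) \<in> borel_measurable Z.horizon"
        by (intro measurable_restrict_space1) auto
      have "(\<lambda>q. ?\<delta>a (fst q) (snd q)) \<in> borel_measurable (Z.horizon \<Otimes>\<^sub>M M)"
        by (intro borel_measurable_diff lipschitz_coefficient.integrand_jointly_measurable[OF a _ mv(1)] processes)
      from measurable_compose[OF measurable_pair_swap' this]
      have \<delta>: "(\<lambda>q. ?\<delta>a (snd q) (fst q)) \<in> borel_measurable (M \<Otimes>\<^sub>M Z.horizon)"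
        by (simp add: case_prod_unfold del: transpose_matrix_vector)
      have "(\<lambda>q. (norm (?\<delta>a (snd q) (fst q)))\<^sup>2) \<in> borel_measurable (M \<Otimes>\<^sub>M Z.horizon)"
        by (rule borel_measurable_power[OF measurable_compose[OF \<delta> borel_measurable_norm]])
      then have "(\<lambda>q. ennreal ((norm (?\<delta>a (snd q) (fst q)))\<^sup>2) * indicator {0..t} (snd q)) \<in> borel_measurable (M \<Otimes>\<^sub>M Z.horizon)"
        by (intro borel_measurable_times_ennreal measurable_compose[OF _ measurable_ennreal]
              measurable_compose[OF measurable_snd ind])
      then show ?thesis
        unfolding eq by (intro horizon.borel_measurable_nn_integral) (simp add: case_prod_unfold del: transpose_matrix_vector)
    qed
    have pointwise: "AE \<omega> in M. ennreal ((norm (Y t \<omega> - Y' t \<omega>))\<^sup>2) \<le>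
        2 * (ennreal t * ?Q \<omega>) + 2 * ennreal ((norm (I \<omega> - I' \<omega>))\<^sup>2)"
      using I(2) I'(2) AE_space
    proof eventually_elim
      case (elim \<omega>)
      have int: "set_integrable lborel {0..t} (\<lambda>s. U s *v a s (Z.X s \<omega>))"
        "set_integrable lborel {0..t} (\<lambda>s. U' s *v a s (Z'.X s \<omega>))"
        by (rule lipschitz_coefficient.integrand_set_integrable[OF a processes(1) mv elim(3) t]
              lipschitz_coefficient.integrand_set_integrable[OF a processes(2) mv elim(3) t])+
      let ?D = "LINT s:{0..t}|lborel. ?\<delta>a s \<omega>"
      have "Y t \<omega> - Y' t \<omega> = ?D - (I' \<omega> - I \<omega>)"
        unfolding elim(1,2) set_integral_diff(2)[OF int] by simp
      then have "(norm (Y t \<omega> - Y' t \<omega>))\<^sup>2 \<le> 2 * (norm ?D)\<^sup>2 + 2 * (norm (I \<omega> - I' \<omega>))\<^sup>2"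
        using norm_diff_square_le[of ?D "I' \<omega> - I \<omega>"] by (simp only: norm_minus_commute[of "I' \<omega>"])
      then have "ennreal ((norm (Y t \<omega> - Y' t \<omega>))\<^sup>2) \<le> ennreal (2 * (norm ?D)\<^sup>2 + 2 * (norm (I \<omega> - I' \<omega>))\<^sup>2)"
        by (rule ennreal_leI)
      also have "\<dots> = 2 * ennreal ((norm ?D)\<^sup>2) + 2 * ennreal ((norm (I \<omega> - I' \<omega>))\<^sup>2)"
        by (simp add: ennreal_mult)
      also have "\<dots> \<le> 2 * (ennreal t * ?Q \<omega>) + 2 * ennreal ((norm (I \<omega> - I' \<omega>))\<^sup>2)"
        using t by (intro add_right_mono mult_left_mono norm_set_integral_square_le set_integral_diff(1)[OF int]) auto
      finally show ?case .
    qed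
    have "ennreal (mean_square_dist t) = (\<integral>\<^sup>+\<omega>. ennreal ((norm (Y t \<omega> - Y' t \<omega>))\<^sup>2) \<partial>M)"
      using diff_square_integrable[OF t] by (intro nn_integral_eq_integral[symmetric]) auto
    also have "\<dots> \<le> (\<integral>\<^sup>+\<omega>. 2 * (ennreal t * ?Q \<omega>) + 2 * ennreal ((norm (I \<omega> - I' \<omega>))\<^sup>2) \<partial>M)"
      by (rule nn_integral_mono_AE[OF pointwise])
    also have "\<dots> = 2 * (ennreal t * (\<integral>\<^sup>+\<omega>. ?Q \<omega> \<partial>M)) + 2 * (\<integral>\<^sup>+\<omega>. ennreal ((norm (I \<omega> - I' \<omega>))\<^sup>2) \<partial>M)"
      using Q_meas by (subst nn_integral_add) (auto simp: nn_integral_cmult simp del: transpose_matrix_vector)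
    also have "\<dots> \<le> 2 * (ennreal t * ennreal (Ka * ?J)) + 2 * (9 * ennreal (Kb * ?J))"
      using t by (intro add_mono mult_left_mono Ka(2) order_trans[OF ito_integral_diff_le[OF I(1) I'(1)]] Kb(2)) auto
    also have "\<dots> = ennreal (2 * (t * (Ka * ?J)) + 2 * (9 * (Kb * ?J)))"
      using t Ka(1) Kb(1) J by (simp add: ennreal_mult)
    finally have "mean_square_dist t \<le> 2 * (t * (Ka * ?J)) + 2 * (9 * (Kb * ?J))"
      using t Ka(1) Kb(1) J by (subst (asm) ennreal_le_iff) auto
    also have "\<dots> \<le> 2 * (T * (Ka * ?J)) + 2 * (9 * (Kb * ?J))"
      using t Ka(1) J by (intro add_right_mono mult_left_mono mult_right_mono) auto
    finally show "mean_square_dist t \<le> (2 * (T * Ka) + 18 * Kb) * ?J"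
      by (simp add: algebra_simps)
  qed
qed

end

section \<open>Pathwise uniqueness\<close>

lemma continuous_eq_from_rationals:
  fixes f g :: "real \<Rightarrow> 'b::real_normed_vector"
  assumes "0 < T" "continuous_on {0..T} f" "continuous_on {0..T} g"
    and eq: "\<And>t. t \<in> {0..T} \<inter> \<rat> \<Longrightarrow> f t = g t" and t: "t \<in> {0..T}"
  shows "f t = g t"
proof -
  have cl: "closure ({0<..<T} \<inter> \<rat>) = {0..T}"
    using \<open>0 < T\<close> closure_open_Int_superset[of "{0<..<T}" \<rat>] by (simp add: Rats_closure_real)
  have "continuous_on (closure ({0<..<T} \<inter> \<rat>)) (\<lambda>t. f t - g t)"
    unfolding cl by (intro continuous_intros assms)
  moreover have "f s - g s = 0" if "s \<in> {0<..<T} \<inter> \<rat>" for s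
    using eq[of s] that by auto
  ultimately have "f t - g t = 0"
    by (rule continuous_constant_on_closure) (use t cl in auto)
  then show ?thesis by simp
qed

theorem theorem3p6:
  fixes M :: "'a measure" and F :: "real \<Rightarrow> 'a measure"
    and W :: "real \<Rightarrow> 'a \<Rightarrow> real^'m"
    and a :: "real \<Rightarrow> real^'d \<Rightarrow> real^'d" and b :: "real \<Rightarrow> real^'d \<Rightarrow> real^'m^'d"
    and \<phi> :: "real^'d^'r" and \<xi> :: "'a \<Rightarrow> real^'r"
    and U U' :: "real \<Rightarrow> real^'d^'r" and Y Y' :: "real \<Rightarrow> 'a \<Rightarrow> real^'r"
    and C_Lip C_lgb T :: real
  assumes "usual_filtered_prob_space M F"
    and "standard_brownian_motion M F W"
    and "CARD('r) \<le> CARD('d)"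
    and "jointly_measurable a" and "jointly_measurable b"
    and "C_Lip > 0" and "lipschitz_condition C_Lip a b"
    and "C_lgb > 0" and "linear_growth_bound C_lgb a b"
    and "orthonormal_rows \<phi>"
    and "\<xi> \<in> borel_measurable (F 0)" and "integrable M (\<lambda>\<omega>. (norm (\<xi> \<omega>))\<^sup>2)"
    and "independent_components M \<xi>"
    and "T > 0"
    and "F1_F2_fixed_point M F W a b \<phi> \<xi> T U Y"
    and "F1_F2_fixed_point M F W a b \<phi> \<xi> T U' Y'"
  shows "{\<omega> \<in> space M. (SUP t\<in>{0..T}. (norm (U t - U' t))\<^sup>2)
            + (SUP t\<in>{0..T}. norm (Y t \<omega> - Y' t \<omega>)) > 0} \<in> null_sets M"
proof -
  interpret usual_filtered_prob_space M F by fact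
  interpret filtered_brownian_motion M F W
    by unfold_locales fact
  have dom: "F_domain M F T U Y" "F_domain M F T U' Y'"
    and U: "\<And>t. t \<in> {0..T} \<Longrightarrow> U t = F1 M a \<phi> U Y t" "\<And>t. t \<in> {0..T} \<Longrightarrow> U' t = F1 M a \<phi> U' Y' t"
    and Y: "\<And>t. t \<in> {0..T} \<Longrightarrow> is_F2 M F W a b \<xi> U Y t (Y t)" "\<And>t. t \<in> {0..T} \<Longrightarrow> is_F2 M F W a b \<xi> U' Y' t (Y' t)"
    using assms(15,16) unfolding F1_F2_fixed_point_def by blast+
  have pair: "low_rank_pair M T U U' Y Y'"
    using dom \<open>0 < T\<close> unfolding F_domain_def by unfold_locales auto
  interpret low_rank_pair M T U U' Y Y' by (rule pair)
  have bound: "(norm (a s x))\<^sup>2 \<le> C_lgb * (1 + (norm x)\<^sup>2)" "(norm (b s x))\<^sup>2 \<le> C_lgb * (1 + (norm x)\<^sup>2)"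
    if "0 \<le> s" for s x
  proof -
    have "(norm (a s x))\<^sup>2 + (norm (b s x))\<^sup>2 \<le> C_lgb * (1 + (norm x)\<^sup>2)"
      using assms(9) that unfolding linear_growth_bound_def by blast
    then show "(norm (a s x))\<^sup>2 \<le> C_lgb * (1 + (norm x)\<^sup>2)" "(norm (b s x))\<^sup>2 \<le> C_lgb * (1 + (norm x)\<^sup>2)"
      using zero_le_power2[of "norm (a s x)"] zero_le_power2[of "norm (b s x)"] by linarith+
  qed
  have coeff: "lipschitz_coefficient a C_Lip (sqrt C_lgb)" "lipschitz_coefficient b C_Lip (sqrt C_lgb)"
    using assms(4-8) bound unfolding lipschitz_condition_def by (auto intro!: lipschitz_coefficientI)
  obtain K where K: "0 < K" "\<And>t. t \<in> {0..T} \<Longrightarrow> (norm (U t - U' t))\<^sup>2 \<le> K * integral {0..t} gap"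
    using modes_diff_square_le[OF coeff(1) U] by blast
  obtain K' where K': "0 \<le> K'" "\<And>t. t \<in> {0..T} \<Longrightarrow> mean_square_dist t \<le> K' * integral {0..t} gap"
    using factors_mean_square_le[OF pair coeff Y] by blast
  have gap0: "gap t = 0" if "t \<in> {0..T}" for t
  proof (rule antisym)
    show "gap t \<le> 0"
    proof (rule gronwall_zero[OF gap_continuous _ _ that])
      show "0 < K + K'" using K(1) K'(1) by simp
      show "gap s \<le> (K + K') * integral {0..s} gap" if "s \<in> {0..T}" for s
        using K(2)[OF that] K'(2)[OF that] by (simp add: gap_def distrib_right)
    qed
  qed (rule gap_nonneg)
  have eq: "U t = U' t" "AE \<omega> in M. Y t \<omega> = Y' t \<omega>" if t: "t \<in> {0..T}" for t
  proof -
    have "0 \<le> (norm (U t - U' t))\<^sup>2" "0 \<le> mean_square_dist t" by simp_all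
    then have "(norm (U t - U' t))\<^sup>2 = 0" and zero: "mean_square_dist t = 0"
      using gap0[OF t] unfolding gap_def by linarith+
    then show "U t = U' t" by simp
    from zero have "AE \<omega> in M. (norm (Y t \<omega> - Y' t \<omega>))\<^sup>2 = 0"
      by (subst (asm) integral_nonneg_eq_0_iff_AE[OF diff_square_integrable[OF t]]) auto
    then show "AE \<omega> in M. Y t \<omega> = Y' t \<omega>" by simp
  qed
  have "AE \<omega> in M. \<forall>t\<in>{0..T} \<inter> \<rat>. Y t \<omega> = Y' t \<omega>"
    using eq(2) by (intro AE_ball_countable[THEN iffD2]) (auto intro: countable_rat)
  then have "AE \<omega> in M. \<not> (SUP t\<in>{0..T}. (norm (U t - U' t))\<^sup>2) + (SUP t\<in>{0..T}. norm (Y t \<omega> - Y' t \<omega>)) > 0"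
    using AE_space
  proof eventually_elim
    case (elim \<omega>)
    have "Y t \<omega> = Y' t \<omega>" if "t \<in> {0..T}" for t
      using \<open>0 < T\<close> Z.Y_continuous[OF elim(2)] Z'.Y_continuous[OF elim(2)] _ that
      by (rule continuous_eq_from_rationals) (use elim(1) in auto)
    then have "(SUP t\<in>{0..T}. norm (Y t \<omega> - Y' t \<omega>)) = (SUP t\<in>{0..T}. 0)"
      by (intro SUP_cong) auto
    moreover have "(SUP t\<in>{0..T}. (norm (U t - U' t))\<^sup>2) = (SUP t\<in>{0..T}. 0)"
      using eq(1) by (intro SUP_cong) auto
    ultimately show ?case using \<open>0 < T\<close> by simp
  qed
  then show ?thesis
    unfolding AE_iff_null_sets by simp
qed

end
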